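(* Assume that $M^2$ is a smooth Riemannian $2$-manifold without boundary (not necessarily compact). If a smooth function $f\in C^\infty(M^2)$ satisfies $(\Delta_\phi+h(x))f=0$, $h\in C^\infty(M^2)$, then except for a few isolated points, the set of nodes of $f$ forms a smooth curve.
   Context: Here $\phi\in C^\infty(M^2)$ is a smooth real-valued function, and the Witten-Laplacian is $\Delta_\phi:=\Delta-\langle\nabla\phi,\nabla\cdot\rangle$, where $\nabla$ and $\Delta$ are the gradient and Laplace operators of the Riemannian manifold $(M^2,\langle\cdot,\cdot\rangle)$. The set of nodes (nodal set) of $f$ is $f^{-1}(0)$.
   Formalization: The function f is additionally assumed not to vanish identically on any connected component of M; without this the claim fails, e.g. for f = 0, whose set of nodes is the whole surface. *)

theory Defs
  imports "HOL-Analysis.Analysis"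
begin

text \<open>Only used for open sets \<open>S\<close>, where \<open>at x\<close> and \<open>at x within S\<close> agree.\<close>

primrec Ck_on :: "nat \<Rightarrow> 'a::euclidean_space set \<Rightarrow> ('a \<Rightarrow> 'b::real_normed_vector) \<Rightarrow> bool" where
  "Ck_on 0 S F \<longleftrightarrow> continuous_on S F"
| "Ck_on (Suc k) S F \<longleftrightarrow>
     (\<forall>x\<in>S. F differentiable (at x)) \<and>
     (\<forall>v\<in>Basis. Ck_on k S (\<lambda>x. frechet_derivative F (at x) v))"

definition smooth_on :: "'a::euclidean_space set \<Rightarrow> ('a \<Rightarrow> 'b::real_normed_vector) \<Rightarrow> bool" where
  "smooth_on S F \<longleftrightarrow> (\<forall>k. Ck_on k S F)"


section \<open>Smooth surfaces\<close>

text \<open>A chart is a pair of a domain and a coordinate map; the values of the coordinate map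
  outside the domain are irrelevant.\<close>

type_synonym 'a chart = "'a set \<times> ('a \<Rightarrow> real^2)"

abbreviation chart_dom :: "'a chart \<Rightarrow> 'a set" where
  "chart_dom \<equiv> fst"

abbreviation chart_map :: "'a chart \<Rightarrow> 'a \<Rightarrow> real^2" where
  "chart_map \<equiv> snd"

abbreviation chart_img :: "'a chart \<Rightarrow> (real^2) set" where
  "chart_img c \<equiv> chart_map c ` chart_dom c"

abbreviation chart_inv :: "'a chart \<Rightarrow> real^2 \<Rightarrow> 'a" where
  "chart_inv c \<equiv> inv_into (chart_dom c) (chart_map c)"

definition is_chart :: "'a topology \<Rightarrow> 'a chart \<Rightarrow> bool" where
  "is_chart M c \<longleftrightarrow>
     openin M (chart_dom c) \<and> open (chart_img c) \<and>
     homeomorphic_map (subtopology M (chart_dom c)) (top_of_set (chart_img c)) (chart_map c)"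

definition transition :: "'a chart \<Rightarrow> 'a chart \<Rightarrow> real^2 \<Rightarrow> real^2" where
  "transition c d = chart_map d \<circ> chart_inv c"

definition smoothly_compatible :: "'a chart \<Rightarrow> 'a chart \<Rightarrow> bool" where
  "smoothly_compatible c d \<longleftrightarrow>
     smooth_on (chart_map c ` (chart_dom c \<inter> chart_dom d)) (transition c d) \<and>
     smooth_on (chart_map d ` (chart_dom c \<inter> chart_dom d)) (transition d c)"

text \<open>The smooth structure is given by an atlas \<open>A\<close>, which need not be maximal; the charts of
  the maximal atlas it generates are described by \<open>smooth_chart\<close> below.
  All charts map onto open subsets of the plane, so there is no boundary.\<close>

definition smooth_surface :: "'a topology \<Rightarrow> 'a chart set \<Rightarrow> bool" where
  "smooth_surface M A \<longleftrightarrow>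
     Hausdorff_space M \<and> second_countable M \<and>
     (\<forall>c\<in>A. is_chart M c) \<and> (\<Union>c\<in>A. chart_dom c) = topspace M \<and>
     (\<forall>c\<in>A. \<forall>d\<in>A. smoothly_compatible c d)"

definition smooth_chart :: "'a topology \<Rightarrow> 'a chart set \<Rightarrow> 'a chart \<Rightarrow> bool" where
  "smooth_chart M A c \<longleftrightarrow> is_chart M c \<and> (\<forall>d\<in>A. smoothly_compatible c d)"

definition coord_rep :: "'a chart \<Rightarrow> ('a \<Rightarrow> real) \<Rightarrow> real^2 \<Rightarrow> real" where
  "coord_rep c f = f \<circ> chart_inv c"

definition smooth_fun :: "'a chart set \<Rightarrow> ('a \<Rightarrow> real) \<Rightarrow> bool" where
  "smooth_fun A f \<longleftrightarrow> (\<forall>c\<in>A. smooth_on (chart_img c) (coord_rep c f))"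

text \<open>A smooth curve in the surface is a one-dimensional embedded submanifold: near each of its
  points, the surface has coordinates in which it becomes the first coordinate axis.
  It may be empty or have several components.\<close>

definition smooth_curve :: "'a topology \<Rightarrow> 'a chart set \<Rightarrow> 'a set \<Rightarrow> bool" where
  "smooth_curve M A N \<longleftrightarrow>
     N \<subseteq> topspace M \<and>
     (\<forall>p\<in>N. \<exists>c. smooth_chart M A c \<and> p \<in> chart_dom c \<and>
        chart_map c ` (N \<inter> chart_dom c) = {u \<in> chart_img c. u $ 2 = 0})"


section \<open>Riemannian metrics\<close>

text \<open>A symmetric 2-tensor is given by its components: \<open>g c u\<close> is its matrix with respect to
  the coordinate frame of the chart \<open>c \<in> A\<close>, at the point with coordinates \<open>u\<close> in \<open>c\<close>.
  The last conjunct is the transformation law of covariant 2-tensors.\<close>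

type_synonym 'a metric_components = "'a chart \<Rightarrow> real^2 \<Rightarrow> real^2^2"

definition inner_product_matrix :: "real^2^2 \<Rightarrow> bool" where
  "inner_product_matrix B \<longleftrightarrow> transpose B = B \<and> (\<forall>x. x \<noteq> 0 \<longrightarrow> x \<bullet> (B *v x) > 0)"

definition riemannian_metric :: "'a chart set \<Rightarrow> 'a metric_components \<Rightarrow> bool" where
  "riemannian_metric A g \<longleftrightarrow>
     (\<forall>c\<in>A. smooth_on (chart_img c) (g c) \<and> (\<forall>u\<in>chart_img c. inner_product_matrix (g c u))) \<and>
     (\<forall>c\<in>A. \<forall>d\<in>A. \<forall>p\<in>chart_dom c \<inter> chart_dom d.
        let J = jacobian (transition c d) (at (chart_map c p))
        in g c (chart_map c p) = transpose J ** g d (chart_map d p) ** J)"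

definition riemannian_surface ::
    "'a topology \<Rightarrow> 'a chart set \<Rightarrow> 'a metric_components \<Rightarrow> bool" where
  "riemannian_surface M A g \<longleftrightarrow> smooth_surface M A \<and> riemannian_metric A g"


section \<open>Gradient, Laplacian and Witten-Laplacian\<close>

definition partial_deriv :: "2 \<Rightarrow> (real^2 \<Rightarrow> real) \<Rightarrow> real^2 \<Rightarrow> real" where
  "partial_deriv i F u = frechet_derivative F (at u) (axis i 1)"

text \<open>Here \<open>G\<close> is the matrix function of a metric on a plane domain.\<close>

definition coord_grad :: "(real^2 \<Rightarrow> real^2^2) \<Rightarrow> (real^2 \<Rightarrow> real) \<Rightarrow> real^2 \<Rightarrow> real^2" where
  "coord_grad G F u = matrix_inv (G u) *v (\<chi> j. partial_deriv j F u)"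

definition coord_div :: "(real^2 \<Rightarrow> real^2^2) \<Rightarrow> (real^2 \<Rightarrow> real^2) \<Rightarrow> real^2 \<Rightarrow> real" where
  "coord_div G X u =
     (\<Sum>i\<in>UNIV. partial_deriv i (\<lambda>v. sqrt (det (G v)) * X v $ i) u) / sqrt (det (G u))"

definition coord_laplacian :: "(real^2 \<Rightarrow> real^2^2) \<Rightarrow> (real^2 \<Rightarrow> real) \<Rightarrow> real^2 \<Rightarrow> real" where
  "coord_laplacian G F = coord_div G (coord_grad G F)"

definition coord_grad_inner ::
    "(real^2 \<Rightarrow> real^2^2) \<Rightarrow> (real^2 \<Rightarrow> real) \<Rightarrow> (real^2 \<Rightarrow> real) \<Rightarrow> real^2 \<Rightarrow> real" where
  "coord_grad_inner G E F u = coord_grad G E u \<bullet> (G u *v coord_grad G F u)"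

text \<open>The operators on the surface are computed in an arbitrary chart around the point;
  that the choice does not matter is proved in \<open>laplacian_eq\<close> and \<open>grad_inner_eq\<close>.
  The sign is such that the Laplacian is \<open>div grad\<close>.\<close>

definition chart_at :: "'a chart set \<Rightarrow> 'a \<Rightarrow> 'a chart" where
  "chart_at A p = (SOME c. c \<in> A \<and> p \<in> chart_dom c)"

definition laplacian :: "'a chart set \<Rightarrow> 'a metric_components \<Rightarrow> ('a \<Rightarrow> real) \<Rightarrow> 'a \<Rightarrow> real" where
  "laplacian A g f p =
     (let c = chart_at A p in coord_laplacian (g c) (coord_rep c f) (chart_map c p))"

definition grad_inner ::
    "'a chart set \<Rightarrow> 'a metric_components \<Rightarrow> ('a \<Rightarrow> real) \<Rightarrow> ('a \<Rightarrow> real) \<Rightarrow> 'a \<Rightarrow> real" where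
  "grad_inner A g e f p =
     (let c = chart_at A p
      in coord_grad_inner (g c) (coord_rep c e) (coord_rep c f) (chart_map c p))"

definition witten_laplacian ::
    "'a chart set \<Rightarrow> 'a metric_components \<Rightarrow> ('a \<Rightarrow> real) \<Rightarrow> ('a \<Rightarrow> real) \<Rightarrow> 'a \<Rightarrow> real" where
  "witten_laplacian A g \<phi> f p = laplacian A g f p - grad_inner A g \<phi> f p"

definition nodal_set :: "'a topology \<Rightarrow> ('a \<Rightarrow> real) \<Rightarrow> 'a set" where
  "nodal_set M f = {p \<in> topspace M. f p = 0}"


section \<open>Independence of the chart\<close>

lemma smooth_on_differentiable: "smooth_on S F \<Longrightarrow> x \<in> S \<Longrightarrow> F differentiable (at x)"
  unfolding smooth_on_def by (metis Ck_on.simps(2))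

lemma smooth_on_continuous: "smooth_on S F \<Longrightarrow> continuous_on S F"
  unfolding smooth_on_def by (metis Ck_on.simps(1))

lemma smooth_on_frechet:
  assumes "smooth_on S F" "v \<in> Basis"
  shows "smooth_on S (\<lambda>x. frechet_derivative F (at x) v)"
  using assms unfolding smooth_on_def by (metis Ck_on.simps(2))

lemma smooth_on_partial: "smooth_on S F \<Longrightarrow> smooth_on S (partial_deriv i F)"
  using smooth_on_frechet[of S F "axis i 1"]
  by (simp add: partial_deriv_def[abs_def] axis_in_Basis_iff)

lemma partial_deriv_eqI: "(F has_derivative D) (at u) \<Longrightarrow> partial_deriv i F u = D (axis i 1)"
  unfolding partial_deriv_def by (metis frechet_derivative_at)

lemma differentiable_has_derivative:
  "F differentiable (at x) \<Longrightarrow> (F has_derivative frechet_derivative F (at x)) (at x)"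
  by (rule frechet_derivative_works[THEN iffD1])

lemma frechet_derivative_eqI:
  "(F has_derivative D) (at x) \<Longrightarrow> frechet_derivative F (at x) = D"
  by (rule frechet_derivative_at[symmetric])

lemma Ck_on_cong:
  assumes "open S" "Ck_on k S P" "\<And>x. x \<in> S \<Longrightarrow> P x = Q x"
  shows "Ck_on k S Q"
  using assms(2,3)
proof (induction k arbitrary: P Q)
  case 0
  then show ?case unfolding Ck_on.simps by (metis continuous_on_cong)
next
  case (Suc k)
  have d: "(Q has_derivative frechet_derivative P (at x)) (at x)" if "x \<in> S" for x
  proof (rule has_derivative_transform_within_open)
    show "(P has_derivative frechet_derivative P (at x)) (at x)"
      using Suc.prems(1) that by (intro differentiable_has_derivative) simp
  qed (use assms(1) that Suc.prems(2) in auto)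
  have e: "frechet_derivative P (at x) v = frechet_derivative Q (at x) v" if "x \<in> S" for x v
    using frechet_derivative_eqI[OF d[OF that]] by simp
  show ?case
    unfolding Ck_on.simps
  proof (intro conjI ballI)
    show "Q differentiable (at x)" if "x \<in> S" for x
      using d[OF that] by (rule differentiableI)
    show "Ck_on k S (\<lambda>x. frechet_derivative Q (at x) v)" if "v \<in> Basis" for v
    proof (rule Suc.IH)
      show "Ck_on k S (\<lambda>x. frechet_derivative P (at x) v)" using Suc.prems(1) that by simp
    qed (rule e)
  qed
qed

lemma Ck_on_bounded_linear:
  assumes "bounded_linear L" "open S"
  shows "Ck_on k S F \<Longrightarrow> Ck_on k S (\<lambda>x. L (F x))"
proof (induction k arbitrary: F)
  case 0
  then show ?case
    unfolding Ck_on.simps by (rule bounded_linear.continuous_on[OF assms(1)])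
next
  case (Suc k)
  have d: "((\<lambda>x. L (F x)) has_derivative (\<lambda>h. L (frechet_derivative F (at x) h))) (at x)"
    if "x \<in> S" for x
    using Suc.prems that
    by (intro bounded_linear.has_derivative[OF assms(1)] differentiable_has_derivative) simp
  have e: "L (frechet_derivative F (at x) v) = frechet_derivative (\<lambda>x. L (F x)) (at x) v"
    if "x \<in> S" for x v
    using frechet_derivative_eqI[OF d[OF that]] by simp
  show ?case
    unfolding Ck_on.simps
  proof (intro conjI ballI)
    show "(\<lambda>x. L (F x)) differentiable (at x)" if "x \<in> S" for x
      using d[OF that] by (rule differentiableI)
    show "Ck_on k S (\<lambda>x. frechet_derivative (\<lambda>x. L (F x)) (at x) v)" if "v \<in> Basis" for v
    proof (rule Ck_on_cong[OF assms(2)])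
      show "Ck_on k S (\<lambda>x. L (frechet_derivative F (at x) v))"
        by (rule Suc.IH) (use Suc.prems that in simp)
    qed (rule e)
  qed
qed

lemma smooth_on_bounded_linear:
  assumes "bounded_linear L" "open S" "smooth_on S F"
  shows "smooth_on S (\<lambda>x. L (F x))"
  using assms(3) Ck_on_bounded_linear[OF assms(1,2)] unfolding smooth_on_def by simp

lemma smooth_on_nth: "open S \<Longrightarrow> smooth_on S F \<Longrightarrow> smooth_on S (\<lambda>x. F x $ i)"
  by (rule smooth_on_bounded_linear[OF bounded_linear_vec_nth])

lemma partial_line_DERIV:
  assumes "F differentiable (at (u + t *\<^sub>R axis i 1))"
  shows "((\<lambda>t. F (u + t *\<^sub>R axis i 1)) has_real_derivative
            partial_deriv i F (u + t *\<^sub>R axis i 1)) (at t)"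
proof -
  let ?D = "frechet_derivative F (at (u + t *\<^sub>R axis i 1))"
  have D: "(F has_derivative ?D) (at (u + t *\<^sub>R axis i 1))"
    using assms by (simp add: frechet_derivative_works)
  have "((\<lambda>t. u + t *\<^sub>R axis i (1::real)) has_derivative (\<lambda>h. h *\<^sub>R axis i 1)) (at t)"
    by (auto intro!: derivative_eq_intros)
  from has_derivative_compose[OF this D]
  have "((\<lambda>t. F (u + t *\<^sub>R axis i 1)) has_derivative (\<lambda>h. ?D (h *\<^sub>R axis i 1))) (at t)" .
  moreover have "?D (h *\<^sub>R axis i 1) = partial_deriv i F (u + t *\<^sub>R axis i 1) * h" for h
    using linear_scale[OF has_derivative_linear[OF D]] by (simp add: partial_deriv_def)
  ultimately show ?thesis by (simp add: has_field_derivative_def)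
qed

text \<open>Towards the symmetry of second partial derivatives.\<close>

lemma second_difference:
  assumes F: "smooth_on U F" and U: "open U" "ball u r \<subseteq> U" and t: "0 < t" "2 * t < r"
  shows "\<exists>q\<in>ball u r. F (u + t *\<^sub>R axis i 1 + t *\<^sub>R axis j 1) - F (u + t *\<^sub>R axis i 1)
            - F (u + t *\<^sub>R axis j 1) + F u = t * t * partial_deriv j (partial_deriv i F) q"
proof -
  have inb: "u + a *\<^sub>R axis i 1 + b *\<^sub>R axis j 1 \<in> ball u r"
    if "0 \<le> a" "a \<le> t" "0 \<le> b" "b \<le> t" for a b
  proof -
    have "norm (a *\<^sub>R axis i (1::real) + b *\<^sub>R axis j 1) \<le> a + b"
      using norm_triangle_ineq[of "a *\<^sub>R axis i (1::real)" "b *\<^sub>R axis j 1"] that by (simp add: norm_axis_1)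
    also have "\<dots> < r" using that t by linarith
    finally have "dist u (u + (a *\<^sub>R axis i (1::real) + b *\<^sub>R axis j 1)) < r"
      unfolding dist_commute[of u] by (simp add: dist_norm)
    then show ?thesis by (simp add: add.assoc)
  qed
  define H where "H s = F (u + t *\<^sub>R axis j 1 + s *\<^sub>R axis i 1) - F (u + s *\<^sub>R axis i 1)" for s
  define P where "P = partial_deriv i F"
  have P: "smooth_on U P" unfolding P_def by (rule smooth_on_partial[OF F])
  have dH: "(H has_real_derivative P (u + t *\<^sub>R axis j 1 + s *\<^sub>R axis i 1) - P (u + s *\<^sub>R axis i 1)) (at s)"
    if "0 \<le> s" "s \<le> t" for s
  proof -
    have "u + s *\<^sub>R axis i 1 + t *\<^sub>R axis j 1 = u + t *\<^sub>R axis j 1 + s *\<^sub>R axis i (1::real)"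
      by (simp only: ac_simps)
    moreover have "u + s *\<^sub>R axis i 1 + t *\<^sub>R axis j 1 \<in> ball u r" "u + s *\<^sub>R axis i 1 \<in> ball u r"
      using inb[of s t] inb[of s 0] that t(1) by simp_all
    ultimately have 1: "u + t *\<^sub>R axis j 1 + s *\<^sub>R axis i 1 \<in> U" and 2: "u + s *\<^sub>R axis i 1 \<in> U"
      using U(2) by (metis subsetD)+
    show ?thesis
      unfolding H_def P_def
      by (intro DERIV_diff partial_line_DERIV smooth_on_differentiable[OF F] 1 2)
  qed
  have "\<exists>s>0. s < t \<and> H t - H 0 =
      (t - 0) * (P (u + t *\<^sub>R axis j 1 + s *\<^sub>R axis i 1) - P (u + s *\<^sub>R axis i 1))"
    using t(1) by (rule MVT2) (rule dH)
  then obtain s where s: "0 < s" "s < t"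
    "H t - H 0 = (t - 0) * (P (u + t *\<^sub>R axis j 1 + s *\<^sub>R axis i 1) - P (u + s *\<^sub>R axis i 1))"
    by (elim exE conjE)
  define K where "K s' = P (u + s *\<^sub>R axis i 1 + s' *\<^sub>R axis j 1)" for s'
  have dK: "(K has_real_derivative partial_deriv j P (u + s *\<^sub>R axis i 1 + s' *\<^sub>R axis j 1)) (at s')"
    if "0 \<le> s'" "s' \<le> t" for s'
    unfolding K_def
    using inb[of s s'] that s U
    by (intro partial_line_DERIV smooth_on_differentiable[OF P]) auto
  have "\<exists>z>0. z < t \<and> K t - K 0 =
      (t - 0) * partial_deriv j P (u + s *\<^sub>R axis i 1 + z *\<^sub>R axis j 1)"
    using t(1) by (rule MVT2) (rule dK)
  then obtain z where z: "0 < z" "z < t"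
    "K t - K 0 = (t - 0) * partial_deriv j P (u + s *\<^sub>R axis i 1 + z *\<^sub>R axis j 1)"
    by (elim exE conjE)
  have "H t - H 0 = t * (K t - K 0)"
    unfolding s(3) K_def by (simp add: ac_simps)
  then have "H t - H 0 = t * t * partial_deriv j P (u + s *\<^sub>R axis i 1 + z *\<^sub>R axis j 1)"
    using z(3) by simp
  moreover have "H t - H 0 = F (u + t *\<^sub>R axis i 1 + t *\<^sub>R axis j 1) - F (u + t *\<^sub>R axis i 1)
            - F (u + t *\<^sub>R axis j 1) + F u"
    by (simp add: H_def add.assoc add.commute[of "t *\<^sub>R axis j 1"])
  moreover have "u + s *\<^sub>R axis i 1 + z *\<^sub>R axis j 1 \<in> ball u r"
    using s z by (intro inb) auto
  ultimately show ?thesis unfolding P_def by (intro bexI) simp_all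
qed

lemma partial_deriv_commute:
  assumes F: "smooth_on U F" and U: "open U" "u \<in> U"
  shows "partial_deriv i (partial_deriv j F) u = partial_deriv j (partial_deriv i F) u"
proof (rule ccontr)
  let ?A = "partial_deriv i (partial_deriv j F)" and ?B = "partial_deriv j (partial_deriv i F)"
  assume ne: "?A u \<noteq> ?B u"
  define e where "e = \<bar>?A u - ?B u\<bar> / 2"
  have e: "e > 0" using ne by (simp add: e_def)
  have "continuous_on U ?A" "continuous_on U ?B"
    by (intro smooth_on_continuous smooth_on_partial F)+
  then have "isCont ?A u" "isCont ?B u"
    using U by (simp_all add: continuous_on_eq_continuous_at)
  then have "\<exists>r>0. \<forall>x. dist x u < r \<longrightarrow> dist (?A x) (?A u) < e"
    and ex2: "\<exists>r>0. \<forall>x. dist x u < r \<longrightarrow> dist (?B x) (?B u) < e"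
    using e unfolding continuous_at_eps_delta dist_norm by simp_all
  then obtain r1 where r1: "r1 > 0" "\<forall>x. dist x u < r1 \<longrightarrow> dist (?A x) (?A u) < e"
    by (elim exE conjE)
  obtain r2 where r2: "r2 > 0" "\<forall>x. dist x u < r2 \<longrightarrow> dist (?B x) (?B u) < e"
    using ex2 by (elim exE conjE)
  obtain r3 where r3: "r3 > 0" "ball u r3 \<subseteq> U" using U open_contains_ball by blast
  define r where "r = min r1 (min r2 r3)"
  have r: "r > 0" "ball u r \<subseteq> U" using r1(1) r2(1) r3 by (auto simp: r_def)
  define t where "t = r / 3"
  have t: "0 < t" "2 * t < r" using r by (auto simp: t_def)
  obtain q where q: "q \<in> ball u r" "F (u + t *\<^sub>R axis i 1 + t *\<^sub>R axis j 1) - F (u + t *\<^sub>R axis i 1)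
            - F (u + t *\<^sub>R axis j 1) + F u = t * t * ?B q"
    using second_difference[OF F U(1) r(2) t, of i j] by (elim bexE)
  obtain q' where q': "q' \<in> ball u r" "F (u + t *\<^sub>R axis j 1 + t *\<^sub>R axis i 1) - F (u + t *\<^sub>R axis j 1)
            - F (u + t *\<^sub>R axis i 1) + F u = t * t * ?A q'"
    using second_difference[OF F U(1) r(2) t, of j i] by (elim bexE)
  have "F (u + t *\<^sub>R axis j 1 + t *\<^sub>R axis i 1) = F (u + t *\<^sub>R axis i 1 + t *\<^sub>R axis j (1::real))"
    by (simp only: ac_simps)
  then have "t * t * ?A q' = t * t * ?B q" using q(2) q'(2) by linarith
  then have "?A q' = ?B q" using t(1) by simp
  moreover have "dist (?A q') (?A u) < e" "dist (?B q) (?B u) < e"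
    using r1(2)[rule_format, of q'] r2(2)[rule_format, of q] q(1) q'(1)
    by (simp_all add: r_def dist_commute)
  ultimately have "\<bar>?A u - ?B u\<bar> < e + e" unfolding dist_real_def by linarith
  then show False by (simp add: e_def)
qed

lemma vec2_eq_iff: "(x :: 'a^2) = y \<longleftrightarrow> x $ 1 = y $ 1 \<and> x $ 2 = y $ 2"
  by (simp add: vec_eq_iff forall_2)

lemma matrix_vector_2:
  "((B::real^2^2) *v x) $ i = B $ i $ 1 * x $ 1 + B $ i $ 2 * x $ 2"
  by (simp add: matrix_vector_mult_def sum_2)

lemma inner_product_matrix_det:
  assumes "inner_product_matrix B" shows "det B > 0"
proof -
  have sym: "B $ 2 $ 1 = B $ 1 $ 2"
  proof -
    have "transpose B $ 1 $ 2 = B $ 1 $ 2" using assms by (simp add: inner_product_matrix_def)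
    then show ?thesis by (simp add: transpose_def)
  qed
  have pos: "x \<noteq> 0 \<Longrightarrow> x \<bullet> (B *v x) > 0" for x
    using assms by (simp add: inner_product_matrix_def)
  have 1: "B $ 1 $ 1 > 0"
    using pos[of "vector [1, 0]"] by (simp add: inner_vec_def sum_2 matrix_vector_2 vec2_eq_iff)
  have "B $ 1 $ 1 * det B > 0"
    using pos[of "vector [- (B $ 1 $ 2), B $ 1 $ 1]"] 1 sym
    by (simp add: inner_vec_def sum_2 matrix_vector_2 vec2_eq_iff det_2 algebra_simps)
  then show ?thesis using 1 by (simp add: zero_less_mult_iff)
qed

lemma matrix_inv_eq_iff:
  assumes "det (B::real^2^2) \<noteq> 0"
  shows "matrix_inv B *v b = w \<longleftrightarrow> B *v w = b"
proof -
  have "invertible B" using assms by (simp add: invertible_det_nz)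
  then have "B ** matrix_inv B = mat 1 \<and> matrix_inv B ** B = mat 1"
    unfolding invertible_def matrix_inv_def by (rule someI_ex)
  then show ?thesis by (metis matrix_vector_mul_assoc matrix_vector_mul_lid)
qed

lemma coord_grad_2:
  assumes "det (G u) \<noteq> 0"
  shows "coord_grad G F u $ 1 = (G u $ 2 $ 2 * partial_deriv 1 F u - G u $ 1 $ 2 * partial_deriv 2 F u) / det (G u)"
    and "coord_grad G F u $ 2 = (G u $ 1 $ 1 * partial_deriv 2 F u - G u $ 2 $ 1 * partial_deriv 1 F u) / det (G u)"
proof -
  let ?w = "coord_grad G F u"
  have "G u *v ?w = (\<chi> j. partial_deriv j F u)"
    using matrix_inv_eq_iff[OF assms] unfolding coord_grad_def by blast
  then have *: "G u $ 1 $ 1 * ?w $ 1 + G u $ 1 $ 2 * ?w $ 2 = partial_deriv 1 F u"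
    "G u $ 2 $ 1 * ?w $ 1 + G u $ 2 $ 2 * ?w $ 2 = partial_deriv 2 F u"
    by (simp_all add: vec2_eq_iff matrix_vector_2)
  show "?w $ 1 = (G u $ 2 $ 2 * partial_deriv 1 F u - G u $ 1 $ 2 * partial_deriv 2 F u) / det (G u)"
    using assms unfolding *[symmetric] by (simp add: field_simps det_2)
  show "?w $ 2 = (G u $ 1 $ 1 * partial_deriv 2 F u - G u $ 2 $ 1 * partial_deriv 1 F u) / det (G u)"
    using assms unfolding *[symmetric] by (simp add: field_simps det_2)
qed


lemma partial_deriv_cong:
  assumes "open S" "u \<in> S" "\<And>x. x \<in> S \<Longrightarrow> P x = Q x"
  shows "partial_deriv i P u = partial_deriv i Q u"
proof -
  have "(P has_derivative D) (at u) \<longleftrightarrow> (Q has_derivative D) (at u)" for D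
    using has_derivative_transform_within_open[of P D u UNIV S Q]
      has_derivative_transform_within_open[of Q D u UNIV S P] assms by auto
  then show ?thesis by (simp add: partial_deriv_def frechet_derivative_def)
qed

lemma differentiable_cong_open:
  assumes "P differentiable (at u)" "open S" "u \<in> S" "\<And>x. x \<in> S \<Longrightarrow> P x = Q x"
  shows "Q differentiable (at u)"
  using has_derivative_transform_within_open[of P _ u UNIV S Q] assms
  unfolding differentiable_def by blast

lemma partial_deriv_mult:
  assumes "P differentiable (at u)" "Q differentiable (at u)"
  shows "partial_deriv i (\<lambda>x. P x * Q x) u = partial_deriv i P u * Q u + P u * partial_deriv i Q u"
  using partial_deriv_eqI[OF has_derivative_mult[OF assms[THEN differentiable_has_derivative]], of i]
  by (simp add: partial_deriv_def)

lemma partial_deriv_diff: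
  assumes "P differentiable (at u)" "Q differentiable (at u)"
  shows "partial_deriv i (\<lambda>x. P x - Q x) u = partial_deriv i P u - partial_deriv i Q u"
  using partial_deriv_eqI[OF has_derivative_diff[OF assms[THEN differentiable_has_derivative]], of i]
  by (simp add: partial_deriv_def)

lemma partial_deriv_cmult:
  assumes "P differentiable (at u)"
  shows "partial_deriv i (\<lambda>x. r * P x) u = r * partial_deriv i P u"
  using partial_deriv_eqI[OF has_derivative_mult_right[OF assms[THEN differentiable_has_derivative]], of i]
  by (simp add: partial_deriv_def)

lemma differentiable_sqrt:
  fixes F :: "'a::real_normed_vector \<Rightarrow> real"
  assumes "F differentiable (at x)" "F x > 0"
  shows "(\<lambda>x. sqrt (F x)) differentiable (at x)"
  using has_derivative_real_sqrt[OF assms(2) differentiable_has_derivative[OF assms(1)]]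
  by (rule differentiableI)

text \<open>A change of coordinates \<open>T\<close>; \<open>G\<close> and \<open>G'\<close> are the components of one metric in the two
  coordinate systems.\<close>

locale coord_change =
  fixes U V :: "(real^2) set" and T :: "real^2 \<Rightarrow> real^2" and G G' :: "real^2 \<Rightarrow> real^2^2"
  assumes U: "open U" and V: "open V" and TU: "T ` U \<subseteq> V"
    and T: "smooth_on U T" and G': "smooth_on V G'"
    and innerG: "u \<in> U \<Longrightarrow> inner_product_matrix (G u)"
    and innerG': "v \<in> V \<Longrightarrow> inner_product_matrix (G' v)"
    and law: "u \<in> U \<Longrightarrow> G u = transpose (jacobian T (at u)) ** G' (T u) ** jacobian T (at u)"
begin

abbreviation "J u \<equiv> jacobian T (at u)"
abbreviation "T1 \<equiv> \<lambda>u. T u $ 1"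
abbreviation "T2 \<equiv> \<lambda>u. T u $ 2"

lemma T_der: "u \<in> U \<Longrightarrow> (T has_derivative frechet_derivative T (at u)) (at u)"
  by (intro differentiable_has_derivative smooth_on_differentiable[OF T])

lemma J_nth: "u \<in> U \<Longrightarrow> J u $ i $ j = partial_deriv j (\<lambda>u. T u $ i) u"
  using partial_deriv_eqI[OF bounded_linear.has_derivative[OF bounded_linear_vec_nth T_der], of u j i]
  by (simp add: jacobian_def matrix_def)

lemma det_G: "u \<in> U \<Longrightarrow> det (G u) = (det (J u))\<^sup>2 * det (G' (T u))"
  by (simp add: law det_mul power2_eq_square)

lemma det_J: "u \<in> U \<Longrightarrow> det (J u) \<noteq> 0"
  using det_G[of u] inner_product_matrix_det[OF innerG, of u] by auto

lemma partial_compose: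
  assumes "u \<in> U" "H differentiable (at (T u))"
  shows "partial_deriv j (\<lambda>x. H (T x)) u =
           partial_deriv 1 H (T u) * J u $ 1 $ j + partial_deriv 2 H (T u) * J u $ 2 $ j"
proof -
  let ?D = "frechet_derivative T (at u)" and ?D' = "frechet_derivative H (at (T u))"
  let ?x = "?D (axis j 1)"
  have D': "(H has_derivative ?D') (at (T u))"
    by (rule differentiable_has_derivative[OF assms(2)])
  have "((\<lambda>x. H (T x)) has_derivative (\<lambda>h. ?D' (?D h))) (at u)"
    using T_der[OF assms(1)] D' by (rule has_derivative_compose)
  then have 1: "partial_deriv j (\<lambda>x. H (T x)) u = ?D' ?x"
    by (rule partial_deriv_eqI)
  have l: "linear ?D'" by (rule has_derivative_linear[OF D'])
  have "?x = ?x $ 1 *\<^sub>R axis 1 1 + ?x $ 2 *\<^sub>R axis 2 1"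
    by (simp add: vec2_eq_iff axis_def)
  then have "?D' ?x = ?D' (?x $ 1 *\<^sub>R axis 1 1 + ?x $ 2 *\<^sub>R axis 2 1)" by metis
  also have "\<dots> = ?x $ 1 * ?D' (axis 1 1) + ?x $ 2 * ?D' (axis 2 1)"
    by (simp add: linear_add[OF l] linear_scale[OF l])
  finally show ?thesis
    unfolding 1 by (simp add: jacobian_def matrix_def partial_deriv_def mult.commute)
qed

lemma J_grad:
  assumes F': "smooth_on V F'" and F: "\<And>x. x \<in> U \<Longrightarrow> F x = F' (T x)" and u: "u \<in> U"
  shows "J u *v coord_grad G F u = coord_grad G' F' (T u)"
proof -
  let ?w = "coord_grad G F u"
  have Tu: "T u \<in> V" using u TU by auto
  have dG: "det (G u) \<noteq> 0" "det (G' (T u)) \<noteq> 0"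
    using inner_product_matrix_det innerG[OF u] innerG'[OF Tu] by force+
  have 1: "G u *v ?w = (\<chi> j. partial_deriv j F u)"
    using matrix_inv_eq_iff[OF dG(1)] unfolding coord_grad_def by blast
  have "partial_deriv j F u = partial_deriv j (\<lambda>x. F' (T x)) u" for j
    by (rule partial_deriv_cong[OF U u F])
  then have "(\<chi> j. partial_deriv j F u) = transpose (J u) *v (\<chi> j. partial_deriv j F' (T u))"
    by (simp add: partial_compose[OF u smooth_on_differentiable[OF F' Tu]] vec2_eq_iff
        matrix_vector_2 transpose_def mult.commute)
  moreover have "G u *v ?w = transpose (J u) *v (G' (T u) *v (J u *v ?w))"
    by (simp add: law[OF u] matrix_vector_mul_assoc matrix_mul_assoc)
  ultimately have "transpose (J u) *v (G' (T u) *v (J u *v ?w)) =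
      transpose (J u) *v (\<chi> j. partial_deriv j F' (T u))" using 1 by simp
  moreover have "det (transpose (J u)) \<noteq> 0" using det_J[OF u] by simp
  ultimately have "G' (T u) *v (J u *v ?w) = (\<chi> j. partial_deriv j F' (T u))"
    using matrix_inv_eq_iff by metis
  then show ?thesis
    using matrix_inv_eq_iff[OF dG(2)] unfolding coord_grad_def by metis
qed

lemma grad_inner_change:
  assumes "smooth_on V E'" "\<And>x. x \<in> U \<Longrightarrow> E x = E' (T x)"
    and "smooth_on V F'" "\<And>x. x \<in> U \<Longrightarrow> F x = F' (T x)" and u: "u \<in> U"
  shows "coord_grad_inner G E F u = coord_grad_inner G' E' F' (T u)"
proof -
  have "coord_grad_inner G E F u =
      coord_grad G E u \<bullet> (transpose (J u) *v (G' (T u) *v (J u *v coord_grad G F u)))"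
    by (simp add: coord_grad_inner_def law[OF u] matrix_vector_mul_assoc matrix_mul_assoc)
  also have "\<dots> = (J u *v coord_grad G E u) \<bullet> (G' (T u) *v (J u *v coord_grad G F u))"
    by (metis dot_lmul_matrix vector_transpose_matrix)
  finally show ?thesis
    by (simp add: coord_grad_inner_def J_grad[OF assms(1,2) u] J_grad[OF assms(3,4) u])
qed

lemma G'_differentiable: "v \<in> V \<Longrightarrow> (\<lambda>v. G' v $ i $ j) differentiable (at v)"
  by (intro smooth_on_differentiable[of V] smooth_on_nth V G')

lemma flux_differentiable:
  assumes F': "smooth_on V F'" and v: "v \<in> V"
  shows "(\<lambda>v. sqrt (det (G' v)) * coord_grad G' F' v $ i) differentiable (at v)"
proof -
  have pos: "v \<in> V \<Longrightarrow> det (G' v) > 0" for v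
    using inner_product_matrix_det[OF innerG'] .
  then have nz: "v \<in> V \<Longrightarrow> det (G' v) \<noteq> 0" for v by force
  have dF: "partial_deriv j F' differentiable (at v)" for j
    by (rule smooth_on_differentiable[OF smooth_on_partial[OF F'] v])
  have dd: "(\<lambda>v. det (G' v)) differentiable (at v)"
    unfolding det_2 by (intro differentiable_diff differentiable_mult G'_differentiable v)
  have "(\<lambda>v. coord_grad G' F' v $ 1) differentiable (at v)"
    by (rule differentiable_cong_open[OF _ V v coord_grad_2(1)[OF nz, symmetric]])
       (intro differentiable_divide differentiable_diff differentiable_mult G'_differentiable v dF dd nz)
  moreover have "(\<lambda>v. coord_grad G' F' v $ 2) differentiable (at v)"
    by (rule differentiable_cong_open[OF _ V v coord_grad_2(2)[OF nz, symmetric]])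
       (intro differentiable_divide differentiable_diff differentiable_mult G'_differentiable v dF dd nz)
  ultimately have "(\<lambda>v. coord_grad G' F' v $ i) differentiable (at v)"
    using exhaust_2[of i] by auto
  then show ?thesis
    by (intro differentiable_mult differentiable_sqrt dd pos v)
qed

lemma laplacian_change:
  assumes F': "smooth_on V F'" and F: "\<And>x. x \<in> U \<Longrightarrow> F x = F' (T x)" and u: "u \<in> U"
  shows "coord_laplacian G F u = coord_laplacian G' F' (T u)"
proof -
  define a b c d where "a = partial_deriv 1 T1" and "b = partial_deriv 2 T1"
    and "c = partial_deriv 1 T2" and "d = partial_deriv 2 T2"
  have sT: "smooth_on U T1" "smooth_on U T2" by (intro smooth_on_nth U T)+
  have sm: "smooth_on U a" "smooth_on U b" "smooth_on U c" "smooth_on U d"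
    unfolding a_def b_def c_def d_def by (intro smooth_on_partial sT)+
  note df = sm[THEN smooth_on_differentiable, OF u]
  have J: "J x $ 1 $ 1 = a x" "J x $ 1 $ 2 = b x" "J x $ 2 $ 1 = c x" "J x $ 2 $ 2 = d x"
    if "x \<in> U" for x
    using that by (simp_all add: J_nth a_def b_def c_def d_def)
  define D where "D x = a x * d x - b x * c x" for x
  have D: "det (J x) = D x" if "x \<in> U" for x
    using that by (simp add: det_2 J D_def)
  define s where "s = sgn (D u)"
  have Du: "D u \<noteq> 0" using det_J[OF u] D[OF u] by simp
  define W where "W = U \<inter> (\<lambda>x. s * D x) -` {0<..}"
  have "continuous_on U (\<lambda>x. s * D x)"
    unfolding D_def by (intro continuous_intros smooth_on_continuous sm)
  then have W: "open W"
    unfolding W_def using U by (intro continuous_open_preimage) auto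
  have uW: "u \<in> W" using u Du by (auto simp: W_def s_def sgn_if)
  have WU: "W \<subseteq> U" by (auto simp: W_def)
  have ab: "\<bar>D x\<bar> = s * D x" if "x \<in> W" for x
    using that Du by (auto simp: W_def s_def sgn_if split: if_splits)
  define Y where "Y i v = sqrt (det (G' v)) * coord_grad G' F' v $ i" for i v
  define X where "X i x = sqrt (det (G x)) * coord_grad G F x $ i" for i x
  have Tu: "T u \<in> V" using u TU by auto
  have dY: "Y i differentiable (at (T u))" for i
    unfolding Y_def by (rule flux_differentiable[OF F' Tu])
  have Tdiff: "T differentiable (at u)" by (rule smooth_on_differentiable[OF T u])
  have dYT: "(\<lambda>x. Y i (T x)) differentiable (at u)" for i
    using has_derivative_compose[OF T_der[OF u] differentiable_has_derivative[OF dY]]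
    by (rule differentiableI)
  have X: "X 1 x = s * (d x * Y 1 (T x) - b x * Y 2 (T x))"
          "X 2 x = s * (a x * Y 2 (T x) - c x * Y 1 (T x))" if x: "x \<in> W" for x
  proof -
    have xU: "x \<in> U" using x WU by auto
    let ?w = "coord_grad G F x" and ?w' = "coord_grad G' F' (T x)"
    have "?w' $ 1 = a x * ?w $ 1 + b x * ?w $ 2" "?w' $ 2 = c x * ?w $ 1 + d x * ?w $ 2"
      using J_grad[OF F' F xU] J[OF xU] by (simp_all add: vec2_eq_iff matrix_vector_2)
    then have w: "D x * ?w $ 1 = d x * ?w' $ 1 - b x * ?w' $ 2"
       "D x * ?w $ 2 = a x * ?w' $ 2 - c x * ?w' $ 1"
      by (simp_all add: D_def algebra_simps)
    have r: "sqrt (det (G x)) = s * D x * sqrt (det (G' (T x)))"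
      by (simp add: det_G[OF xU] D[OF xU] real_sqrt_mult ab[OF x])
    have X: "X i x = s * sqrt (det (G' (T x))) * (D x * ?w $ i)" for i
      by (simp add: X_def r)
    show "X 1 x = s * (d x * Y 1 (T x) - b x * Y 2 (T x))"
          "X 2 x = s * (a x * Y 2 (T x) - c x * Y 1 (T x))"
      unfolding X w Y_def by (simp_all add: algebra_simps)
  qed
  have X1: "partial_deriv 1 (X 1) u =
      partial_deriv 1 (\<lambda>x. s * (d x * Y 1 (T x) - b x * Y 2 (T x))) u"
    by (rule partial_deriv_cong[OF W uW X(1)])
  have X2: "partial_deriv 2 (X 2) u =
      partial_deriv 2 (\<lambda>x. s * (a x * Y 2 (T x) - c x * Y 1 (T x))) u"
    by (rule partial_deriv_cong[OF W uW X(2)])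
  have comm: "partial_deriv 1 b u = partial_deriv 2 a u" "partial_deriv 1 d u = partial_deriv 2 c u"
    unfolding a_def b_def c_def d_def
    by (rule partial_deriv_commute[OF sT(1) U u] partial_deriv_commute[OF sT(2) U u])+
  have m: "(\<lambda>x. p x * Y i (T x)) differentiable (at u)" if "p differentiable (at u)" for p i
    using that dYT by (rule differentiable_mult)
  have p: "partial_deriv k (\<lambda>x. s * (p x * Y i (T x) - q x * Y j (T x))) u =
      s * ((partial_deriv k p u * Y i (T u) + p u * partial_deriv k (\<lambda>x. Y i (T x)) u)
         - (partial_deriv k q u * Y j (T u) + q u * partial_deriv k (\<lambda>x. Y j (T x)) u))"
    if "p differentiable (at u)" "q differentiable (at u)" for k i j p q
    by (simp only: partial_deriv_cmult[OF differentiable_diff[OF m[OF that(1)] m[OF that(2)]]]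
        partial_deriv_diff[OF m[OF that(1)] m[OF that(2)]]
        partial_deriv_mult[OF that(1) dYT] partial_deriv_mult[OF that(2) dYT])
  have "partial_deriv 1 (X 1) u + partial_deriv 2 (X 2) u =
      s * D u * (partial_deriv 1 (Y 1) (T u) + partial_deriv 2 (Y 2) (T u))"
    unfolding X1 X2 p[OF df(4,2)] p[OF df(1,3)] partial_compose[OF u dY] J[OF u] comm D_def
    by (simp only: ring_distribs mult.assoc) (simp add: ac_simps)
  moreover have "sqrt (det (G u)) = s * D u * sqrt (det (G' (T u)))"
    by (simp add: det_G[OF u] D[OF u] real_sqrt_mult ab[OF uW])
  moreover have "s * D u \<noteq> 0" using uW by (auto simp: W_def)
  ultimately show ?thesis
    by (simp add: coord_laplacian_def coord_div_def sum_2 X_def[abs_def] Y_def[abs_def])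
qed

end

lemma coord_change_charts:
  assumes M: "riemannian_surface M A g" and c: "c \<in> A" and d: "d \<in> A"
  shows "coord_change (chart_map c ` (chart_dom c \<inter> chart_dom d)) (chart_img d) (transition c d) (g c) (g d)"
proof
  have ch: "is_chart M c" "is_chart M d" and comp: "smoothly_compatible c d" and met: "riemannian_metric A g"
    using assms by (auto simp: riemannian_surface_def smooth_surface_def)
  have inj: "inj_on (chart_map c) (chart_dom c)"
    using ch(1) by (auto simp: is_chart_def homeomorphic_map_def Int_absorb1 openin_subset)
  have om: "open_map (subtopology M (chart_dom c)) (top_of_set (chart_img c)) (chart_map c)"
    using ch(1) by (simp add: is_chart_def homeomorphic_map_openness_eq homeomorphic_imp_open_map)
  have "openin (subtopology M (chart_dom c)) (chart_dom c \<inter> chart_dom d)"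
    using ch unfolding is_chart_def by (metis inf_commute openin_subtopology_Int)
  then have "openin (top_of_set (chart_img c)) (chart_map c ` (chart_dom c \<inter> chart_dom d))"
    using om unfolding open_map_def by blast
  then show "open (chart_map c ` (chart_dom c \<inter> chart_dom d))"
    using ch(1) unfolding is_chart_def by (meson openin_open_trans)
  show "open (chart_img d)" using ch(2) by (simp add: is_chart_def)
  have tr: "transition c d (chart_map c p) = chart_map d p" if "p \<in> chart_dom c" for p
    using that inj by (simp add: transition_def)
  then show "transition c d ` chart_map c ` (chart_dom c \<inter> chart_dom d) \<subseteq> chart_img d" by auto
  show "smooth_on (chart_map c ` (chart_dom c \<inter> chart_dom d)) (transition c d)"
    using comp by (simp add: smoothly_compatible_def)
  have m: "smooth_on (chart_img e) (g e)" "\<forall>u\<in>chart_img e. inner_product_matrix (g e u)"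
    if "e \<in> A" for e
    using met that unfolding riemannian_metric_def by blast+
  show "smooth_on (chart_img d) (g d)" by (rule m(1)[OF d])
  show "inner_product_matrix (g c u)" if "u \<in> chart_map c ` (chart_dom c \<inter> chart_dom d)" for u
    using that m(2)[OF c] by blast
  show "inner_product_matrix (g d v)" if "v \<in> chart_img d" for v
    using that m(2)[OF d] by blast
  fix u assume "u \<in> chart_map c ` (chart_dom c \<inter> chart_dom d)"
  then obtain p where p: "p \<in> chart_dom c \<inter> chart_dom d" and u: "u = chart_map c p" by blast
  have "g c u = transpose (jacobian (transition c d) (at u)) ** g d (chart_map d p)
          ** jacobian (transition c d) (at u)"
    using met c d p unfolding riemannian_metric_def Let_def u by blast
  then show "g c u = transpose (jacobian (transition c d) (at u)) ** g d (transition c d u)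
          ** jacobian (transition c d) (at u)"
    using p tr[of p] by (simp add: u)
qed

lemma coord_rep_change:
  assumes "riemannian_surface M A g" "c \<in> A" "d \<in> A"
    and "u \<in> chart_map c ` (chart_dom c \<inter> chart_dom d)"
  shows "coord_rep c f u = coord_rep d f (transition c d u)"
proof -
  have inj: "inj_on (chart_map e) (chart_dom e)" if "e \<in> A" for e
    using assms(1) that
    by (auto simp: riemannian_surface_def smooth_surface_def is_chart_def homeomorphic_map_def
        Int_absorb1 openin_subset)
  from assms(4) obtain p where "p \<in> chart_dom c" "p \<in> chart_dom d" "u = chart_map c p" by auto
  then show ?thesis
    by (simp add: coord_rep_def transition_def inj assms(2,3))
qed

lemma transition_chart_map:
  assumes "riemannian_surface M A g" "c \<in> A" "p \<in> chart_dom c"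
  shows "transition c d (chart_map c p) = chart_map d p"
proof -
  have "inj_on (chart_map c) (chart_dom c)"
    using assms
    by (auto simp: riemannian_surface_def smooth_surface_def is_chart_def homeomorphic_map_def
        Int_absorb1 openin_subset)
  then show ?thesis using assms(3) by (simp add: transition_def)
qed

lemma chart_at:
  assumes "c \<in> A" "p \<in> chart_dom c"
  shows "chart_at A p \<in> A" "p \<in> chart_dom (chart_at A p)"
  using someI[of "\<lambda>c. c \<in> A \<and> p \<in> chart_dom c" c] assms unfolding chart_at_def by auto

theorem laplacian_eq:
  assumes M: "riemannian_surface M A g" and f: "smooth_fun A f"
    and c: "c \<in> A" and p: "p \<in> chart_dom c"
  shows "laplacian A g f p = coord_laplacian (g c) (coord_rep c f) (chart_map c p)"
proof -
  let ?b = "chart_at A p"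
  note b = chart_at[OF c p]
  have "coord_laplacian (g ?b) (coord_rep ?b f) (chart_map ?b p) =
      coord_laplacian (g c) (coord_rep c f) (transition ?b c (chart_map ?b p))"
    by (rule coord_change.laplacian_change[OF coord_change_charts[OF M b(1) c]])
       (use f c p b coord_rep_change[OF M b(1) c] in \<open>auto simp: smooth_fun_def\<close>)
  then show ?thesis
    by (simp add: laplacian_def Let_def transition_chart_map[OF M b])
qed

theorem grad_inner_eq:
  assumes M: "riemannian_surface M A g" and e: "smooth_fun A e" and f: "smooth_fun A f"
    and c: "c \<in> A" and p: "p \<in> chart_dom c"
  shows "grad_inner A g e f p = coord_grad_inner (g c) (coord_rep c e) (coord_rep c f) (chart_map c p)"
proof -
  let ?b = "chart_at A p"
  note b = chart_at[OF c p]
  have "coord_grad_inner (g ?b) (coord_rep ?b e) (coord_rep ?b f) (chart_map ?b p) =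
      coord_grad_inner (g c) (coord_rep c e) (coord_rep c f) (transition ?b c (chart_map ?b p))"
    by (rule coord_change.grad_inner_change[OF coord_change_charts[OF M b(1) c]])
       (use e f c p b coord_rep_change[OF M b(1) c] in \<open>auto simp: smooth_fun_def\<close>)
  then show ?thesis
    by (simp add: grad_inner_def Let_def transition_chart_map[OF M b])
qed

end

theory Submission
  imports Defs
begin

text \<open>
  The set \<open>S\<close> to be removed consists of the zeros of \<open>f\<close> at which the gradient vanishes
  (\<open>critical_zeros\<close>). At the other zeros some partial derivative of \<open>f\<close> is non-zero, so \<open>f\<close> and one of the old
  coordinates form a new chart by the inverse function theorem, and in this chart the nodal set is
  an axis (\<open>smooth_curve_regular_zeros\<close>). What has to be shown is that \<open>S\<close> has no accumulation point.

  In a chart the equation reads \<open>f\<^sub>1\<^sub>1 + 2a f\<^sub>1\<^sub>2 + (a\<^sup>2 + b\<^sup>2) f\<^sub>2\<^sub>2 = k\<^sub>1 f\<^sub>1 + k\<^sub>2 f\<^sub>2 + k\<^sub>3 f\<close> with smooth coefficients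
  and \<open>b > 0\<close>. Put \<open>\<beta> = a + \<i> b\<close>. The principal part factors as
  \<open>(\<partial>\<^sub>1 + \<beta> \<partial>\<^sub>2) (\<partial>\<^sub>1 + \<beta>\<^sup>* \<partial>\<^sub>2)\<close>, where \<open>\<beta>\<^sup>*\<close> is the conjugate. Hence \<open>w = f\<^sub>1 + \<beta>\<^sup>* f\<^sub>2\<close> solves
  a Cauchy-Riemann equation whose right-hand side is linear in \<open>w\<close>, its conjugate and \<open>f\<close>; and the
  critical zeros of \<open>f\<close> are the points where \<open>f = w = 0\<close>.

  Let \<open>x\<close> be an accumulation point of critical zeros. If \<open>w\<close> vanishes to order \<open>m\<close> at \<open>x\<close>, then
  its leading term solves the equation \<open>(\<partial>\<^sub>1 + \<beta>(x) \<partial>\<^sub>2) w = 0\<close> with frozen coefficient, so it is \<open>c \<zeta>\<^sup>m\<close>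
  for the complex linear coordinate \<open>\<zeta>\<close> that this operator annihilates. Unless \<open>c = 0\<close>, such a term
  dominates the remainder near \<open>x\<close> and there are no other zeros nearby. By induction \<open>w\<close>, and
  with it \<open>f\<close>, vanishes to infinite order at \<open>x\<close> (\<open>flat_step\<close>, \<open>flat_all\<close>).

  A function in this class that vanishes to infinite order at a point vanishes near it
  (\<open>strong_unique_continuation\<close>). This follows from Carleman's method with the weight \<open>e\<^sup>-\<^sup>n\<^sup>\<psi>\<close>,
  \<open>\<psi> = ln \<bar>\<zeta>\<bar> - K \<bar>\<zeta>\<bar>\<close>. The logarithm is harmonic for the frozen operator, and the correction makes \<open>\<psi>\<close> so
  strictly superharmonic that the variability of the coefficients is absorbed. This gives
  \<open>(n - M) \<integral> e\<^sup>-\<^sup>2\<^sup>n\<^sup>\<psi> \<bar>w\<bar>\<^sup>2 \<le> \<integral> e\<^sup>-\<^sup>2\<^sup>n\<^sup>\<psi> \<bar>(\<partial>\<^sub>1 + \<beta> \<partial>\<^sub>2) w\<bar>\<^sup>2\<close> for \<open>w\<close> supported in a punctured neighbourhood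
  (\<open>carleman_inequality\<close>). It is applied to \<open>w\<close> and to \<open>f\<close> itself, since
  \<open>(\<partial>\<^sub>1 + \<beta> \<partial>\<^sub>2) f\<close> is the conjugate of \<open>w\<close>.

  So every accumulation point of \<open>S\<close> has a neighbourhood on which \<open>f\<close> is zero. The set of all
  points with such a neighbourhood is open; it is closed, because it is contained in \<open>S\<close> and hence its
  accumulation points again belong to it. If it were non-empty, it would contain a whole component of the
  surface, on which \<open>f\<close> would vanish identically.
\<close>

section \<open>Functions of class \<open>C\<^sup>k\<close>\<close>

lemma Ck_on_SucI:
  assumes "open S"
    and "\<And>x. x \<in> S \<Longrightarrow> (F has_derivative D x) (at x)"
    and "\<And>v. v \<in> Basis \<Longrightarrow> Ck_on k S (\<lambda>x. D x v)"
  shows "Ck_on (Suc k) S F"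
  unfolding Ck_on.simps
proof (intro conjI ballI)
  fix x assume "x \<in> S"
  then show "F differentiable (at x)" using assms(2) by (blast intro: differentiableI)
next
  fix v :: 'a assume v: "v \<in> Basis"
  show "Ck_on k S (\<lambda>x. frechet_derivative F (at x) v)"
    by (rule Ck_on_cong[OF assms(1) assms(3)[OF v]]) (simp add: frechet_derivative_eqI[OF assms(2)])
qed

lemma Ck_on_has_derivative:
  assumes "Ck_on (Suc k) S F" "x \<in> S"
  shows "(F has_derivative frechet_derivative F (at x)) (at x)"
  using assms by (intro differentiable_has_derivative) simp

lemma Ck_on_mono_Suc: "Ck_on (Suc k) S F \<Longrightarrow> Ck_on k S F"
proof (induction k arbitrary: F)
  case 0
  then show ?case
    by (auto intro!: continuous_at_imp_continuous_on differentiable_imp_continuous_within)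
next
  case (Suc k)
  show ?case
    unfolding Ck_on.simps(2)[of k]
  proof (intro conjI ballI)
    show "F differentiable (at x)" if "x \<in> S" for x using Suc.prems that by simp
    show "Ck_on k S (\<lambda>x. frechet_derivative F (at x) v)" if "v \<in> Basis" for v
      by (rule Suc.IH) (use Suc.prems that in \<open>simp only: Ck_on.simps(2)[of "Suc k"]\<close>)
  qed
qed

lemma Ck_on_subset: "Ck_on k S F \<Longrightarrow> T \<subseteq> S \<Longrightarrow> Ck_on k T F"
  by (induction k arbitrary: F) (auto intro: continuous_on_subset)

lemma Ck_on_const: "open S \<Longrightarrow> Ck_on k S (\<lambda>x. c)"
  by (induction k arbitrary: c) (auto intro: Ck_on_SucI[where D = "\<lambda>x h. 0"] simp del: Ck_on.simps(2))

lemma Ck_on_linear: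
  assumes "open S" "bounded_linear L"
  shows "Ck_on k S L"
proof (cases k)
  case 0 then show ?thesis using assms by (simp add: linear_continuous_on)
next
  case (Suc l)
  then show ?thesis
    using assms
    by (auto intro!: Ck_on_SucI[where D = "\<lambda>x. L"] Ck_on_const simp del: Ck_on.simps
        intro: bounded_linear_imp_has_derivative)
qed

lemma Ck_on_add:
  assumes "open S"
  shows "Ck_on k S F \<Longrightarrow> Ck_on k S G \<Longrightarrow> Ck_on k S (\<lambda>x. F x + G x)"
proof (induction k arbitrary: F G)
  case 0 then show ?case by (simp add: continuous_on_add)
next
  case (Suc k)
  show ?case
  proof (rule Ck_on_SucI[OF assms])
    show "((\<lambda>x. F x + G x) has_derivative
        (\<lambda>h. frechet_derivative F (at x) h + frechet_derivative G (at x) h)) (at x)" if "x \<in> S" for x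
      using Suc.prems that by (intro has_derivative_add Ck_on_has_derivative)
    show "Ck_on k S (\<lambda>x. frechet_derivative F (at x) v + frechet_derivative G (at x) v)"
      if "v \<in> Basis" for v
      using Suc.prems that by (intro Suc.IH) auto
  qed
qed

lemma Ck_on_sum:
  assumes "open S" "\<And>i. i \<in> I \<Longrightarrow> Ck_on k S (F i)"
  shows "Ck_on k S (\<lambda>x. \<Sum>i\<in>I. F i x)"
  using assms(2)
  by (induction I rule: infinite_finite_induct) (auto intro: Ck_on_const Ck_on_add assms(1))

text \<open>One proof for scalar multiples and products: the derivative of \<open>B F G\<close> is a sum of two terms of
  the same form with one order of differentiability less to account for.\<close>

lemma Ck_on_bilinear:
  assumes "bounded_bilinear B" "open S"
  shows "Ck_on k S F \<Longrightarrow> Ck_on k S G \<Longrightarrow> Ck_on k S (\<lambda>x. B (F x) (G x))"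
proof (induction k arbitrary: F G)
  case 0 then show ?case by (simp add: bounded_bilinear.continuous_on[OF assms(1)])
next
  case (Suc k)
  have FG: "Ck_on k S F" "Ck_on k S G" using Suc.prems by (blast dest: Ck_on_mono_Suc)+
  show ?case
  proof (rule Ck_on_SucI[OF assms(2)])
    show "((\<lambda>x. B (F x) (G x)) has_derivative
        (\<lambda>h. B (F x) (frechet_derivative G (at x) h) + B (frechet_derivative F (at x) h) (G x))) (at x)"
      if "x \<in> S" for x
      using Suc.prems that by (intro bounded_bilinear.FDERIV[OF assms(1)] Ck_on_has_derivative)
    show "Ck_on k S (\<lambda>x. B (F x) (frechet_derivative G (at x) v) + B (frechet_derivative F (at x) v) (G x))"
      if "v \<in> Basis" for v
      using Suc.prems that by (intro Ck_on_add Suc.IH FG assms(2)) auto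
  qed
qed

lemmas Ck_on_mult = Ck_on_bilinear[OF bounded_bilinear_mult]
lemmas Ck_on_scaleR = Ck_on_bilinear[OF bounded_bilinear_scaleR]

lemma Ck_on_diff:
  assumes "open S" "Ck_on k S F" "Ck_on k S G"
  shows "Ck_on k S (\<lambda>x. F x - G x)"
  using Ck_on_add[OF assms(1,2) Ck_on_bounded_linear[OF bounded_linear_minus[OF bounded_linear_ident] assms(1,3)]]
  by simp

lemma linear_eq_sum_Basis:
  fixes L :: "'a::euclidean_space \<Rightarrow> 'b::real_vector"
  assumes "linear L" shows "L x = (\<Sum>b\<in>Basis. (x \<bullet> b) *\<^sub>R L b)"
  by (subst euclidean_representation[of x, symmetric])
     (simp only: linear_sum[OF assms] linear_scale[OF assms] o_def)

text \<open>By the chain rule a derivative of \<open>F \<circ> T\<close> is a sum of products of a derivative of \<open>T\<close> with the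
  composition of \<open>T\<close> and a derivative of \<open>F\<close>, which makes induction on \<open>k\<close> work.\<close>

lemma Ck_on_compose:
  fixes T :: "'a::euclidean_space \<Rightarrow> 'b::euclidean_space"
  assumes "open S" "open W" "T ` S \<subseteq> W"
  shows "Ck_on k W F \<Longrightarrow> Ck_on k S T \<Longrightarrow> Ck_on k S (\<lambda>x. F (T x))"
proof (induction k arbitrary: F)
  case 0
  then show ?case using assms by (auto intro: continuous_on_compose2)
next
  case (Suc k)
  have T: "Ck_on k S T" using Suc.prems(2) by (rule Ck_on_mono_Suc)
  let ?D = "\<lambda>x. frechet_derivative T (at x)" and ?E = "\<lambda>y. frechet_derivative F (at y)"
  show ?case
  proof (rule Ck_on_SucI[OF assms(1)])
    show "((\<lambda>x. F (T x)) has_derivative (\<lambda>h. \<Sum>b\<in>Basis. (?D x h \<bullet> b) *\<^sub>R ?E (T x) b)) (at x)"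
      if "x \<in> S" for x
    proof -
      have E: "(F has_derivative ?E (T x)) (at (T x))"
        using Suc.prems that assms(3) by (intro Ck_on_has_derivative) auto
      have "((\<lambda>x. F (T x)) has_derivative (\<lambda>h. ?E (T x) (?D x h))) (at x)"
        by (rule has_derivative_compose[OF Ck_on_has_derivative[OF Suc.prems(2) that] E])
      then show ?thesis
        unfolding linear_eq_sum_Basis[OF has_derivative_linear[OF E], symmetric] .
    qed
    show "Ck_on k S (\<lambda>x. \<Sum>b\<in>Basis. (?D x v \<bullet> b) *\<^sub>R ?E (T x) b)" if "v \<in> Basis" for v
    proof (intro Ck_on_sum Ck_on_scaleR assms(1))
      fix b :: 'b assume b: "b \<in> Basis"
      show "Ck_on k S (\<lambda>x. ?D x v \<bullet> b)"
        using Suc.prems that by (intro Ck_on_bounded_linear[OF bounded_linear_inner_left assms(1)]) simp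
      show "Ck_on k S (\<lambda>x. ?E (T x) b)"
        using Suc.prems b T by (intro Suc.IH) auto
    qed
  qed
qed

text \<open>Real exponents stay real exponents under differentiation; so reciprocals and square roots need
  no induction of their own.\<close>

lemma Ck_on_powr: "Ck_on k {0<..} (\<lambda>t::real. t powr r)"
proof (induction k arbitrary: r)
  case 0
  then show ?case by (auto intro!: continuous_intros)
next
  case (Suc k)
  show ?case
  proof (rule Ck_on_SucI)
    show "((\<lambda>t. t powr r) has_derivative (\<lambda>h. (r * t powr (r - 1)) * h)) (at t)" if "t \<in> {0<..}" for t
      using has_real_derivative_powr[of t r] that by (simp add: has_field_derivative_def)
    show "Ck_on k {0<..} (\<lambda>t. r * t powr (r - 1) * v)" for v :: real
      by (intro Ck_on_mult Ck_on_const Suc.IH) auto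
  qed auto
qed

lemma Ck_on_ln: "Ck_on k {0<..} (ln :: real \<Rightarrow> real)"
proof (cases k)
  case 0
  then show ?thesis by (auto intro!: continuous_intros)
next
  case (Suc k)
  have "Ck_on (Suc k) {0<..} (ln :: real \<Rightarrow> real)"
  proof (rule Ck_on_SucI)
    show "(ln has_derivative (\<lambda>h. t powr (-1) * h)) (at t)" if "t \<in> {0<..}" for t :: real
      using that by (auto intro!: derivative_eq_intros simp: powr_minus_divide fun_eq_iff divide_simps)
    show "Ck_on k {0<..} (\<lambda>t. t powr (-1) * v)" for v :: real
      by (intro Ck_on_mult Ck_on_const Ck_on_powr) auto
  qed auto
  then show ?thesis using Suc by simp
qed

lemma Ck_on_exp: "Ck_on k UNIV (exp :: real \<Rightarrow> real)"
proof (induction k)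
  case 0
  then show ?case by (auto intro!: continuous_intros)
next
  case (Suc k)
  show ?case
  proof (rule Ck_on_SucI)
    show "(exp has_derivative (\<lambda>h. exp t * h)) (at t)" for t :: real
      by (auto intro!: derivative_eq_intros)
    show "Ck_on k UNIV (\<lambda>t. exp t * v)" for v :: real
      by (intro Ck_on_mult Ck_on_const Suc.IH) auto
  qed auto
qed

lemma Ck_on_powr_compose:
  assumes "open S" "Ck_on k S F" "\<And>x. x \<in> S \<Longrightarrow> F x > (0::real)"
  shows "Ck_on k S (\<lambda>x. F x powr r)"
  using assms by (intro Ck_on_compose[OF assms(1) _ _ Ck_on_powr assms(2)]) auto

lemma Ck_on_sqrt:
  assumes "open S" "Ck_on k S F" "\<And>x. x \<in> S \<Longrightarrow> F x > (0::real)"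
  shows "Ck_on k S (\<lambda>x. sqrt (F x))"
  by (rule Ck_on_cong[OF assms(1) Ck_on_powr_compose[OF assms, where r="1/2"]])
     (use assms(3) in \<open>auto simp: powr_half_sqrt less_imp_le\<close>)

lemma Ck_on_inverse:
  assumes "open S" "Ck_on k S F" "\<And>x. x \<in> S \<Longrightarrow> F x \<noteq> (0::real)"
  shows "Ck_on k S (\<lambda>x. inverse (F x))"
proof -
  have "Ck_on k S (\<lambda>x. F x * (F x * F x) powr (-1))"
    by (intro Ck_on_mult Ck_on_powr_compose assms(1,2)) (use assms(3) in \<open>auto simp: zero_less_mult_iff linorder_neq_iff\<close>)
  then show ?thesis
    by (rule Ck_on_cong[OF assms(1)]) (auto simp: powr_minus assms(3))
qed

lemma Ck_on_divide:
  assumes "open S" "Ck_on k S F" "Ck_on k S G" "\<And>x. x \<in> S \<Longrightarrow> G x \<noteq> (0::real)"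
  shows "Ck_on k S (\<lambda>x. F x / G x)"
  unfolding divide_inverse by (intro Ck_on_mult Ck_on_inverse assms)

lemma Ck_on_vec2:
  fixes F :: "'a::euclidean_space \<Rightarrow> real^2"
  assumes "open S" "\<And>i. Ck_on k S (\<lambda>x. F x $ i)"
  shows "Ck_on k S F"
proof -
  have "Ck_on k S (\<lambda>x. \<Sum>i\<in>UNIV. F x $ i *\<^sub>R axis i 1)"
    by (intro Ck_on_sum Ck_on_scaleR Ck_on_const assms)
  then show ?thesis
    by (rule Ck_on_cong[OF assms(1)]) (simp add: vec2_eq_iff sum_2 axis_def)
qed

lemma Basis_real2: "(Basis :: (real^2) set) = {axis 1 1, axis 2 1}"
  by (auto simp: Basis_vec_def UNIV_2)

lemma Ck_on_SucI_partial:
  assumes "open S" "\<And>x. x \<in> S \<Longrightarrow> F differentiable (at x)"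
    and "\<And>i. Ck_on k S (partial_deriv i F)"
  shows "Ck_on (Suc k) S F"
  using assms(2,3)[unfolded partial_deriv_def[abs_def]] by (simp add: Basis_real2)

lemma smooth_on_Ck: "smooth_on S F \<Longrightarrow> Ck_on k S F"
  by (simp add: smooth_on_def)

lemma smooth_on_subset: "smooth_on S F \<Longrightarrow> T \<subseteq> S \<Longrightarrow> smooth_on T F"
  unfolding smooth_on_def by (blast intro: Ck_on_subset)

lemma smooth_on_cong: "open S \<Longrightarrow> smooth_on S P \<Longrightarrow> (\<And>x. x \<in> S \<Longrightarrow> P x = Q x) \<Longrightarrow> smooth_on S Q"
  unfolding smooth_on_def by (blast intro: Ck_on_cong)

lemma smooth_on_const: "open S \<Longrightarrow> smooth_on S (\<lambda>x. c)"
  by (simp add: smooth_on_def Ck_on_const)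

lemma smooth_on_linear: "open S \<Longrightarrow> bounded_linear L \<Longrightarrow> smooth_on S L"
  by (simp add: smooth_on_def Ck_on_linear)

lemma smooth_on_add: "open S \<Longrightarrow> smooth_on S F \<Longrightarrow> smooth_on S G \<Longrightarrow> smooth_on S (\<lambda>x. F x + G x)"
  by (simp add: smooth_on_def Ck_on_add)

lemma smooth_on_diff: "open S \<Longrightarrow> smooth_on S F \<Longrightarrow> smooth_on S G \<Longrightarrow> smooth_on S (\<lambda>x. F x - G x)"
  by (simp add: smooth_on_def Ck_on_diff)

lemma smooth_on_mult:
  fixes F G :: "'a::euclidean_space \<Rightarrow> 'b::real_normed_algebra"
  shows "open S \<Longrightarrow> smooth_on S F \<Longrightarrow> smooth_on S G \<Longrightarrow> smooth_on S (\<lambda>x. F x * G x)"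
  by (simp add: smooth_on_def Ck_on_mult)

lemma smooth_on_compose:
  "\<lbrakk>open S; open W; T ` S \<subseteq> W; smooth_on W F; smooth_on S T\<rbrakk> \<Longrightarrow> smooth_on S (\<lambda>x. F (T x))"
  unfolding smooth_on_def by (blast intro: Ck_on_compose)

lemma smooth_on_sqrt:
  "\<lbrakk>open S; smooth_on S F; \<And>x. x \<in> S \<Longrightarrow> F x > (0::real)\<rbrakk> \<Longrightarrow> smooth_on S (\<lambda>x. sqrt (F x))"
  unfolding smooth_on_def by (blast intro: Ck_on_sqrt)

lemma smooth_on_divide:
  "\<lbrakk>open S; smooth_on S F; smooth_on S G; \<And>x. x \<in> S \<Longrightarrow> G x \<noteq> (0::real)\<rbrakk> \<Longrightarrow> smooth_on S (\<lambda>x. F x / G x)"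
  unfolding smooth_on_def by (blast intro: Ck_on_divide)

lemma smooth_on_vec2:
  "open S \<Longrightarrow> (\<And>i. smooth_on S (\<lambda>x. (F x :: real^2) $ i)) \<Longrightarrow> smooth_on S F"
  unfolding smooth_on_def by (blast intro: Ck_on_vec2)

abbreviation D1 :: "(real^2 \<Rightarrow> real) \<Rightarrow> real^2 \<Rightarrow> real" where "D1 \<equiv> partial_deriv 1"
abbreviation D2 :: "(real^2 \<Rightarrow> real) \<Rightarrow> real^2 \<Rightarrow> real" where "D2 \<equiv> partial_deriv 2"

text \<open>Real and imaginary part of \<open>\<partial>\<^sub>1 w + (a + \<i> b) \<partial>\<^sub>2 w\<close> for \<open>w = P + \<i> Q\<close>, a Cauchy-Riemann operator
  with variable coefficients.\<close>

abbreviation cr_re where "cr_re a b P Q x \<equiv> D1 P x + a x * D2 P x - b x * D2 Q x"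
abbreviation cr_im where "cr_im a b P Q x \<equiv> D1 Q x + a x * D2 Q x + b x * D2 P x"

section \<open>Order of vanishing\<close>

text \<open>\<open>partial_deriv\<close> for vector-valued functions; the values below are complex.\<close>

definition pdiff :: "2 \<Rightarrow> (real^2 \<Rightarrow> 'b::real_normed_vector) \<Rightarrow> real^2 \<Rightarrow> 'b" where
  "pdiff i F u = frechet_derivative F (at u) (axis i 1)"

lemma pdiff_real: "pdiff i F = partial_deriv i F"
  by (simp add: fun_eq_iff pdiff_def partial_deriv_def)

lemma pdiff_eqI: "(F has_derivative D) (at u) \<Longrightarrow> pdiff i F u = D (axis i 1)"
  unfolding pdiff_def by (metis frechet_derivative_at)

lemma smooth_on_pdiff: "smooth_on S F \<Longrightarrow> smooth_on S (pdiff i F)"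
  using smooth_on_frechet[of S F "axis i 1"]
  by (simp add: pdiff_def[abs_def] axis_in_Basis_iff)

lemma pdiff_cong:
  assumes "open S" "u \<in> S" "\<And>x. x \<in> S \<Longrightarrow> P x = Q x"
  shows "pdiff i P u = pdiff i Q u"
proof -
  have "(P has_derivative D) (at u) \<longleftrightarrow> (Q has_derivative D) (at u)" for D
    using has_derivative_transform_within_open[of P D u UNIV S Q]
      has_derivative_transform_within_open[of Q D u UNIV S P] assms by auto
  then show ?thesis by (simp add: pdiff_def frechet_derivative_def)
qed

lemma pdiff_add:
  "\<lbrakk>F differentiable (at u); G differentiable (at u)\<rbrakk>
    \<Longrightarrow> pdiff i (\<lambda>x. F x + G x) u = pdiff i F u + pdiff i G u"
  by (subst pdiff_eqI[OF has_derivative_add])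
     (auto simp: pdiff_def intro: differentiable_has_derivative)

lemma pdiff_bilinear:
  "\<lbrakk>bounded_bilinear B; F differentiable (at u); G differentiable (at u)\<rbrakk>
    \<Longrightarrow> pdiff i (\<lambda>x. B (F x) (G x)) u = B (F u) (pdiff i G u) + B (pdiff i F u) (G u)"
  by (subst pdiff_eqI[OF bounded_bilinear.FDERIV])
     (auto simp: pdiff_def intro: differentiable_has_derivative)

lemma pdiff_linear:
  "\<lbrakk>bounded_linear L; F differentiable (at u)\<rbrakk> \<Longrightarrow> pdiff i (\<lambda>x. L (F x)) u = L (pdiff i F u)"
  by (subst pdiff_eqI[OF bounded_linear.has_derivative])
     (auto simp: pdiff_def intro: differentiable_has_derivative)

lemma pdiff_const [simp]: "pdiff i (\<lambda>x. c) = (\<lambda>x. 0)"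
  by (simp add: fun_eq_iff pdiff_def)

text \<open>All partial derivatives of order less than \<open>m\<close> vanish at \<open>x\<close>. For smooth functions this means
  \<open>F = O(\<bar>y - x\<bar>\<^sup>m)\<close> (one direction is \<open>flat_bound\<close>), but unlike the growth condition it is inherited
  by derivatives without a Taylor expansion.\<close>

primrec flat :: "nat \<Rightarrow> real^2 \<Rightarrow> (real^2 \<Rightarrow> 'b::real_normed_vector) \<Rightarrow> bool" where
  "flat 0 x F \<longleftrightarrow> True"
| "flat (Suc m) x F \<longleftrightarrow> F x = 0 \<and> (\<forall>i. flat m x (pdiff i F))"

lemma flat_cong:
  assumes "open U" "x \<in> U"
  shows "flat m x F \<Longrightarrow> (\<And>y. y \<in> U \<Longrightarrow> F y = G y) \<Longrightarrow> flat m x G"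
proof (induction m arbitrary: F G)
  case (Suc m)
  have "flat m x (pdiff i G)" for i
  proof (rule Suc.IH)
    show "flat m x (pdiff i F)" using Suc.prems(1) by simp
    show "pdiff i F y = pdiff i G y" if "y \<in> U" for y
      by (rule pdiff_cong[OF assms(1) that]) (rule Suc.prems(2))
  qed
  then show ?case using Suc.prems assms(2) by simp
qed simp

lemma flat_SucD: "flat (Suc m) x F \<Longrightarrow> flat m x F"
  by (induction m arbitrary: F) auto

lemma flat_add:
  assumes "open U" "x \<in> U"
  shows "\<lbrakk>smooth_on U F; smooth_on U G; flat m x F; flat m x G\<rbrakk> \<Longrightarrow> flat m x (\<lambda>y. F y + G y)"
proof (induction m arbitrary: F G)
  case (Suc m)
  have "flat m x (pdiff i (\<lambda>y. F y + G y))" for i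
  proof (rule flat_cong[OF assms])
    show "flat m x (\<lambda>y. pdiff i F y + pdiff i G y)"
      using Suc.prems by (intro Suc.IH smooth_on_pdiff) auto
    show "pdiff i F y + pdiff i G y = pdiff i (\<lambda>y. F y + G y) y" if "y \<in> U" for y
      using Suc.prems that by (simp add: pdiff_add smooth_on_differentiable)
  qed
  then show ?case using Suc.prems by simp
qed simp

lemma flat_linear:
  assumes "open U" "x \<in> U" "bounded_linear L"
  shows "\<lbrakk>smooth_on U F; flat m x F\<rbrakk> \<Longrightarrow> flat m x (\<lambda>y. L (F y))"
proof (induction m arbitrary: F)
  case (Suc m)
  have "flat m x (pdiff i (\<lambda>y. L (F y)))" for i
  proof (rule flat_cong[OF assms(1,2)])
    show "flat m x (\<lambda>y. L (pdiff i F y))"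
      using Suc.prems by (intro Suc.IH smooth_on_pdiff) auto
    show "L (pdiff i F y) = pdiff i (\<lambda>y. L (F y)) y" if "y \<in> U" for y
      using Suc.prems that by (simp add: pdiff_linear[OF assms(3)] smooth_on_differentiable)
  qed
  then show ?case using Suc.prems linear_0[OF bounded_linear.linear[OF assms(3)]] by simp
qed simp

lemma smooth_on_bilinear:
  "\<lbrakk>bounded_bilinear B; open S; smooth_on S F; smooth_on S G\<rbrakk> \<Longrightarrow> smooth_on S (\<lambda>x. B (F x) (G x))"
  by (simp add: smooth_on_def Ck_on_bilinear)

lemma flat_bilinear:
  assumes "open U" "x \<in> U" "bounded_bilinear B"
  shows "\<lbrakk>smooth_on U G; smooth_on U F; flat m x F\<rbrakk> \<Longrightarrow> flat m x (\<lambda>y. B (G y) (F y))"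
proof (induction m arbitrary: F G)
  case (Suc m)
  have "flat m x (pdiff i (\<lambda>y. B (G y) (F y)))" for i
  proof (rule flat_cong[OF assms(1,2)])
    show "flat m x (\<lambda>y. B (G y) (pdiff i F y) + B (pdiff i G y) (F y))"
      using Suc.prems flat_SucD[OF Suc.prems(3)]
      by (intro flat_add[OF assms(1,2)] Suc.IH smooth_on_bilinear[OF assms(3)] smooth_on_pdiff assms(1)) auto
    show "B (G y) (pdiff i F y) + B (pdiff i G y) (F y) = pdiff i (\<lambda>y. B (G y) (F y)) y" if "y \<in> U" for y
      using Suc.prems that by (simp add: pdiff_bilinear[OF assms(3)] smooth_on_differentiable)
  qed
  then show ?case
    using Suc.prems by (simp add: bounded_bilinear.zero_right[OF assms(3)])
qed simp

text \<open>Freezing a coefficient at \<open>x\<close> produces an error whose factor \<open>G\<close> vanishes at \<open>x\<close>; this compensates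
  the order that is lost by differentiating the other factor.\<close>

lemma flat_bilinear_gain:
  assumes "open U" "x \<in> U" "bounded_bilinear B"
  shows "\<lbrakk>smooth_on U G; smooth_on U F; G x = 0; flat m x F\<rbrakk> \<Longrightarrow> flat (Suc m) x (\<lambda>y. B (G y) (F y))"
proof (induction m arbitrary: F)
  case 0
  then show ?case by (simp add: bounded_bilinear.zero_left[OF assms(3)])
next
  case (Suc m)
  have "flat (Suc m) x (pdiff i (\<lambda>y. B (G y) (F y)))" for i
  proof (rule flat_cong[OF assms(1,2)])
    show "flat (Suc m) x (\<lambda>y. B (G y) (pdiff i F y) + B (pdiff i G y) (F y))"
    proof (intro flat_add[OF assms(1,2)] smooth_on_bilinear[OF assms(3)] smooth_on_pdiff assms(1) Suc.prems(1,2))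
      show "flat (Suc m) x (\<lambda>y. B (G y) (pdiff i F y))"
        using Suc.prems(4) by (intro Suc.IH smooth_on_pdiff Suc.prems(1-3)) simp
      show "flat (Suc m) x (\<lambda>y. B (pdiff i G y) (F y))"
        by (intro flat_bilinear[OF assms] smooth_on_pdiff Suc.prems)
    qed
    show "B (G y) (pdiff i F y) + B (pdiff i G y) (F y) = pdiff i (\<lambda>y. B (G y) (F y)) y" if "y \<in> U" for y
      using Suc.prems that by (simp add: pdiff_bilinear[OF assms(3)] smooth_on_differentiable)
  qed
  then show ?case
    unfolding flat.simps(2)[of "Suc m"]
    using Suc.prems(3) by (simp add: bounded_bilinear.zero_left[OF assms(3)] del: flat.simps(2))
qed

lemma norm_frechet_derivative_le:
  fixes F :: "real^2 \<Rightarrow> 'b::real_normed_vector"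
  assumes "F differentiable (at u)"
  shows "norm (frechet_derivative F (at u) h) \<le> (norm (pdiff 1 F u) + norm (pdiff 2 F u)) * norm h"
proof -
  let ?D = "frechet_derivative F (at u)"
  have l: "linear ?D" using assms by (rule linear_frechet_derivative)
  have "h = h $ 1 *\<^sub>R axis 1 1 + h $ 2 *\<^sub>R axis 2 1" by (simp add: vec2_eq_iff axis_def)
  then have "?D h = ?D (h $ 1 *\<^sub>R axis 1 1 + h $ 2 *\<^sub>R axis 2 1)" by simp
  also have "\<dots> = h $ 1 *\<^sub>R pdiff 1 F u + h $ 2 *\<^sub>R pdiff 2 F u"
    by (simp add: linear_add[OF l] linear_scale[OF l] pdiff_def)
  finally have "norm (?D h) \<le> \<bar>h $ 1\<bar> * norm (pdiff 1 F u) + \<bar>h $ 2\<bar> * norm (pdiff 2 F u)"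
    by (metis norm_triangle_ineq norm_scaleR)
  also have "\<dots> \<le> norm h * norm (pdiff 1 F u) + norm h * norm (pdiff 2 F u)"
    by (intro add_mono mult_right_mono component_le_norm_cart) auto
  finally show ?thesis by (simp add: algebra_simps)
qed

text \<open>Integrate the bounds for the partial derivatives along the segment from \<open>x\<close> to \<open>y\<close>.\<close>

lemma flat_bound:
  fixes F :: "real^2 \<Rightarrow> 'b::real_normed_vector"
  assumes "open U" "x \<in> U"
  shows "smooth_on U F \<Longrightarrow> flat m x F \<Longrightarrow>
    \<exists>C\<ge>0. \<exists>r>0. ball x r \<subseteq> U \<and> (\<forall>y\<in>ball x r. norm (F y) \<le> C * norm (y - x) ^ m)"
proof (induction m arbitrary: F)
  case 0
  have "isCont F x"
    using 0(1) assms smooth_on_continuous continuous_on_eq_continuous_at by blast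
  then obtain r where r: "r > 0" "\<And>y. dist y x < r \<Longrightarrow> dist (F y) (F x) < 1"
    unfolding continuous_at_eps_delta by (metis zero_less_one)
  obtain r' where r': "r' > 0" "ball x r' \<subseteq> U" using assms open_contains_ball by blast
  show ?case
  proof (rule exI[of _ "norm (F x) + 1"], intro conjI, simp, rule exI[of _ "min r r'"], intro conjI ballI)
    fix y assume "y \<in> ball x (min r r')"
    then have "dist (F y) (F x) < 1" by (intro r(2)) (simp add: dist_commute)
    then have "norm (F y - F x) < 1" by (simp add: dist_norm)
    then have "norm (F y) \<le> norm (F x) + 1" by norm
    then show "norm (F y) \<le> (norm (F x) + 1) * norm (y - x) ^ 0" by simp
  qed (use r r' in auto)
next
  case (Suc m)
  have "\<exists>C\<ge>0. \<exists>r>0. ball x r \<subseteq> U \<and> (\<forall>y\<in>ball x r. norm (pdiff i F y) \<le> C * norm (y - x) ^ m)" for i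
    using Suc.prems by (intro Suc.IH smooth_on_pdiff) auto
  then obtain C r where C: "\<And>i. C i \<ge> 0" "\<And>i. r i > 0" "\<And>i. ball x (r i) \<subseteq> U"
    "\<And>i y. y \<in> ball x (r i) \<Longrightarrow> norm (pdiff i F y) \<le> C i * norm (y - x) ^ m"
    by metis
  let ?R = "min (r 1) (r 2)"
  have "norm (F y) \<le> (C 1 + C 2) * norm (y - x) ^ Suc m" if y: "y \<in> ball x ?R" for y
  proof -
    let ?S = "cball x (dist x y)"
    have S: "?S \<subseteq> ball x (r i)" for i using y exhaust_2[of i] by auto
    have SU: "z \<in> U" if "z \<in> ?S" for z using that S[of 1] C(3)[of 1] by blast
    have "norm (F y - F x) \<le> ((C 1 + C 2) * norm (y - x) ^ m) * norm (y - x)"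
    proof (rule differentiable_bound)
      show "convex ?S" by simp
      fix z assume z: "z \<in> ?S"
      have d: "F differentiable (at z)" using Suc.prems(1) SU[OF z] by (rule smooth_on_differentiable)
      show "(F has_derivative frechet_derivative F (at z)) (at z within ?S)"
        using d by (simp add: frechet_derivative_works has_derivative_at_withinI)
      have "norm (z - x) \<le> norm (y - x)" using z by (simp add: dist_norm norm_minus_commute)
      then have "norm (z - x) ^ m \<le> norm (y - x) ^ m" by (rule power_mono) simp
      then have p: "norm (pdiff i F z) \<le> C i * norm (y - x) ^ m" for i
        using C(4)[of z i] S[of i] z mult_left_mono[OF _ C(1)[of i]] by (meson order_trans subsetD)
      have "norm (pdiff 1 F z) + norm (pdiff 2 F z) \<le> (C 1 + C 2) * norm (y - x) ^ m"
        using p[of 1] p[of 2] by (simp add: algebra_simps)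
      then show "onorm (frechet_derivative F (at z)) \<le> (C 1 + C 2) * norm (y - x) ^ m"
        by (intro onorm_le order_trans[OF norm_frechet_derivative_le[OF d]] mult_right_mono) auto
    qed auto
    then show ?thesis using Suc.prems(2) by (simp add: algebra_simps)
  qed
  then show ?case
    using C(1,2)[of 1] C(1,2)[of 2] C(3)[of 1]
    by (rule_tac exI[of _ "C 1 + C 2"], intro conjI, simp, rule_tac exI[of _ ?R]) auto
qed

lemma pdiff_commute:
  fixes F :: "real^2 \<Rightarrow> complex"
  assumes "smooth_on U F" "open U" "u \<in> U"
  shows "pdiff i (pdiff j F) u = pdiff j (pdiff i F) u"
proof -
  have *: "L (pdiff i (pdiff j F) u) = partial_deriv i (partial_deriv j (\<lambda>x. L (F x))) u"
    if L: "bounded_linear L" for L :: "complex \<Rightarrow> real" and i j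
  proof -
    have "L (pdiff i (pdiff j F) u) = pdiff i (\<lambda>y. L (pdiff j F y)) u"
      by (rule pdiff_linear[OF L, symmetric])
         (use assms in \<open>blast intro: smooth_on_differentiable smooth_on_pdiff\<close>)
    also have "\<dots> = pdiff i (pdiff j (\<lambda>y. L (F y))) u"
      by (rule pdiff_cong[OF assms(2,3)])
         (use assms in \<open>simp add: pdiff_linear[OF L] smooth_on_differentiable\<close>)
    finally show ?thesis by (simp add: pdiff_real)
  qed
  have "L (pdiff i (pdiff j F) u) = L (pdiff j (pdiff i F) u)"
    if L: "bounded_linear L" for L :: "complex \<Rightarrow> real"
    unfolding *[OF L]
    by (rule partial_deriv_commute[OF smooth_on_bounded_linear[OF L assms(2,1)] assms(2,3)])
  then show ?thesis by (simp add: complex_eq_iff bounded_linear_Re bounded_linear_Im)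
qed

section \<open>Leading terms of solutions of a Cauchy-Riemann equation\<close>

text \<open>For \<open>\<beta> = \<i>\<close> this is twice the Cauchy-Riemann operator \<open>\<partial> / \<partial>z\<^sup>*\<close>.\<close>

definition dbar :: "complex \<Rightarrow> (real^2 \<Rightarrow> complex) \<Rightarrow> real^2 \<Rightarrow> complex" where
  "dbar \<beta> w u = pdiff 1 w u + \<beta> * pdiff 2 w u"

lemma smooth_on_dbar: "open U \<Longrightarrow> smooth_on U w \<Longrightarrow> smooth_on U (dbar \<beta> w)"
  unfolding dbar_def[abs_def] by (intro smooth_on_add smooth_on_mult smooth_on_pdiff smooth_on_const)

lemma dbar_pdiff:
  assumes "open U" "smooth_on U w" "u \<in> U"
  shows "pdiff i (dbar \<beta> w) u = dbar \<beta> (pdiff i w) u"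
proof -
  have d: "pdiff j w differentiable (at u)" for j
    using assms by (blast intro: smooth_on_differentiable smooth_on_pdiff)
  have "pdiff i (dbar \<beta> w) u = pdiff i (pdiff 1 w) u + \<beta> * pdiff i (pdiff 2 w) u"
    unfolding dbar_def[abs_def]
    by (subst pdiff_add) (auto intro!: d differentiable_mult simp: pdiff_linear[OF bounded_linear_mult_right d])
  also have "\<dots> = dbar \<beta> (pdiff i w) u"
    by (simp add: dbar_def pdiff_commute[OF assms(2,1,3), of i])
  finally show ?thesis .
qed

text \<open>Modulo a function vanishing to order \<open>m\<close>, the equation expresses \<open>\<partial>\<^sub>1 w\<close> as a multiple of \<open>\<partial>\<^sub>2 w\<close>. So all
  derivatives of order \<open>m\<close> at \<open>x\<close> are multiples of the single number \<open>\<partial>\<^sub>2\<^sup>m w(x)\<close>.\<close>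

lemma flat_Suc_dbar:
  assumes "open U" "x \<in> U"
  shows "\<lbrakk>smooth_on U w; flat m x (dbar \<beta> w); flat m x w; (pdiff 2 ^^ m) w x = 0\<rbrakk> \<Longrightarrow> flat (Suc m) x w"
proof (induction m arbitrary: w)
  case (Suc m)
  note sp = smooth_on_pdiff[OF Suc.prems(1)]
  have 2: "flat (Suc m) x (pdiff 2 w)"
  proof (rule Suc.IH[OF sp])
    show "flat m x (dbar \<beta> (pdiff 2 w))"
    proof (rule flat_cong[OF assms])
      show "flat m x (pdiff 2 (dbar \<beta> w))" using Suc.prems(2) by simp
    qed (rule dbar_pdiff[OF assms(1) Suc.prems(1)])
    show "flat m x (pdiff 2 w)" using Suc.prems(3) by simp
    show "(pdiff 2 ^^ m) (pdiff 2 w) x = 0" using Suc.prems(4) by (simp add: funpow_swap1)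
  qed
  have 1: "flat (Suc m) x (pdiff 1 w)"
  proof (rule flat_cong[OF assms])
    show "flat (Suc m) x (\<lambda>y. dbar \<beta> w y + (- \<beta>) * pdiff 2 w y)"
      by (intro flat_add[OF assms] flat_linear[OF assms bounded_linear_mult_right] 2 Suc.prems
          smooth_on_dbar smooth_on_mult smooth_on_const sp assms(1))
  qed (simp add: dbar_def)
  have "flat (Suc m) x (pdiff i w)" for i using 1 2 exhaust_2[of i] by auto
  then show ?case using Suc.prems(3) by (subst flat.simps(2)) simp
qed simp

text \<open>The linear coordinate \<open>\<zeta>\<close> centred at \<open>x\<close> with \<open>dbar \<beta> \<zeta> = 0\<close>; its powers are the homogeneous
  polynomial solutions.\<close>

definition hol :: "complex \<Rightarrow> real^2 \<Rightarrow> real^2 \<Rightarrow> complex" where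
  "hol \<beta> x y = of_real ((y - x) $ 2) - \<beta> * of_real ((y - x) $ 1)"

lemma hol_pow_pdiff:
  "pdiff i (\<lambda>y. c * hol \<beta> x y ^ Suc m) = (\<lambda>y. (c * of_nat (Suc m) * (if i = 1 then - \<beta> else 1)) * hol \<beta> x y ^ m)"
proof
  fix y
  have h: "(hol \<beta> x has_derivative (\<lambda>h. of_real (h $ 2) - \<beta> * of_real (h $ 1))) (at y)"
    unfolding hol_def[abs_def]
    by (intro has_derivative_diff has_derivative_mult_right bounded_linear.has_derivative[OF bounded_linear_of_real])
       (auto intro!: derivative_eq_intros bounded_linear.has_derivative[OF bounded_linear_vec_nth])
  have "((\<lambda>y. c * hol \<beta> x y ^ Suc m) has_derivative
     (\<lambda>h. c * (of_nat (Suc m) * (of_real (h $ 2) - \<beta> * of_real (h $ 1)) * hol \<beta> x y ^ (Suc m - 1)))) (at y)"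
    by (intro has_derivative_mult_right has_derivative_power h)
  note D = pdiff_eqI[OF this, of i]
  show "pdiff i (\<lambda>y. c * hol \<beta> x y ^ Suc m) y = (c * of_nat (Suc m) * (if i = 1 then - \<beta> else 1)) * hol \<beta> x y ^ m"
    unfolding D using exhaust_2[of i] by (auto simp: axis_def algebra_simps simp del: power_Suc)
qed

lemma smooth_hol_pow: "open U \<Longrightarrow> smooth_on U (\<lambda>y. c * hol \<beta> x y ^ m)"
proof -
  assume U: "open U"
  have s: "smooth_on U (hol \<beta> x)"
  proof (rule smooth_on_cong[OF U])
    show "smooth_on U (\<lambda>y. (of_real (y $ 2) - \<beta> * of_real (y $ 1)) - (of_real (x $ 2) - \<beta> * of_real (x $ 1)))"
      by (intro smooth_on_diff smooth_on_mult smooth_on_const U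
          smooth_on_bounded_linear[OF bounded_linear_of_real] smooth_on_linear bounded_linear_vec_nth)
  qed (simp add: hol_def algebra_simps)
  have "smooth_on U (\<lambda>y. hol \<beta> x y ^ m)"
    by (induction m) (auto intro: smooth_on_const smooth_on_mult U s)
  then show ?thesis by (intro smooth_on_mult smooth_on_const U)
qed

lemma dbar_hol_pow: "dbar \<beta> (\<lambda>y. c * hol \<beta> x y ^ m) = (\<lambda>y. 0)"
proof (cases m)
  case (Suc k)
  show ?thesis unfolding Suc dbar_def hol_pow_pdiff by (simp add: fun_eq_iff)
qed (simp add: dbar_def[abs_def])

lemma flat_hol_pow: "flat m x (\<lambda>y. c * hol \<beta> x y ^ m)"
proof (induction m arbitrary: c)
  case (Suc m)
  show ?case unfolding flat.simps(2) hol_pow_pdiff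
    using Suc by (simp add: hol_def)
qed simp

lemma funpow_pdiff_hol_pow: "(pdiff 2 ^^ m) (\<lambda>y. c * hol \<beta> x y ^ m) x = c * fact m"
proof (induction m arbitrary: c)
  case (Suc m)
  show ?case unfolding funpow_Suc_right o_apply hol_pow_pdiff using Suc by simp
qed simp

lemma funpow_pdiff_add:
  assumes "open U" "u \<in> U"
  shows "\<lbrakk>smooth_on U F; smooth_on U G\<rbrakk> \<Longrightarrow> (pdiff 2 ^^ m) (\<lambda>y. F y + G y) u = (pdiff 2 ^^ m) F u + (pdiff 2 ^^ m) G u"
proof -
  have "\<forall>u\<in>U. (pdiff 2 ^^ m) (\<lambda>y. F y + G y) u = (pdiff 2 ^^ m) F u + (pdiff 2 ^^ m) G u 
     \<and> smooth_on U ((pdiff 2 ^^ m) F) \<and> smooth_on U ((pdiff 2 ^^ m) G)" if "smooth_on U F" "smooth_on U G"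
  proof (induction m)
    case (Suc m)
    show ?case
    proof (intro ballI conjI)
      fix u assume u: "u \<in> U"
      have "pdiff 2 ((pdiff 2 ^^ m) (\<lambda>y. F y + G y)) u = pdiff 2 (\<lambda>u. (pdiff 2 ^^ m) F u + (pdiff 2 ^^ m) G u) u"
        using Suc by (intro pdiff_cong[OF assms(1) u]) auto
      also have "\<dots> = (pdiff 2 ^^ Suc m) F u + (pdiff 2 ^^ Suc m) G u"
        using Suc u by (subst pdiff_add) (auto intro: smooth_on_differentiable)
      finally show "(pdiff 2 ^^ Suc m) (\<lambda>y. F y + G y) u = (pdiff 2 ^^ Suc m) F u + (pdiff 2 ^^ Suc m) G u"
        by simp
    qed (use Suc in \<open>auto intro: smooth_on_pdiff\<close>)
  qed (use that in auto)
  then show "\<lbrakk>smooth_on U F; smooth_on U G\<rbrakk> \<Longrightarrow> (pdiff 2 ^^ m) (\<lambda>y. F y + G y) u = (pdiff 2 ^^ m) F u + (pdiff 2 ^^ m) G u"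
    using assms by blast
qed

lemma norm_le_hol:
  assumes "Im \<beta> \<noteq> 0"
  shows "norm (y - x) \<le> (1 + (1 + norm \<beta>) / \<bar>Im \<beta>\<bar>) * norm (hol \<beta> x y)"
proof -
  let ?v = "y - x" and ?Z = "hol \<beta> x y"
  have "Im ?Z = - Im \<beta> * ?v $ 1" by (simp add: hol_def)
  then have "\<bar>Im \<beta>\<bar> * \<bar>?v $ 1\<bar> \<le> norm ?Z" using abs_Im_le_cmod[of ?Z] by (simp add: abs_mult)
  then have 1: "\<bar>?v $ 1\<bar> \<le> norm ?Z / \<bar>Im \<beta>\<bar>" using assms by (simp add: field_simps)
  have "complex_of_real (?v $ 2) = ?Z + \<beta> * of_real (?v $ 1)" by (simp add: hol_def)
  then have "\<bar>?v $ 2\<bar> \<le> norm ?Z + norm \<beta> * \<bar>?v $ 1\<bar>"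
    by (metis norm_of_real norm_triangle_ineq norm_mult)
  also have "\<dots> \<le> norm ?Z + norm \<beta> * (norm ?Z / \<bar>Im \<beta>\<bar>)" by (intro add_left_mono mult_left_mono 1) simp
  finally have 2: "\<bar>?v $ 2\<bar> \<le> norm ?Z + norm \<beta> * (norm ?Z / \<bar>Im \<beta>\<bar>)" .
  have "norm ?v \<le> \<bar>?v $ 1\<bar> + \<bar>?v $ 2\<bar>" using norm_le_l1_cart[of ?v] by (simp add: sum_2)
  also have "\<dots> \<le> norm ?Z / \<bar>Im \<beta>\<bar> + (norm ?Z + norm \<beta> * (norm ?Z / \<bar>Im \<beta>\<bar>))" using 1 2 by simp
  also have "\<dots> = (1 + (1 + norm \<beta>) / \<bar>Im \<beta>\<bar>) * norm ?Z" by (simp add: field_simps add_divide_distrib)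
  finally show ?thesis .
qed

text \<open>Subtracting the right multiple \<open>c \<zeta>\<^sup>m\<close> from \<open>w\<close> raises the order of vanishing to \<open>m + 1\<close>. At the zeros of \<open>w\<close>
  close to \<open>x\<close> this bounds \<open>\<bar>c\<bar> \<bar>\<zeta>\<bar>\<^sup>m\<close> by a multiple of \<open>\<bar>y - x\<bar>\<^sup>m\<^sup>+\<^sup>1\<close>, and \<open>\<bar>\<zeta>\<bar>\<close> is comparable to \<open>\<bar>y - x\<bar>\<close>.
  Hence \<open>c = 0\<close>.\<close>

lemma flat_step:
  assumes U: "open U" "x \<in> U" and w: "smooth_on U w" and fl: "flat m x (dbar \<beta> w)" "flat m x w"
    and \<beta>: "Im \<beta> \<noteq> 0" and lim: "x islimpt {y. w y = 0}"
  shows "flat (Suc m) x w"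
proof -
  (* the coefficient of the leading term: (pdiff 2 ^^ m) maps c * hol ^ m to c * fact m *)
  define c where "c = (pdiff 2 ^^ m) w x / fact m"
  let ?P = "\<lambda>y. (-c) * hol \<beta> x y ^ m"
  define F where "F = (\<lambda>y. w y + ?P y)"
  have sP: "smooth_on U ?P" by (rule smooth_hol_pow[OF U(1)])
  have sF: "smooth_on U F" unfolding F_def by (intro smooth_on_add w sP U)
  have "flat (Suc m) x F"
  proof (rule flat_Suc_dbar[OF U sF])
    show "flat m x (dbar \<beta> F)"
    proof (rule flat_cong[OF U fl(1)])
      fix y assume y: "y \<in> U"
      have "dbar \<beta> F y = dbar \<beta> w y + dbar \<beta> ?P y"
        unfolding dbar_def F_def
        by (subst (1 2) pdiff_add) (use y w sP in \<open>auto intro: smooth_on_differentiable simp: algebra_simps\<close>)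
      then show "dbar \<beta> w y = dbar \<beta> F y" unfolding dbar_hol_pow by simp
    qed
    show "flat m x F" unfolding F_def by (intro flat_add[OF U] w sP fl(2) flat_hol_pow)
    show "(pdiff 2 ^^ m) F x = 0"
      unfolding F_def funpow_pdiff_add[OF U w sP] funpow_pdiff_hol_pow by (simp add: c_def)
  qed
  then obtain C r where C: "C \<ge> 0" "r > 0" "\<And>y. y \<in> ball x r \<Longrightarrow> norm (F y) \<le> C * norm (y - x) ^ Suc m"
    using flat_bound[OF U sF] by meson
  define L where "L = 1 + (1 + norm \<beta>) / \<bar>Im \<beta>\<bar>"
  have L: "L > 0" unfolding L_def by (intro add_pos_nonneg) auto
  have "c = 0"
  proof (rule ccontr)
    assume "c \<noteq> 0"
    define e where "e = min r (norm c / ((C + 1) * L ^ m))"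
    have e: "e > 0" using C L \<open>c \<noteq> 0\<close> by (simp add: e_def)
    obtain y where y: "w y = 0" "y \<noteq> x" "dist y x < e"
      using lim e unfolding islimpt_approachable by blast
    let ?n = "norm (y - x)"
    have n: "0 < ?n" "?n < e" using y by (auto simp: dist_norm)
    have "norm c * norm (hol \<beta> x y) ^ m \<le> C * ?n ^ Suc m"
      using C(3)[of y] y n(2) by (simp add: F_def norm_mult norm_power e_def dist_commute)
    moreover have "?n ^ m \<le> (L * norm (hol \<beta> x y)) ^ m"
      using norm_le_hol[OF \<beta>, of y x] by (intro power_mono) (auto simp: L_def)
    ultimately have "norm c * ?n ^ m \<le> norm c * (L ^ m * norm (hol \<beta> x y) ^ m)"
      by (intro mult_left_mono) (auto simp: power_mult_distrib)
    also have "\<dots> = L ^ m * (norm c * norm (hol \<beta> x y) ^ m)" by simp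
    also have "\<dots> \<le> L ^ m * (C * ?n ^ Suc m)"
      using L \<open>norm c * norm (hol \<beta> x y) ^ m \<le> _\<close> by (intro mult_left_mono) auto
    also have "\<dots> = (L ^ m * C * ?n) * ?n ^ m" by simp
    finally have "norm c \<le> L ^ m * C * ?n" using n by simp
    also have "\<dots> \<le> L ^ m * (C + 1) * ?n" using L by (intro mult_right_mono mult_left_mono) auto
    also have "\<dots> < norm c"
    proof -
      have "?n < norm c / ((C + 1) * L ^ m)" using n(2) by (simp add: e_def)
      then show ?thesis using L C(1) by (simp add: pos_less_divide_eq mult.commute)
    qed
    finally show False by simp
  qed
  then show ?thesis
    by (intro flat_Suc_dbar[OF U w fl]) (simp add: c_def)
qed

section \<open>The equation as a first-order complex system\<close>

lemma partial_add:
  assumes "P differentiable (at u)" "Q differentiable (at u)"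
  shows "partial_deriv i (\<lambda>x. P x + Q x) u = partial_deriv i P u + partial_deriv i Q u"
  using pdiff_add[OF assms, of i] by (simp add: pdiff_real)

text \<open>A linear second-order elliptic equation in two variables takes this form after division by the
  coefficient of \<open>f\<^sub>1\<^sub>1\<close>. Its symbol is \<open>\<bar>\<xi>\<^sub>1 + \<beta> \<xi>\<^sub>2\<bar>\<^sup>2\<close> for \<open>\<beta> = a + \<i> b\<close>, which is
  why the coefficient of \<open>f\<^sub>2\<^sub>2\<close> is written as \<open>a\<^sup>2 + b\<^sup>2\<close>.\<close>

locale elliptic_equation =
  fixes U :: "(real^2) set" and a b k1 k2 k3 f :: "real^2 \<Rightarrow> real"
  assumes U: "open U"
    and smooth: "smooth_on U a" "smooth_on U b" "smooth_on U k1" "smooth_on U k2" "smooth_on U k3" "smooth_on U f"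
    and b_pos: "\<And>u. u \<in> U \<Longrightarrow> b u > 0"
    and eqn: "\<And>u. u \<in> U \<Longrightarrow> D1 (D1 f) u
      + 2 * a u * D1 (D2 f) u
      + ((a u)\<^sup>2 + (b u)\<^sup>2) * D2 (D2 f) u
      = k1 u * D1 f u + k2 u * D2 f u + k3 u * f u"
begin

abbreviation "f1 \<equiv> D1 f"
abbreviation "f2 \<equiv> D2 f"

text \<open>Real and imaginary part of \<open>w = f\<^sub>1 + \<beta>\<^sup>* f\<^sub>2\<close>.\<close>

definition p where "p u = f1 u + a u * f2 u"
definition q where "q u = - (b u * f2 u)"

lemma smooth_f12: "smooth_on U f1" "smooth_on U f2"
  by (intro smooth_on_partial smooth)+

lemma smooth_pq: "smooth_on U p" "smooth_on U q"
proof -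
  show "smooth_on U p"
    unfolding p_def[abs_def] by (intro smooth_on_add smooth_on_mult U smooth smooth_f12)
  have "smooth_on U (\<lambda>u. (-1) * (b u * f2 u))"
    by (intro smooth_on_const smooth_on_mult U smooth smooth_f12)
  then show "smooth_on U q" by (simp add: q_def[abs_def])
qed

text \<open>Coefficients of \<open>f\<^sub>2\<close> in the real and imaginary part of \<open>(\<partial>\<^sub>1 + \<beta> \<partial>\<^sub>2) w\<close>; besides \<open>k2\<close> they
  collect the derivatives that fall on \<open>\<beta>\<close>.\<close>

definition m2 where "m2 u = k2 u + D1 a u + a u * D2 a u + b u * D2 b u"
definition m3 where "m3 u = b u * D2 a u - D1 b u - a u * D2 b u"

lemma smooth_m: "smooth_on U m2" "smooth_on U m3"
  unfolding m2_def[abs_def] m3_def[abs_def]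
  by (intro smooth_on_add smooth_on_diff smooth_on_mult smooth_on_partial U smooth)+

text \<open>The real part of \<open>(\<partial>\<^sub>1 + \<beta> \<partial>\<^sub>2) (\<partial>\<^sub>1 + \<beta>\<^sup>* \<partial>\<^sub>2) f\<close> contains the second derivatives in the combination of
  the equation; in the imaginary part they cancel.\<close>

lemma dbar_pq:
  assumes u: "u \<in> U"
  shows "cr_re a b p q u
           = k1 u * f1 u + m2 u * f2 u + k3 u * f u" (is ?A)
    and "cr_im a b p q u
           = m3 u * f2 u" (is ?B)
proof -
  note d = smooth_f12[THEN smooth_on_differentiable, OF u] smooth(1,2)[THEN smooth_on_differentiable, OF u]
  have p: "partial_deriv i p u = partial_deriv i f1 u + (partial_deriv i a u * f2 u + a u * partial_deriv i f2 u)" for i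
    unfolding p_def[abs_def]
    by (subst partial_add) (auto intro!: d differentiable_mult simp: partial_deriv_mult d)
  have q: "partial_deriv i q u = - (partial_deriv i b u * f2 u + b u * partial_deriv i f2 u)" for i
    using partial_deriv_cmult[of "\<lambda>u. b u * f2 u" u i "-1"]
    by (simp add: q_def[abs_def] partial_deriv_mult d differentiable_mult)
  have c: "D2 f1 u = D1 f2 u"
    by (rule partial_deriv_commute[OF smooth(6) U u])
  show ?A ?B
    using eqn[OF u] unfolding p q m2_def m3_def c by (simp_all add: algebra_simps power2_eq_square)
qed

definition w :: "real^2 \<Rightarrow> complex" where
  "w u = of_real (p u) + \<i> * of_real (q u)"

lemma smooth_w: "smooth_on U w"
  unfolding w_def[abs_def]
  by (intro smooth_on_add smooth_on_mult smooth_on_const U smooth_on_bounded_linear[OF bounded_linear_of_real] smooth_pq)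

definition \<beta> :: "real^2 \<Rightarrow> complex" where "\<beta> u = of_real (a u) + \<i> * of_real (b u)"

lemma smooth_\<beta>: "smooth_on U \<beta>"
  unfolding \<beta>_def[abs_def]
  by (intro smooth_on_add smooth_on_mult smooth_on_const U smooth_on_bounded_linear[OF bounded_linear_of_real] smooth)

lemma pdiff_w: "u \<in> U \<Longrightarrow> pdiff i w u = of_real (partial_deriv i p u) + \<i> * of_real (partial_deriv i q u)"
proof -
  assume u: "u \<in> U"
  note d = smooth_pq[THEN smooth_on_differentiable, OF u]
  have "(w has_derivative (\<lambda>h. of_real (frechet_derivative p (at u) h) + \<i> * of_real (frechet_derivative q (at u) h))) (at u)"
    unfolding w_def[abs_def]
    by (intro has_derivative_add has_derivative_mult_right bounded_linear.has_derivative[OF bounded_linear_of_real]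
        differentiable_has_derivative d)
  from pdiff_eqI[OF this, of i] show ?thesis by (simp add: partial_deriv_def)
qed

lemma dbar_w:
  assumes "u \<in> U"
  shows "dbar (\<beta> u) w u = of_real (k1 u) * of_real (f1 u) + (of_real (m2 u) + \<i> * of_real (m3 u)) * of_real (f2 u)
     + of_real (k3 u) * of_real (f u)"
  using dbar_pq[OF assms]
  by (simp add: dbar_def pdiff_w[OF assms] \<beta>_def complex_eq_iff)

text \<open>Since \<open>b\<close> does not vanish, the partial derivatives of \<open>f\<close> can be recovered from \<open>w\<close>.\<close>

lemma flat_f12:
  assumes x: "x \<in> U" and "flat m x w"
  shows "flat m x f1" "flat m x f2"
proof -
  have r: "flat m x (\<lambda>u. Re (w u))" "flat m x (\<lambda>u. Im (w u))"
    by (rule flat_linear[OF U x bounded_linear_Re smooth_w assms(2)],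
        rule flat_linear[OF U x bounded_linear_Im smooth_w assms(2)])
  have ri: "smooth_on U (\<lambda>u. Re (w u))" "smooth_on U (\<lambda>u. Im (w u))"
    by (rule smooth_on_bounded_linear[OF bounded_linear_Re U smooth_w],
        rule smooth_on_bounded_linear[OF bounded_linear_Im U smooth_w])
  have nz: "b u \<noteq> 0" if "u \<in> U" for u using b_pos[OF that] by simp
  show f2: "flat m x f2"
  proof (rule flat_cong[OF U x])
    show "flat m x (\<lambda>u. (-1 / b u) * Im (w u))"
      by (intro flat_bilinear[OF U x bounded_bilinear_mult] smooth_on_divide smooth_on_const U smooth r ri nz)
    show "(-1 / b u) * Im (w u) = f2 u" if "u \<in> U" for u
      using nz[OF that] by (simp add: w_def q_def)
  qed
  have s: "smooth_on U (\<lambda>u. - a u)"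
    by (intro smooth_on_bounded_linear[OF bounded_linear_minus[OF bounded_linear_ident]] smooth U)
  show "flat m x f1"
  proof (rule flat_cong[OF U x])
    show "flat m x (\<lambda>u. Re (w u) + (- a u) * f2 u)"
      by (intro flat_add[OF U x] flat_bilinear[OF U x bounded_bilinear_mult] smooth_on_mult s ri r f2 smooth_f12 U)
  qed (simp add: w_def p_def)
qed

text \<open>Induction on the order. If \<open>w\<close> vanishes to order \<open>m\<close>, so do the partial derivatives of \<open>f\<close>, the
  function \<open>f\<close> and thus the right-hand side of the equation for \<open>w\<close>. Replacing \<open>\<beta>\<close> by its value at \<open>x\<close> costs a
  term \<open>(\<beta>(x) - \<beta>) \<partial>\<^sub>2 w\<close>, which vanishes to order \<open>m\<close> as well, and \<open>flat_step\<close> applies.\<close>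

lemma flat_all:
  assumes x: "x \<in> U" and lim: "x islimpt {u \<in> U. f u = 0 \<and> f1 u = 0 \<and> f2 u = 0}"
  shows "flat m x w" "flat m x f"
proof -
  have "x islimpt {u \<in> U. f u = 0}"
    using lim by (rule islimpt_subset) auto
  moreover have "closedin (top_of_set U) {u \<in> U. f u = 0}"
    using smooth_on_continuous[OF smooth(6)] by (rule continuous_closedin_preimage_constant)
  ultimately have f0: "f x = 0"
    using x unfolding closedin_limpt by blast
  have limw: "x islimpt {u. w u = 0}"
    using lim by (rule islimpt_subset) (auto simp: w_def p_def q_def)
  have fm: "flat (Suc m) x f" if "flat m x w" for m
  proof -
    have "flat m x (pdiff i f)" for i
      using flat_f12[OF x that] exhaust_2[of i] by (auto simp: pdiff_real)
    then show ?thesis using f0 by simp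
  qed
  show w: "flat m x w" for m
  proof (induction m)
    case (Suc m)
    note f12 = flat_f12[OF x Suc]
    have fl: "flat m x f" using fm[OF Suc] by (rule flat_SucD)
    let ?e = "\<lambda>u. of_real (k1 u) * of_real (f1 u) + (of_real (m2 u) + \<i> * of_real (m3 u)) * of_real (f2 u)
     + of_real (k3 u) * of_real (f u) :: complex"
    note sm = smooth_on_add[OF U] smooth_on_mult[OF U] smooth_on_const[OF U]
          smooth_on_bounded_linear[OF bounded_linear_of_real U] smooth smooth_f12 smooth_m smooth_\<beta>
    have e: "flat m x ?e"
      by (intro flat_add[OF U x] flat_bilinear[OF U x bounded_bilinear_mult] flat_linear[OF U x bounded_linear_of_real]
          f12 fl sm)
    have se: "smooth_on U ?e" by (intro sm)
    let ?r = "\<lambda>u. (\<beta> x - \<beta> u) * pdiff 2 w u"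
    have s: "smooth_on U (\<lambda>u. \<beta> x - \<beta> u)" "smooth_on U (pdiff 2 w)"
      by (intro smooth_on_diff[OF U] sm smooth_on_pdiff smooth_w)+
    have r: "flat m x ?r"
    proof (cases m)
      case (Suc k)
      show ?thesis unfolding Suc
        using Suc.IH[unfolded Suc]
        by (intro flat_bilinear_gain[OF U x bounded_bilinear_mult] s) simp_all
    qed simp
    have d: "flat m x (dbar (\<beta> x) w)"
    proof (rule flat_cong[OF U x])
      show "flat m x (\<lambda>u. ?e u + ?r u)"
        by (intro flat_add[OF U x] e r se smooth_on_mult[OF U] s)
      show "?e u + ?r u = dbar (\<beta> x) w u" if "u \<in> U" for u
        unfolding dbar_w[OF that, symmetric] by (simp add: dbar_def algebra_simps)
    qed
    show ?case
      using b_pos[OF x] by (intro flat_step[OF U x smooth_w d Suc.IH _ limw]) (simp add: \<beta>_def)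
  qed simp
  show "flat m x f" by (rule flat_SucD[OF fm[OF w]])
qed

end

section \<open>Smooth cutoff functions\<close>

text \<open>For \<open>j = 0\<close> the usual flat function \<open>e\<^sup>-\<^sup>1\<^sup>/\<^sup>t\<close>. With the factor \<open>t\<^sup>-\<^sup>j\<close> the family is closed
  under differentiation up to linear combinations, so that smoothness is proved for all \<open>j\<close> at once.\<close>

definition expinv :: "nat \<Rightarrow> real \<Rightarrow> real" where
  "expinv j t = (if t > 0 then (1 / t) ^ j * exp (- 1 / t) else 0)"

lemma expinv_tendsto_0: "(expinv j \<longlongrightarrow> 0) (at 0)"
proof -
  have "((\<lambda>u::real. u ^ j / exp u) \<longlongrightarrow> 0) at_top" by (rule tendsto_power_div_exp_0)
  then have "((\<lambda>t::real. inverse t ^ j / exp (inverse t)) \<longlongrightarrow> 0) (at_right 0)"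
    by (rule filterlim_compose) (rule filterlim_inverse_at_top_right)
  then have "(expinv j \<longlongrightarrow> 0) (at_right 0)"
    by (rule Lim_transform_eventually)
       (auto simp: eventually_at_filter expinv_def exp_minus inverse_eq_divide divide_simps)
  moreover have "(expinv j \<longlongrightarrow> 0) (at_left 0)"
    by (rule Lim_transform_eventually[OF tendsto_const]) (auto simp: eventually_at_filter expinv_def)
  ultimately show ?thesis by (simp add: filterlim_split_at)
qed

lemma expinv_deriv: "(expinv j has_real_derivative expinv (j + 2) t - j * expinv (j + 1) t) (at t)"
proof -
  consider "t > 0" | "t < 0" | "t = 0" by linarith
  then show ?thesis
  proof cases
    case 1
    have d: "((\<lambda>t. 1 / t) has_real_derivative - (1 / t)\<^sup>2) (at t)"
      using 1 by (auto intro!: derivative_eq_intros simp: power2_eq_square)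
    have pw: "((\<lambda>t. (1 / t) ^ j) has_real_derivative - real j * (1 / t) ^ Suc j) (at t)"
    proof (cases j)
      case (Suc m)
      have eq: "(1 + real m) * (- r\<^sup>2 * r ^ m) = - real (Suc m) * r ^ Suc (Suc m)" for r :: real
        by (simp add: power2_eq_square algebra_simps)
      show ?thesis unfolding Suc by (rule DERIV_cong[OF DERIV_power_Suc[OF d] eq])
    qed simp
    have ex: "((\<lambda>t. exp (- 1 / t)) has_real_derivative exp (- 1 / t) * (1 / t)\<^sup>2) (at t)"
      using 1 by (auto intro!: derivative_eq_intros simp: power2_eq_square)
    have "((\<lambda>t. (1 / t) ^ j * exp (- 1 / t)) has_real_derivative expinv (j + 2) t - j * expinv (j + 1) t) (at t)"
      by (rule DERIV_cong[OF DERIV_mult[OF pw ex]])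
         (use 1 in \<open>simp add: expinv_def power_add power2_eq_square algebra_simps\<close>)
    then show ?thesis
      by (rule has_field_derivative_transform_within_open[where S = "{0<..}"]) (use 1 in \<open>auto simp: expinv_def\<close>)
  next
    case 2
    have "((\<lambda>t. 0) has_real_derivative expinv (j + 2) t - j * expinv (j + 1) t) (at t)"
      using 2 by (simp add: expinv_def)
    then show ?thesis
      by (rule has_field_derivative_transform_within_open[where S = "{..<0}"]) (use 2 in \<open>auto simp: expinv_def\<close>)
  next
    case 3
    have "((\<lambda>h. (expinv j (0 + h) - expinv j 0) / h) \<longlongrightarrow> 0) (at 0)"
      by (rule Lim_transform_eventually[OF expinv_tendsto_0[of "Suc j"]])
         (auto simp: eventually_at_filter expinv_def)
    then show ?thesis using 3 by (simp add: DERIV_def expinv_def)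
  qed
qed

lemma smooth_expinv: "smooth_on UNIV (expinv j)"
proof -
  have "Ck_on k UNIV (expinv j)" for k j
  proof (induction k arbitrary: j)
    case 0
    show ?case by (auto simp: continuous_on_eq_continuous_at intro: DERIV_isCont[OF expinv_deriv])
  next
    case (Suc k)
    show ?case
    proof (rule Ck_on_SucI)
      show "(expinv j has_derivative (\<lambda>h. (expinv (j + 2) t - j * expinv (j + 1) t) * h)) (at t)" for t
        using expinv_deriv[of j t] by (simp add: has_field_derivative_def)
      show "Ck_on k UNIV (\<lambda>t. (expinv (j + 2) t - j * expinv (j + 1) t) * v)" for v :: real
        by (intro Ck_on_mult Ck_on_diff Ck_on_const Suc.IH) auto
    qed auto
  qed
  then show ?thesis by (simp add: smooth_on_def)
qed

text \<open>With \<open>e(t) = e\<^sup>-\<^sup>1\<^sup>/\<^sup>t\<close> for positive \<open>t\<close> and \<open>e(t) = 0\<close> otherwise, the quotient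
  \<open>e(2 - t) / (e(2 - t) + e(t - 1))\<close> has the required values.\<close>

lemma smooth_step:
  obtains H :: "real \<Rightarrow> real" and H' B
  where "smooth_on UNIV H" "\<And>t. t \<le> 1 \<Longrightarrow> H t = 1" "\<And>t. t \<ge> 2 \<Longrightarrow> H t = 0"
    "\<And>t. 0 \<le> H t" "\<And>t. H t \<le> 1" "\<And>t. (H has_real_derivative H' t) (at t)"
    "\<And>t. \<bar>H' t\<bar> \<le> B" "\<And>t. t < 1 \<or> t > 2 \<Longrightarrow> H' t = 0"
proof -
  define e where "e = expinv 0"
  have e0: "e t \<ge> 0" "t > 0 \<Longrightarrow> e t > 0" "t \<le> 0 \<Longrightarrow> e t = 0" for t by (auto simp: e_def expinv_def)
  define H where "H t = e (2 - t) / (e (2 - t) + e (t - 1))" for t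
  have pos: "e (2 - t) + e (t - 1) > 0" for t
    using e0(1)[of "2 - t"] e0(1)[of "t - 1"] e0(2)[of "2 - t"] e0(2)[of "t - 1"]
    by (cases "t < 2") (auto intro: add_pos_nonneg add_nonneg_pos)
  have s: "smooth_on UNIV (\<lambda>t. e (2 - t))" "smooth_on UNIV (\<lambda>t. e (t - 1))"
    unfolding e_def
    by (intro smooth_on_compose[OF _ _ _ smooth_expinv] smooth_on_diff smooth_on_const
        smooth_on_linear bounded_linear_ident open_UNIV subset_UNIV)+
  have H: "smooth_on UNIV H"
    unfolding H_def[abs_def]
    by (intro smooth_on_divide smooth_on_add s open_UNIV) (rule less_imp_neq[OF pos, symmetric])
  define H' where "H' = deriv H"
  have "H differentiable (at t)" for t using H by (rule smooth_on_differentiable) simp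
  then have D: "(H has_real_derivative H' t) (at t)" for t
    unfolding H'_def by (metis DERIV_deriv_iff_real_differentiable)
  have 1: "H t = 1" if "t \<le> 1" for t using that pos[of t] e0(3)[of "t - 1"] by (simp add: H_def)
  have 2: "H t = 0" if "t \<ge> 2" for t using that e0(3)[of "2 - t"] by (simp add: H_def)
  have z: "H' t = 0" if t: "t < 1 \<or> t > 2" for t
  proof -
    from t have "(H has_real_derivative 0) (at t)"
    proof
      assume "t < 1"
      then show ?thesis
        using has_field_derivative_transform_within_open[of "\<lambda>t. 1" 0 t "{..<1}" H] by (simp add: 1)
    next
      assume "t > 2"
      then show ?thesis
        using has_field_derivative_transform_within_open[of "\<lambda>t. 0" 0 t "{2<..}" H] by (simp add: 2)
    qed
    with D[of t] show ?thesis by (rule DERIV_unique)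
  qed
  have "smooth_on UNIV (\<lambda>t. frechet_derivative H (at t) 1)" using H by (rule smooth_on_frechet) simp
  moreover have "frechet_derivative H (at t) 1 = H' t" for t
    using frechet_derivative_eqI[OF D[of t, unfolded has_field_derivative_def]] by simp
  ultimately have "continuous_on {1..2} H'"
    by (auto dest!: smooth_on_continuous intro: continuous_on_subset)
  then have "bounded (H' ` {1..2})" by (intro compact_imp_bounded compact_continuous_image) auto
  then obtain B where B: "\<And>t. t \<in> {1..2} \<Longrightarrow> \<bar>H' t\<bar> \<le> B"
    unfolding bounded_iff by (metis imageI real_norm_def)
  have "\<bar>H' t\<bar> \<le> B" for t
    using B[of t] B[of 1] z[of t] by (cases "t \<in> {1..2}") (auto simp: not_le)
  moreover have "0 \<le> H t" "H t \<le> 1" for t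
    using e0(1)[of "2 - t"] e0(1)[of "t - 1"] pos[of t] by (auto simp: H_def divide_simps)
  ultimately show thesis using that[of H H' B] H 1 2 D z by blast
qed

section \<open>Integration by parts\<close>

lemma integral_translation:
  fixes V :: "'a::euclidean_space \<Rightarrow> real"
  assumes "integrable lborel V"
  shows "integrable lborel (\<lambda>x. V (x + c))" "(\<integral>x. V (x + c) \<partial>lborel) = (\<integral>x. V x \<partial>lborel)"
proof -
  have V: "V \<in> borel_measurable borel" using assms by auto
  have "integrable (distr lborel borel ((+) c)) V" unfolding lborel_distr_plus by (rule assms)
  then show "integrable lborel (\<lambda>x. V (x + c))"
    using V by (subst (asm) integrable_distr_eq) (auto simp: add.commute)
  have "(\<integral>x. V x \<partial>lborel) = (\<integral>x. V x \<partial>distr lborel borel ((+) c))" by (simp add: lborel_distr_plus)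
  also have "\<dots> = (\<integral>x. V (x + c) \<partial>lborel)"
    using V by (subst integral_distr) (auto simp: add.commute)
  finally show "(\<integral>x. V (x + c) \<partial>lborel) = (\<integral>x. V x \<partial>lborel)" by simp
qed

lemma integrable_compact_support:
  fixes F :: "'a::euclidean_space \<Rightarrow> real"
  assumes "compact K" "continuous_on K F" "\<And>x. x \<notin> K \<Longrightarrow> F x = 0"
  shows "integrable lborel F"
proof -
  have "(\<lambda>x. indicator K x *\<^sub>R F x) = F" using assms(3) by (auto simp: indicator_def fun_eq_iff)
  then show ?thesis using borel_integrable_compact[OF assms(1,2)] by simp
qed

text \<open>The integral of \<open>V(x + t e\<^sub>i)\<close> does not depend on \<open>t\<close>; differentiate under the integral sign at \<open>t = 0\<close>.
  The difference quotients are dominated by the mean value theorem.\<close>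

lemma integral_partial_deriv_zero:
  assumes W: "open W" and V: "smooth_on W V" and K: "compact K" "K \<subseteq> W" and V0: "\<And>x. x \<notin> K \<Longrightarrow> V x = 0"
  shows "integrable lborel (partial_deriv i V)" "(\<integral>x. partial_deriv i V x \<partial>lborel) = 0"
proof -
  let ?D = "partial_deriv i V" and ?e = "axis i 1 :: real^2"
  have diff: "V differentiable (at x)" for x
  proof (cases "x \<in> K")
    case True then show ?thesis using V K by (blast intro: smooth_on_differentiable)
  next
    case False
    show ?thesis
      by (rule differentiable_cong_open[where P="\<lambda>x. 0" and S="-K"])
         (use False K V0 in \<open>auto intro: compact_imp_closed\<close>)
  qed
  have D0: "?D x = 0" if "x \<notin> K" for x
  proof -
    have "?D x = partial_deriv i (\<lambda>x. 0) x"
      by (rule partial_deriv_cong[where S="-K"]) (use that K V0 in \<open>auto intro: compact_imp_closed\<close>)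
    then show ?thesis by (simp add: partial_deriv_def)
  qed
  have cD: "continuous_on K ?D"
    using smooth_on_continuous[OF smooth_on_partial[OF V]] K(2) by (rule continuous_on_subset)
  show int: "integrable lborel ?D" by (rule integrable_compact_support[OF K(1) cD D0])
  have cV: "continuous_on K V" using smooth_on_continuous[OF V] K(2) by (rule continuous_on_subset)
  have intV: "integrable lborel V" by (rule integrable_compact_support[OF K(1) cV V0])
  have "bounded (?D ` K)" using compact_continuous_image[OF cD K(1)] by (rule compact_imp_bounded)
  then obtain B0 where "\<forall>x\<in>K. \<bar>?D x\<bar> \<le> B0" by (auto simp: bounded_iff)
  then have B: "\<bar>?D x\<bar> \<le> max B0 0" for x using D0[of x] by (cases "x \<in> K") auto
  define B where "B = max B0 0"
  obtain r where r: "\<And>x. x \<in> K \<Longrightarrow> norm x \<le> r" using K(1) compact_imp_bounded bounded_iff by metis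
  define s where "s n x = (V (x + (1 / Suc n) *\<^sub>R ?e) - V x) * Suc n" for n x
  have s0: "(\<integral>x. s n x \<partial>lborel) = 0" and ints: "integrable lborel (s n)" for n
    unfolding s_def using integral_translation[OF intV, of "(1 / Suc n) *\<^sub>R ?e"] intV
    by (simp_all del: of_nat_Suc)
  have mvt: "\<exists>z. V (x + t *\<^sub>R ?e) - V x = t * ?D (x + z *\<^sub>R ?e)" if "t > 0" for t x
  proof -
    have "\<exists>z>0. z < t \<and> V (x + t *\<^sub>R ?e) - V (x + 0 *\<^sub>R ?e) = (t - 0) * ?D (x + z *\<^sub>R ?e)"
      using that by (rule MVT2) (rule partial_line_DERIV[OF diff])
    then show ?thesis by auto
  qed
  have "(\<lambda>n. \<integral>x. s n x \<partial>lborel) \<longlonglongrightarrow> (\<integral>x. ?D x \<partial>lborel)"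
  proof (rule integral_dominated_convergence[where w="\<lambda>x. B * indicator (cball 0 (r + 1)) x"])
    show "integrable lborel (\<lambda>x::real^2. B * indicator (cball 0 (r + 1)) x)"
      by (intro integrable_mult_right integrable_real_indicator emeasure_compact_finite) auto
    show "AE x in lborel. (\<lambda>n. s n x) \<longlonglongrightarrow> ?D x"
    proof (rule AE_I2)
      fix x
      have "((\<lambda>t. V (x + t *\<^sub>R ?e)) has_real_derivative ?D (x + 0 *\<^sub>R ?e)) (at 0)"
        by (rule partial_line_DERIV[OF diff])
      then have lim: "((\<lambda>h. (V (x + h *\<^sub>R ?e) - V x) / h) \<longlongrightarrow> ?D x) (at 0)"
        by (simp add: DERIV_def)
      have "filterlim (\<lambda>n. 1 / real (Suc n)) (at 0) sequentially"
        unfolding filterlim_at using LIMSEQ_inverse_real_of_nat by (auto simp: inverse_eq_divide)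
      from filterlim_compose[OF lim this]
      show "(\<lambda>n. s n x) \<longlonglongrightarrow> ?D x" by (simp add: s_def[abs_def])
    qed
    show "AE x in lborel. norm (s n x) \<le> B * indicator (cball 0 (r + 1)) x" for n
    proof (rule AE_I2)
      fix x
      show "norm (s n x) \<le> B * indicator (cball 0 (r + 1)) x"
      proof (cases "norm x \<le> r + 1")
        case True
        obtain z where "V (x + (1 / Suc n) *\<^sub>R ?e) - V x = (1 / Suc n) * ?D (x + z *\<^sub>R ?e)"
          using mvt[of "1 / Suc n" x] by auto
        then have "s n x = ?D (x + z *\<^sub>R ?e)" by (simp add: s_def)
        then show ?thesis using B True by (simp add: B_def)
      next
        case False
        have "norm (x + (1 / Suc n) *\<^sub>R ?e) \<ge> norm x - norm ((1 / Suc n) *\<^sub>R ?e)"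
          by (metis norm_diff_ineq)
        moreover have "norm ((1 / Suc n) *\<^sub>R ?e) \<le> 1" by (simp add: norm_axis_1)
        ultimately have "norm (x + (1 / Suc n) *\<^sub>R ?e) > r" using False by linarith
        then have "V (x + (1 / Suc n) *\<^sub>R ?e) = 0" "V x = 0"
          using V0 r False by fastforce+
        then show ?thesis using False by (simp add: s_def)
      qed
    qed
  qed (use int ints in auto)
  then show "(\<integral>x. ?D x \<partial>lborel) = 0" unfolding s0 by (simp add: LIMSEQ_const_iff)
qed

section \<open>The pointwise Carleman identity\<close>

text \<open>The pointwise core of Carleman's method, for \<open>v = e\<^sup>-\<^sup>\<phi> w = p + \<i> q\<close>. Conjugation with the weight turns
  \<open>\<partial>\<^sub>1 + \<beta> \<partial>\<^sub>2\<close> into \<open>S + T\<close> with \<open>S = X + \<i> b \<partial>\<^sub>2\<close> symmetric and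
  \<open>T = \<partial>\<^sub>1 + a \<partial>\<^sub>2 + \<i> b \<phi>\<^sub>2\<close> antisymmetric up to terms of order zero; here \<open>X = \<phi>\<^sub>1 + a \<phi>\<^sub>2\<close>. In
  \<open>\<bar>S v + T v\<bar>\<^sup>2 = \<bar>S v\<bar>\<^sup>2 + \<bar>T v\<bar>\<^sup>2 + 2 Re (S v \<cdot> (T v)\<^sup>*)\<close> the mixed term is, by \<open>div_identity\<close>, a divergence
  minus \<open>\<Lambda> / 2 \<bar>v\<bar>\<^sup>2\<close> and an error with first derivatives of \<open>v\<close>. The first bracket on the left-hand
  side below is this divergence. The error is absorbed by \<open>\<bar>S v\<bar>\<^sup>2 + \<bar>T v\<bar>\<^sup>2\<close>.\<close>

lemma carleman_algebra:
  fixes p q p1 p2 q1 q2 a b b1 b2 \<phi>1 \<phi>2 \<Lambda> m :: real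
  assumes b: "b > 0" and m: "\<bar>a\<bar> \<le> m" "\<bar>b\<bar> \<le> m" "\<bar>b2\<bar> \<le> m" "\<bar>(a * b2 + b1) / b\<bar> \<le> m"
  defines "X \<equiv> \<phi>1 + a * \<phi>2"
  shows "2 * (X * (p * (p1 + a * p2) + q * (q1 + a * q2)) + b * (p2 * q1 - p1 * q2)
        + b\<^sup>2 * \<phi>2 * (p * p2 + q * q2) + \<Lambda> / 2 * (p\<^sup>2 + q\<^sup>2) + b2 * p * q1 - b1 * p * q2)
      + (- \<Lambda> - (4 * m\<^sup>2 + 2 * m) * (1 + \<bar>\<phi>1\<bar> + \<bar>\<phi>2\<bar>)) * (p\<^sup>2 + q\<^sup>2)
    \<le> (p1 + a * p2 - b * q2 + X * p - b * \<phi>2 * q)\<^sup>2 + (q1 + a * q2 + b * p2 + X * q + b * \<phi>2 * p)\<^sup>2"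
proof -
  define c where "c = (a * b2 + b1) / b"
  have c: "b1 = c * b - a * b2" using b by (simp add: c_def)
  define Sr Si Tr Ti where "Sr = X * p - b * q2" and "Si = X * q + b * p2"
    and "Tr = p1 + a * p2 - b * \<phi>2 * q" and "Ti = q1 + a * q2 + b * \<phi>2 * p"
  have m0: "m \<ge> 0" using m by linarith
  have cross: "2 * (Sr * Tr + Si * Ti) = 2 * (X * (p * (p1 + a * p2) + q * (q1 + a * q2)) + b * (p2 * q1 - p1 * q2)
        + b\<^sup>2 * \<phi>2 * (p * p2 + q * q2))"
    unfolding Sr_def Si_def Tr_def Ti_def by (simp add: algebra_simps power2_eq_square)
  (* the first derivatives in the error term are traded for Sr and Ti, whose squares are available *)
  have err: "b2 * p * q1 - b1 * p * q2 = b2 * p * Ti - b * b2 * \<phi>2 * p\<^sup>2 - c * X * p\<^sup>2 + c * p * Sr"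
    unfolding c Sr_def Ti_def by (simp add: algebra_simps power2_eq_square)
  have y1: "2 * (b2 * p * Ti) \<le> Ti\<^sup>2 + m\<^sup>2 * p\<^sup>2"
  proof -
    have "2 * (b2 * p * Ti) \<le> Ti\<^sup>2 + b2\<^sup>2 * p\<^sup>2"
      using zero_le_power2[of "Ti - b2 * p"] by (simp add: power2_eq_square algebra_simps)
    moreover have "b2\<^sup>2 * p\<^sup>2 \<le> m\<^sup>2 * p\<^sup>2" using m(3) by (intro mult_right_mono) (auto simp: abs_le_square_iff[symmetric])
    ultimately show ?thesis by linarith
  qed
  have y2: "2 * (c * p * Sr) \<le> Sr\<^sup>2 + m\<^sup>2 * p\<^sup>2"
  proof -
    have "2 * (c * p * Sr) \<le> Sr\<^sup>2 + c\<^sup>2 * p\<^sup>2"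
      using zero_le_power2[of "Sr - c * p"] by (simp add: power2_eq_square algebra_simps)
    moreover have "c\<^sup>2 * p\<^sup>2 \<le> m\<^sup>2 * p\<^sup>2"
      using m(4) by (intro mult_right_mono) (auto simp: abs_le_square_iff[symmetric] c_def)
    ultimately show ?thesis by linarith
  qed
  have y3: "- (2 * (b * b2 * \<phi>2 * p\<^sup>2)) \<le> 2 * m\<^sup>2 * \<bar>\<phi>2\<bar> * p\<^sup>2"
  proof -
    have "\<bar>b * b2\<bar> \<le> m * m" unfolding abs_mult using m m0 by (intro mult_mono) auto
    then have "\<bar>b * b2\<bar> * \<bar>\<phi>2\<bar> \<le> m\<^sup>2 * \<bar>\<phi>2\<bar>"
      unfolding power2_eq_square by (rule mult_right_mono) simp
    moreover have "- (b * b2 * \<phi>2) \<le> \<bar>b * b2\<bar> * \<bar>\<phi>2\<bar>"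
      unfolding abs_mult[symmetric] by (rule abs_ge_minus_self)
    ultimately have "- (b * b2 * \<phi>2) \<le> m\<^sup>2 * \<bar>\<phi>2\<bar>" by (rule order_trans[rotated])
    then have "- (b * b2 * \<phi>2) * p\<^sup>2 \<le> m\<^sup>2 * \<bar>\<phi>2\<bar> * p\<^sup>2" by (rule mult_right_mono) simp
    then have "- (b * b2 * \<phi>2 * p\<^sup>2) \<le> m\<^sup>2 * \<bar>\<phi>2\<bar> * p\<^sup>2" by (simp only: mult_minus_left)
    then show ?thesis unfolding mult.assoc[of 2] by linarith
  qed
  have y4: "- (2 * (c * X * p\<^sup>2)) \<le> (2 * m * \<bar>\<phi>1\<bar> + 2 * m\<^sup>2 * \<bar>\<phi>2\<bar>) * p\<^sup>2"
  proof -
    have "\<bar>X\<bar> \<le> \<bar>\<phi>1\<bar> + \<bar>a\<bar> * \<bar>\<phi>2\<bar>" unfolding X_def by (metis abs_mult abs_triangle_ineq)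
    also have "\<dots> \<le> \<bar>\<phi>1\<bar> + m * \<bar>\<phi>2\<bar>" using m by (intro add_left_mono mult_right_mono) auto
    finally have "\<bar>c\<bar> * \<bar>X\<bar> \<le> m * (\<bar>\<phi>1\<bar> + m * \<bar>\<phi>2\<bar>)"
      using m(4) m0 unfolding c_def[symmetric] by (intro mult_mono) auto
    moreover have "- (c * X) \<le> \<bar>c\<bar> * \<bar>X\<bar>" by (metis abs_ge_minus_self abs_mult)
    ultimately have "- (c * X) \<le> m * (\<bar>\<phi>1\<bar> + m * \<bar>\<phi>2\<bar>)" by linarith
    then have "- (c * X) * p\<^sup>2 \<le> m * (\<bar>\<phi>1\<bar> + m * \<bar>\<phi>2\<bar>) * p\<^sup>2" by (rule mult_right_mono) simp
    then show ?thesis by (simp add: algebra_simps power2_eq_square)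
  qed
  have "2 * (b2 * p * q1 - b1 * p * q2)
      \<le> Sr\<^sup>2 + Ti\<^sup>2 + (2 * m\<^sup>2 + 2 * m\<^sup>2 * \<bar>\<phi>2\<bar> + (2 * m * \<bar>\<phi>1\<bar> + 2 * m\<^sup>2 * \<bar>\<phi>2\<bar>)) * p\<^sup>2"
    unfolding err ring_distribs using y1 y2 y3 y4[unfolded distrib_right] by linarith
  also have "(2 * m\<^sup>2 + 2 * m\<^sup>2 * \<bar>\<phi>2\<bar> + (2 * m * \<bar>\<phi>1\<bar> + 2 * m\<^sup>2 * \<bar>\<phi>2\<bar>)) * p\<^sup>2
      \<le> (4 * m\<^sup>2 + 2 * m) * (1 + \<bar>\<phi>1\<bar> + \<bar>\<phi>2\<bar>) * (p\<^sup>2 + q\<^sup>2)"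
    using m0 by (intro mult_mono) (auto simp: algebra_simps intro!: add_nonneg_nonneg mult_nonneg_nonneg)
  finally have e: "2 * (b2 * p * q1 - b1 * p * q2)
      \<le> Sr\<^sup>2 + Ti\<^sup>2 + (4 * m\<^sup>2 + 2 * m) * (1 + \<bar>\<phi>1\<bar> + \<bar>\<phi>2\<bar>) * (p\<^sup>2 + q\<^sup>2)" by simp
  have "(p1 + a * p2 - b * q2 + X * p - b * \<phi>2 * q)\<^sup>2 + (q1 + a * q2 + b * p2 + X * q + b * \<phi>2 * p)\<^sup>2
      = (Sr + Tr)\<^sup>2 + (Si + Ti)\<^sup>2"
    unfolding Sr_def Si_def Tr_def Ti_def by (simp add: algebra_simps)
  also have "\<dots> = Sr\<^sup>2 + Ti\<^sup>2 + 2 * (Sr * Tr + Si * Ti) + (Tr\<^sup>2 + Si\<^sup>2)"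
    by (simp add: algebra_simps power2_eq_square)
  finally have main: "(p1 + a * p2 - b * q2 + X * p - b * \<phi>2 * q)\<^sup>2 + (q1 + a * q2 + b * p2 + X * q + b * \<phi>2 * p)\<^sup>2
     \<ge> Sr\<^sup>2 + Ti\<^sup>2 + 2 * (Sr * Tr + Si * Ti)" by simp
  have ring: "2 * (A + B + C + \<Lambda> / 2 * N + x - y) + (- \<Lambda> - Y) * N = 2 * (A + B + C) + (2 * (x - y) - Y * N)"
    for A B C N x y Y :: real by (simp add: algebra_simps)
  show ?thesis unfolding ring cross[symmetric] using e main by linarith
qed

text \<open>Here \<open>\<rho>\<close> stands for \<open>\<bar>\<zeta>\<bar>\<close>, \<open>s = \<rho>\<^sup>2 = \<xi>\<^sup>2 + \<eta>\<^sup>2\<close> has the first partial derivatives \<open>s1\<close> and \<open>s2\<close>, and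
  \<open>g\<close>, \<open>g'\<close> are the first two derivatives of \<open>ln s / 2 - K \<surd>s\<close> as a function of \<open>s\<close>. The sum on the left-hand side is
  the second-order operator applied to the weight. For frozen coefficients the logarithm contributes nothing and
  \<open>- K \<surd>s\<close> contributes exactly \<open>- K b0\<^sup>2 / \<rho>\<close>. The coefficients deviate by \<open>O(\<rho>)\<close>
  from their frozen values, which costs only \<open>O(1 / \<rho> + K)\<close> with a constant independent of \<open>K\<close>.\<close>

lemma weight_algebra:
  fixes \<xi> \<eta> a0 b0 a d c1 c2 K L m \<rho> :: real
  assumes \<rho>: "\<rho> > 0" "\<rho>\<^sup>2 = \<xi>\<^sup>2 + \<eta>\<^sup>2" and K: "K \<ge> 0" and L: "L \<ge> 0"
    and bd: "\<bar>a - a0\<bar> \<le> L * \<rho>" "\<bar>d - (a0\<^sup>2 + b0\<^sup>2)\<bar> \<le> L * \<rho>" "\<bar>c1\<bar> \<le> m" "\<bar>c2\<bar> \<le> m"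
  defines "g \<equiv> 1 / (2 * \<rho>\<^sup>2) - K / (2 * \<rho>)" and "g' \<equiv> - 1 / (2 * \<rho> ^ 4) + K / (4 * \<rho> ^ 3)"
    and "s1 \<equiv> 2 * b0 * \<eta> - 2 * a0 * \<xi>" and "s2 \<equiv> 2 * \<xi>" and "k \<equiv> 2 + 2 * \<bar>a0\<bar> + 2 * \<bar>b0\<bar>"
  shows "\<bar>s1 * g\<bar> \<le> k * (1 / \<rho> + K)" (is ?A) "\<bar>s2 * g\<bar> \<le> k * (1 / \<rho> + K)" (is ?B)
    and "(2 * a0\<^sup>2 + 2 * b0\<^sup>2) * g + s1 * s1 * g' + 2 * a * (- 2 * a0 * g + s1 * s2 * g') + d * (2 * g + s2 * s2 * g')
        + c2 * (s2 * g) + c1 * (s1 * g) \<le> - K * b0\<^sup>2 / \<rho> + (3 * L * (k + k\<^sup>2) + 2 * m * k) * (1 / \<rho> + K)" (is ?C)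
proof -
  have "\<bar>\<xi>\<bar>\<^sup>2 \<le> \<rho>\<^sup>2" "\<bar>\<eta>\<bar>\<^sup>2 \<le> \<rho>\<^sup>2" by (simp_all add: \<rho>(2))
  then have \<xi>: "\<bar>\<xi>\<bar> \<le> \<rho>" and \<eta>: "\<bar>\<eta>\<bar> \<le> \<rho>"
    using \<rho>(1) power2_le_imp_le less_imp_le by blast+
  have k: "k \<ge> 2" by (simp add: k_def)
  define T where "T = 1 / \<rho> + K"
  have T: "T \<ge> 0" using \<rho> K by (simp add: T_def)
  have s1: "\<bar>s1\<bar> \<le> k * \<rho>"
  proof -
    have "\<bar>s1\<bar> \<le> 2 * \<bar>b0\<bar> * \<bar>\<eta>\<bar> + 2 * \<bar>a0\<bar> * \<bar>\<xi>\<bar>"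
      unfolding s1_def by (rule order_trans[OF abs_triangle_ineq4]) (simp add: abs_mult)
    also have "\<dots> \<le> 2 * \<bar>b0\<bar> * \<rho> + 2 * \<bar>a0\<bar> * \<rho>" using \<xi> \<eta> by (intro add_mono mult_left_mono) auto
    also have "\<dots> \<le> k * \<rho>" using \<rho> by (simp add: k_def algebra_simps)
    finally show ?thesis .
  qed
  have s2: "\<bar>s2\<bar> \<le> k * \<rho>"
  proof -
    have "\<bar>s2\<bar> \<le> 2 * \<rho>" using \<xi> by (simp add: s2_def)
    also have "\<dots> \<le> k * \<rho>" using k \<rho> by (intro mult_right_mono) auto
    finally show ?thesis .
  qed
  have g: "\<rho> * \<bar>g\<bar> \<le> T"
  proof -
    have "\<rho> * g = 1 / (2 * \<rho>) - K / 2" using \<rho>(1) by (simp add: g_def field_simps power2_eq_square)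
    moreover have "\<rho> * \<bar>g\<bar> = \<bar>\<rho> * g\<bar>" using \<rho>(1) by (simp add: abs_mult)
    moreover have "1 / (2 * \<rho>) \<le> 1 / \<rho>" "1 / (2 * \<rho>) \<ge> 0" using \<rho>(1) by (auto simp: field_simps)
    ultimately show ?thesis using K unfolding T_def by linarith
  qed
  have g': "\<rho> ^ 3 * \<bar>g'\<bar> \<le> T"
  proof -
    have "\<rho> ^ 3 * g' = - 1 / (2 * \<rho>) + K / 4" using \<rho>(1) by (simp add: g'_def field_simps power4_eq_xxxx power3_eq_cube)
    moreover have "\<rho> ^ 3 * \<bar>g'\<bar> = \<bar>\<rho> ^ 3 * g'\<bar>" using \<rho>(1) by (simp add: abs_mult)
    moreover have "1 / (2 * \<rho>) \<le> 1 / \<rho>" "1 / (2 * \<rho>) \<ge> 0" "- 1 / (2 * \<rho>) = - (1 / (2 * \<rho>))" using \<rho>(1) by (auto simp: field_simps)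
    ultimately show ?thesis using K unfolding T_def by linarith
  qed
  have f: "\<bar>v * g\<bar> \<le> k * T" if "\<bar>v\<bar> \<le> k * \<rho>" for v
  proof -
    have "\<bar>v * g\<bar> \<le> (k * \<rho>) * \<bar>g\<bar>" unfolding abs_mult using that by (rule mult_right_mono) simp
    also have "\<dots> = k * (\<rho> * \<bar>g\<bar>)" by simp
    also have "\<dots> \<le> k * T" using g k by (intro mult_left_mono) auto
    finally show ?thesis .
  qed
  show ?A ?B using f[OF s1] f[OF s2] by (simp_all add: T_def)
  have h: "\<rho> * \<bar>r * g + v * v' * g'\<bar> \<le> (k + k\<^sup>2) * T"
    if "\<bar>v\<bar> \<le> k * \<rho>" "\<bar>v'\<bar> \<le> k * \<rho>" "\<bar>r\<bar> \<le> k" for r v v'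
  proof -
    have "\<bar>v\<bar> * \<bar>v'\<bar> \<le> (k * \<rho>) * (k * \<rho>)" using that k \<rho> by (intro mult_mono) auto
    then have "\<bar>v\<bar> * \<bar>v'\<bar> * (\<rho> * \<bar>g'\<bar>) \<le> ((k * \<rho>) * (k * \<rho>)) * (\<rho> * \<bar>g'\<bar>)"
      using \<rho> by (intro mult_right_mono) auto
    also have "\<dots> = k\<^sup>2 * (\<rho> ^ 3 * \<bar>g'\<bar>)" by (simp add: power2_eq_square power3_eq_cube)
    also have "\<dots> \<le> k\<^sup>2 * T" using g' by (intro mult_left_mono) auto
    finally have 1: "\<bar>v\<bar> * \<bar>v'\<bar> * (\<rho> * \<bar>g'\<bar>) \<le> k\<^sup>2 * T" .
    have 2: "\<bar>r\<bar> * (\<rho> * \<bar>g\<bar>) \<le> k * T" using that g k \<rho> by (intro mult_mono) auto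
    have "\<rho> * \<bar>r * g + v * v' * g'\<bar> \<le> \<rho> * (\<bar>r * g\<bar> + \<bar>v * v' * g'\<bar>)"
      using \<rho> by (intro mult_left_mono abs_triangle_ineq) auto
    also have "\<dots> = \<bar>r\<bar> * (\<rho> * \<bar>g\<bar>) + \<bar>v\<bar> * \<bar>v'\<bar> * (\<rho> * \<bar>g'\<bar>)" by (simp add: abs_mult algebra_simps)
    also have "\<dots> \<le> (k + k\<^sup>2) * T" using 1 2 by (simp add: distrib_right)
    finally show ?thesis .
  qed
  have h12: "\<rho> * \<bar>- 2 * a0 * g + s1 * s2 * g'\<bar> \<le> (k + k\<^sup>2) * T"
    using h[OF s1 s2, of "- 2 * a0"] by (simp add: k_def)
  have h22: "\<rho> * \<bar>2 * g + s2 * s2 * g'\<bar> \<le> (k + k\<^sup>2) * T"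
    using h[OF s2 s2, of 2] by (simp add: k_def)
  have kk: "(k + k\<^sup>2) * T \<ge> 0" using k T by (intro mult_nonneg_nonneg) auto
  have prod: "e * z \<le> L * ((k + k\<^sup>2) * T)" if "\<bar>e\<bar> \<le> L * \<rho>" "\<rho> * \<bar>z\<bar> \<le> (k + k\<^sup>2) * T" for e z
  proof -
    have "e * z \<le> \<bar>e\<bar> * \<bar>z\<bar>" by (metis abs_ge_self abs_mult)
    also have "\<dots> \<le> (L * \<rho>) * \<bar>z\<bar>" using that(1) by (rule mult_right_mono) simp
    also have "\<dots> = L * (\<rho> * \<bar>z\<bar>)" by simp
    also have "\<dots> \<le> L * ((k + k\<^sup>2) * T)" using that(2) L by (rule mult_left_mono)
    finally show ?thesis .
  qed
  have low: "e * z \<le> m * (k * T)" if "\<bar>e\<bar> \<le> m" "\<bar>z\<bar> \<le> k * T" for e z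
  proof -
    have "e * z \<le> \<bar>e\<bar> * \<bar>z\<bar>" by (metis abs_ge_self abs_mult)
    also have "\<dots> \<le> m * (k * T)" using that by (intro mult_mono) auto
    finally show ?thesis .
  qed
  have frozen: "(2 * a0\<^sup>2 + 2 * b0\<^sup>2) * g + s1 * s1 * g' + 2 * a0 * (- 2 * a0 * g + s1 * s2 * g')
      + (a0\<^sup>2 + b0\<^sup>2) * (2 * g + s2 * s2 * g') = - K * b0\<^sup>2 / \<rho>"
  proof -
    have "(2 * a0\<^sup>2 + 2 * b0\<^sup>2) * g + s1 * s1 * g' + 2 * a0 * (- 2 * a0 * g + s1 * s2 * g')
      + (a0\<^sup>2 + b0\<^sup>2) * (2 * g + s2 * s2 * g') = 4 * b0\<^sup>2 * (g + (\<xi>\<^sup>2 + \<eta>\<^sup>2) * g')"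
      unfolding s1_def s2_def by (simp add: algebra_simps power2_eq_square)
    also have "\<dots> = 4 * b0\<^sup>2 * (g + \<rho>\<^sup>2 * g')" by (simp add: \<rho>)
    also have "g + \<rho>\<^sup>2 * g' = - K / (4 * \<rho>)"
      unfolding g_def g'_def using \<rho>(1) by (simp add: field_simps power2_eq_square power3_eq_cube power4_eq_xxxx)
    finally show ?thesis by simp
  qed
  have "(2 * a0\<^sup>2 + 2 * b0\<^sup>2) * g + s1 * s1 * g' + 2 * a * (- 2 * a0 * g + s1 * s2 * g') + d * (2 * g + s2 * s2 * g')
      = - K * b0\<^sup>2 / \<rho> + 2 * ((a - a0) * (- 2 * a0 * g + s1 * s2 * g'))
        + (d - (a0\<^sup>2 + b0\<^sup>2)) * (2 * g + s2 * s2 * g')"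
    unfolding frozen[symmetric] by (simp add: algebra_simps)
  moreover note prod[OF bd(1) h12] prod[OF bd(2) h22] low[OF bd(3) f[OF s1]] low[OF bd(4) f[OF s2]]
  ultimately have "(2 * a0\<^sup>2 + 2 * b0\<^sup>2) * g + s1 * s1 * g' + 2 * a * (- 2 * a0 * g + s1 * s2 * g') + d * (2 * g + s2 * s2 * g')
      + c2 * (s2 * g) + c1 * (s1 * g) \<le> - K * b0\<^sup>2 / \<rho> + 3 * (L * ((k + k\<^sup>2) * T)) + 2 * (m * (k * T))" by linarith
  also have "\<dots> = - K * b0\<^sup>2 / \<rho> + (3 * L * (k + k\<^sup>2) + 2 * m * k) * T" by (simp add: algebra_simps)
  finally show ?C unfolding T_def .
qed

lemma partial_chain:
  assumes "(G has_real_derivative d) (at (F u))" "F differentiable (at u)"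
  shows "partial_deriv i (\<lambda>x. G (F x)) u = d * partial_deriv i F u"
  using partial_deriv_eqI[OF has_derivative_compose[OF differentiable_has_derivative[OF assms(2)]
        assms(1)[unfolded has_field_derivative_def]], of i]
  by (simp add: partial_deriv_def)

text \<open>The term \<open>b (\<partial>\<^sub>2 P \<partial>\<^sub>1 Q - \<partial>\<^sub>1 P \<partial>\<^sub>2 Q)\<close> is a null form: it equals
  \<open>\<partial>\<^sub>2 (b P \<partial>\<^sub>1 Q) - \<partial>\<^sub>1 (b P \<partial>\<^sub>2 Q)\<close> up to derivatives of \<open>b\<close>, because the mixed second derivatives of \<open>Q\<close> cancel.
  The other terms come from the product rule for \<open>\<partial>\<^sub>i (P\<^sup>2 + Q\<^sup>2)\<close>.\<close>

lemma div_identity: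
  assumes W: "open W" and sm: "smooth_on W a" "smooth_on W b" "smooth_on W \<phi>" "smooth_on W P" "smooth_on W Q"
  defines "X \<equiv> \<lambda>u. D1 \<phi> u + a u * D2 \<phi> u"
  defines "V1 \<equiv> \<lambda>u. X u / 2 * (P u * P u + Q u * Q u) - b u * P u * D2 Q u"
    and "V2 \<equiv> \<lambda>u. (a u * X u + b u * b u * D2 \<phi> u) / 2 * (P u * P u + Q u * Q u) + b u * P u * D1 Q u"
  defines "\<Lambda> \<equiv> \<lambda>u. D1 (D1 \<phi>) u + 2 * a u * D1 (D2 \<phi>) u
        + ((a u)\<^sup>2 + (b u)\<^sup>2) * D2 (D2 \<phi>) u
        + (D1 a u + 2 * a u * D2 a u + 2 * b u * D2 b u) * D2 \<phi> u
        + D2 a u * D1 \<phi> u"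
  shows "smooth_on W V1" "smooth_on W V2" "u \<in> W \<Longrightarrow> D1 V1 u + D2 V2 u =
     X u * (P u * (D1 P u + a u * D2 P u) + Q u * (D1 Q u + a u * D2 Q u))
     + b u * (D2 P u * D1 Q u - D1 P u * D2 Q u)
     + (b u)\<^sup>2 * D2 \<phi> u * (P u * D2 P u + Q u * D2 Q u)
     + \<Lambda> u / 2 * ((P u)\<^sup>2 + (Q u)\<^sup>2) + D2 b u * P u * D1 Q u - D1 b u * P u * D2 Q u"
proof -
  note smr = smooth_on_add[OF W] smooth_on_diff[OF W] smooth_on_mult[OF W] smooth_on_const[OF W] sm smooth_on_partial
  have sX: "smooth_on W X" unfolding X_def by (intro smr)
  obtain h :: real where h: "h = 1 / 2" by blast
  have half: "x / 2 = h * x" for x by (simp add: h)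
  show "smooth_on W V1" "smooth_on W V2"
    unfolding V1_def V2_def half by (intro smr sX)+
  show "D1 V1 u + D2 V2 u =
     X u * (P u * (D1 P u + a u * D2 P u) + Q u * (D1 Q u + a u * D2 Q u))
     + b u * (D2 P u * D1 Q u - D1 P u * D2 Q u)
     + (b u)\<^sup>2 * D2 \<phi> u * (P u * D2 P u + Q u * D2 Q u)
     + \<Lambda> u / 2 * ((P u)\<^sup>2 + (Q u)\<^sup>2) + D2 b u * P u * D1 Q u - D1 b u * P u * D2 Q u" if uW: "u \<in> W"
  proof -
    have d: "F differentiable (at u)" if "smooth_on W F" for F :: "real^2 \<Rightarrow> real"
      using that uW by (rule smooth_on_differentiable)
    note ds = d[OF sm(1)] d[OF sm(2)] d[OF sm(3)] d[OF sm(4)] d[OF sm(5)] d[OF smooth_on_partial[OF sm(3)]]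
      d[OF smooth_on_partial[OF sm(5)]] d[OF smooth_on_partial[OF sm(4)]] d[OF sX]
    note rules = partial_add partial_deriv_diff partial_deriv_mult ds differentiable_add differentiable_diff differentiable_mult
    have pX: "partial_deriv i X u = partial_deriv i (D1 \<phi>) u
       + (partial_deriv i a u * D2 \<phi> u + a u * partial_deriv i (D2 \<phi>) u)" for i
      unfolding X_def by (simp add: rules)
    have c: "D2 (D1 \<phi>) u = D1 (D2 \<phi>) u"
      "D2 (D1 Q) u = D1 (D2 Q) u"
      by (rule partial_deriv_commute[OF sm(3) W uW] partial_deriv_commute[OF sm(5) W uW])+
    have k0: "partial_deriv i (\<lambda>x. k) u = 0" for i k by (simp add: partial_deriv_def)
    have p1: "D1 V1 u = D1 X u / 2 * (P u * P u + Q u * Q u)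
        + X u * (P u * D1 P u + Q u * D1 Q u)
        - (D1 b u * P u * D2 Q u + b u * D1 P u * D2 Q u
           + b u * P u * D1 (D2 Q) u)"
      unfolding V1_def half by (simp add: rules k0 algebra_simps) (simp add: h)
    have p2: "D2 V2 u = (D2 a u * X u + a u * D2 X u
           + 2 * b u * D2 b u * D2 \<phi> u + b u * b u * D2 (D2 \<phi>) u) / 2 * (P u * P u + Q u * Q u)
        + (a u * X u + b u * b u * D2 \<phi> u) * (P u * D2 P u + Q u * D2 Q u)
        + (D2 b u * P u * D1 Q u + b u * D2 P u * D1 Q u
           + b u * P u * D2 (D1 Q) u)"
      unfolding V2_def half by (simp add: rules k0 algebra_simps) (simp add: h)
    show ?thesis
      unfolding p1 p2 pX c unfolding \<Lambda>_def X_def by (simp add: h field_simps power2_eq_square)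
  qed
qed

section \<open>The Carleman inequality\<close>

lemma partial_zero_outside:
  assumes "compact K" "\<And>x. x \<notin> K \<Longrightarrow> V x = 0" "x \<notin> K"
  shows "partial_deriv i V x = 0"
proof -
  have "partial_deriv i V x = partial_deriv i (\<lambda>x. 0) x"
    by (rule partial_deriv_cong[where S="-K"]) (use assms in \<open>auto intro: compact_imp_closed\<close>)
  then show ?thesis by (simp add: partial_deriv_def)
qed

lemma smooth_locally_bounded:
  fixes F :: "real^2 \<Rightarrow> real"
  assumes "open U" "x \<in> U" "smooth_on U F"
  shows "eventually (\<lambda>m. \<forall>\<^sub>F y in nhds x. \<bar>F y\<bar> \<le> m) at_top"
proof -
  obtain C r where "r > 0" "\<forall>y\<in>ball x r. norm (F y) \<le> C * norm (y - x) ^ 0"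
    using flat_bound[OF assms(1,2,3), of 0] by auto
  then have "\<forall>\<^sub>F y in nhds x. \<bar>F y\<bar> \<le> C"
    by (auto simp: eventually_nhds_metric dist_commute)
  then have "\<forall>\<^sub>F y in nhds x. \<bar>F y\<bar> \<le> m" if "m \<ge> C" for m
    by eventually_elim (use that in linarith)
  then show ?thesis by (auto simp: eventually_at_top_linorder)
qed

lemma smooth_locally_lipschitz:
  fixes F :: "real^2 \<Rightarrow> real"
  assumes "open U" "x \<in> U" "smooth_on U F"
  shows "eventually (\<lambda>m. \<forall>\<^sub>F y in nhds x. \<bar>F y - F x\<bar> \<le> m * norm (y - x)) at_top"
proof -
  have s: "smooth_on U (\<lambda>y. F y - F x)" by (intro smooth_on_diff smooth_on_const assms)
  have "flat 1 x (\<lambda>y. F y - F x)" by simp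
  then obtain C r where "r > 0" "\<forall>y\<in>ball x r. norm (F y - F x) \<le> C * norm (y - x) ^ 1"
    using flat_bound[OF assms(1,2) s, of 1] by auto
  then have "\<forall>\<^sub>F y in nhds x. \<bar>F y - F x\<bar> \<le> C * norm (y - x)"
    by (auto simp: eventually_nhds_metric dist_commute)
  then have "\<forall>\<^sub>F y in nhds x. \<bar>F y - F x\<bar> \<le> m * norm (y - x)" if "m \<ge> C" for m
    by eventually_elim (use that mult_right_mono[OF that] norm_ge_zero order_trans in blast)
  then show ?thesis by (auto simp: eventually_at_top_linorder)
qed

text \<open>The coefficients \<open>a\<close>, \<open>b\<close> with a base point \<open>x0\<close>. In the sequel \<open>xi\<close> and \<open>eta\<close> are, up to sign, the
  real and imaginary part of the coordinate \<open>\<zeta>\<close> for the values of the coefficients at \<open>x0\<close>, and \<open>rho\<close> is its modulus.\<close>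

locale elliptic_symbol =
  fixes U :: "(real^2) set" and a b :: "real^2 \<Rightarrow> real" and x0 :: "real^2"
  assumes U: "open U" and x0: "x0 \<in> U" and sa: "smooth_on U a" and sb: "smooth_on U b"
    and b_pos: "\<And>u. u \<in> U \<Longrightarrow> b u > 0"
begin

abbreviation "a0 \<equiv> a x0"
abbreviation "b0 \<equiv> b x0"

definition xi where "xi y = (y - x0) $ 2 - a0 * (y - x0) $ 1"
definition eta where "eta y = b0 * (y - x0) $ 1"
definition sq where "sq y = xi y * xi y + eta y * eta y"
definition rho where "rho y = sqrt (sq y)"

lemma b0: "b0 > 0" using b_pos x0 .

lemma xi_eta_partial: "partial_deriv i xi u = (if i = 1 then - a0 else 1)"
  "partial_deriv i eta u = (if i = 1 then b0 else 0)" "xi differentiable (at u)" "eta differentiable (at u)"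
proof -
  have x: "(xi has_derivative (\<lambda>h. h $ 2 - a0 * h $ 1)) (at u)"
    unfolding xi_def[abs_def]
    by (auto intro!: derivative_eq_intros bounded_linear.has_derivative[OF bounded_linear_vec_nth])
  have e: "(eta has_derivative (\<lambda>h. b0 * h $ 1)) (at u)"
    unfolding eta_def[abs_def]
    by (auto intro!: derivative_eq_intros bounded_linear.has_derivative[OF bounded_linear_vec_nth])
  show "partial_deriv i xi u = (if i = 1 then - a0 else 1)"
    "partial_deriv i eta u = (if i = 1 then b0 else 0)"
    using exhaust_2[of i] by (auto simp: partial_deriv_eqI[OF x] partial_deriv_eqI[OF e] axis_def)
  show "xi differentiable (at u)" "eta differentiable (at u)" using x e by (auto intro: differentiableI)
qed

lemma smooth_xi_eta: "open S \<Longrightarrow> smooth_on S xi" "open S \<Longrightarrow> smooth_on S eta"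
  unfolding xi_def[abs_def] eta_def[abs_def] vector_minus_component
  by (intro smooth_on_diff smooth_on_mult smooth_on_const smooth_on_linear bounded_linear_vec_nth | assumption)+

lemma smooth_sq: "open S \<Longrightarrow> smooth_on S sq"
  unfolding sq_def[abs_def] by (intro smooth_on_add smooth_on_mult smooth_xi_eta)

lemma sq_nonneg: "sq y \<ge> 0" by (simp add: sq_def)

lemma rho_sq: "rho y * rho y = sq y" by (simp add: rho_def sq_nonneg)

lemma rho_nonneg: "rho y \<ge> 0" by (simp add: rho_def sq_nonneg)

lemma norm_le_rho: "\<exists>\<kappa>>0. \<forall>y. norm (y - x0) \<le> \<kappa> * rho y"
proof -
  let ?\<beta> = "Complex a0 b0"
  have "cmod (hol ?\<beta> x0 y) = rho y" for y
    by (simp add: hol_def cmod_def rho_def sq_def xi_def eta_def power2_eq_square algebra_simps)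
  then have "norm (y - x0) \<le> (1 + (1 + norm ?\<beta>) / \<bar>Im ?\<beta>\<bar>) * rho y" for y
    using norm_le_hol[of ?\<beta> y x0] b0 by simp
  moreover have "1 + (1 + norm ?\<beta>) / \<bar>Im ?\<beta>\<bar> > 0" by (intro add_pos_nonneg) auto
  ultimately show ?thesis by blast
qed

lemma rho_pos: "y \<noteq> x0 \<Longrightarrow> rho y > 0"
proof -
  assume y: "y \<noteq> x0"
  obtain \<kappa> where "norm (y - x0) \<le> \<kappa> * rho y" using norm_le_rho by blast
  then have "rho y \<noteq> 0" using y by auto
  then show ?thesis using rho_nonneg[of y] by simp
qed

lemma sq_pos: "y \<noteq> x0 \<Longrightarrow> sq y > 0"
  using rho_pos[of y] by (simp add: rho_def)

lemma rho_x0: "rho x0 = 0"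
  by (simp add: rho_def sq_def xi_def eta_def)

lemma sq_partial:
  "D1 sq = (\<lambda>u. 2 * b0 * eta u - 2 * a0 * xi u)" "D2 sq = (\<lambda>u. 2 * xi u)"
  by (simp_all add: fun_eq_iff sq_def[abs_def] partial_add partial_deriv_mult xi_eta_partial differentiable_mult)

lemma sq_partial2:
  "D1 (D1 sq) u = 2 * a0\<^sup>2 + 2 * b0\<^sup>2"
  "D1 (D2 sq) u = - 2 * a0"
  "D2 (D2 sq) u = 2"
proof -
  have d: "(\<lambda>u. c * xi u) differentiable (at u)" "(\<lambda>u. c * eta u) differentiable (at u)" for c
    using xi_eta_partial by (auto intro: differentiable_mult)
  show "D1 (D1 sq) u = 2 * a0\<^sup>2 + 2 * b0\<^sup>2"
    "D1 (D2 sq) u = - 2 * a0"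
    "D2 (D2 sq) u = 2"
    unfolding sq_partial
    by (simp_all add: partial_deriv_diff d partial_deriv_cmult xi_eta_partial power2_eq_square)
qed

text \<open>The Carleman weight \<open>ln \<rho> - K \<rho>\<close>, written as a function of \<open>sq = \<rho>\<^sup>2\<close>, which is a polynomial;
  \<open>gg\<close> and \<open>gg'\<close> are the first and second derivative of this function of \<open>sq\<close>.\<close>

definition psi :: "real \<Rightarrow> real^2 \<Rightarrow> real" where "psi K y = ln (sq y) / 2 - K * sqrt (sq y)"
definition gg where "gg K y = 1 / (2 * (rho y)\<^sup>2) - K / (2 * rho y)"
definition gg' where "gg' K y = - 1 / (2 * rho y ^ 4) + K / (4 * rho y ^ 3)"

lemma open_punctured: "open (- {x0})" by (rule open_Compl[OF closed_singleton])

lemma smooth_psi: "smooth_on (- {x0}) (psi K)"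
proof -
  have s: "smooth_on (- {x0}) sq" by (rule smooth_sq[OF open_punctured])
  have l: "smooth_on (- {x0}) (\<lambda>y. ln (sq y))"
  proof (rule smooth_on_compose[where W="{0<..}" and F=ln and T=sq])
    show "smooth_on {0<..} (ln :: real \<Rightarrow> real)" by (simp add: smooth_on_def Ck_on_ln)
  qed (use s sq_pos open_punctured in auto)
  have "smooth_on (- {x0}) (\<lambda>y. (1 / 2) * ln (sq y) - K * sqrt (sq y))"
    by (intro smooth_on_diff smooth_on_mult smooth_on_const smooth_on_sqrt open_punctured s l) (use sq_pos in auto)
  then show ?thesis by (simp add: psi_def[abs_def])
qed

lemma psi_partial:
  assumes "u \<noteq> x0"
  shows "partial_deriv i (psi K) u = partial_deriv i sq u * gg K u"
proof -
  have d: "((\<lambda>t. ln t / 2 - K * sqrt t) has_real_derivative gg K u) (at (sq u))"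
    using sq_pos[OF assms] rho_sq[of u] rho_pos[OF assms]
    by (auto intro!: derivative_eq_intros simp: gg_def rho_def field_simps power2_eq_square)
  have s: "sq differentiable (at u)" using smooth_sq[OF open_UNIV] by (rule smooth_on_differentiable) simp
  show ?thesis using partial_chain[OF d s, of i] by (simp add: psi_def[abs_def] mult.commute)
qed

lemma psi_partial2:
  assumes "u \<noteq> x0"
  shows "partial_deriv i (partial_deriv j (psi K)) u =
    partial_deriv i (partial_deriv j sq) u * gg K u + partial_deriv i sq u * partial_deriv j sq u * gg' K u"
proof -
  have d: "((\<lambda>t. 1 / (2 * t) - K / (2 * sqrt t)) has_real_derivative gg' K u) (at (sq u))"
  proof -
    have "((\<lambda>t. 1 / (2 * t) - K / (2 * sqrt t)) has_real_derivative
       - 1 / (2 * (sq u)\<^sup>2) + K * (inverse (sqrt (sq u)) / 2) / (2 * (sqrt (sq u))\<^sup>2)) (at (sq u))"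
      using sq_pos[OF assms]
      by (auto intro!: derivative_eq_intros simp: field_simps power2_eq_square)
    moreover have "sqrt (sq u) = rho u" "sq u = (rho u)\<^sup>2" using rho_sq[of u] by (simp_all add: rho_def power2_eq_square)
    ultimately show ?thesis
      using rho_pos[OF assms] unfolding gg'_def
      by (auto elim!: DERIV_cong simp: field_simps power2_eq_square power3_eq_cube power4_eq_xxxx)
  qed
  have s: "smooth_on UNIV sq" by (rule smooth_sq[OF open_UNIV])
  have ds: "sq differentiable (at u)" "partial_deriv j sq differentiable (at u)"
    using s smooth_on_partial[OF s] by (auto intro: smooth_on_differentiable)
  have g: "gg K = (\<lambda>u. 1 / (2 * sq u) - K / (2 * sqrt (sq u)))"
    by (simp add: fun_eq_iff gg_def rho_sq[symmetric] power2_eq_square) (simp add: rho_def sq_nonneg)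
  have dg: "gg K differentiable (at u)" unfolding g
    using has_derivative_compose[OF differentiable_has_derivative[OF ds(1)] d[unfolded has_field_derivative_def]]
    by (rule differentiableI)
  have "partial_deriv i (partial_deriv j (psi K)) u = partial_deriv i (\<lambda>u. partial_deriv j sq u * gg K u) u"
    by (rule partial_deriv_cong[where S="-{x0}"]) (use assms psi_partial in auto)
  also have "\<dots> = partial_deriv i (partial_deriv j sq) u * gg K u + partial_deriv j sq u * partial_deriv i (gg K) u"
    by (rule partial_deriv_mult[OF ds(2) dg])
  also have "partial_deriv i (gg K) u = gg' K u * partial_deriv i sq u"
    unfolding g by (rule partial_chain[OF d ds(1)])
  finally show ?thesis by (simp add: mult_ac)
qed

text \<open>The operator \<open>\<partial>\<^sub>1 X + \<partial>\<^sub>2 (a X + b\<^sup>2 \<phi>\<^sub>2)\<close> for \<open>X = \<phi>\<^sub>1 + a \<phi>\<^sub>2\<close>, as it arises in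
  \<open>div_identity\<close>.\<close>

definition Lam where
  "Lam \<phi> u = D1 (D1 \<phi>) u + 2 * a u * D1 (D2 \<phi>) u
        + ((a u)\<^sup>2 + (b u)\<^sup>2) * D2 (D2 \<phi>) u
        + (D1 a u + 2 * a u * D2 a u + 2 * b u * D2 b u) * D2 \<phi> u
        + D2 a u * D1 \<phi> u"

text \<open>By \<open>weight_algebra\<close> everything except \<open>- K b0\<^sup>2 / \<rho>\<close> is bounded by \<open>C (1 / \<rho> + K)\<close> with \<open>C\<close> independent of
  \<open>K\<close>. So first \<open>K\<close> is taken large enough to beat \<open>C / \<rho>\<close>, and then the radius small enough to
  beat \<open>C K\<close>. The condition \<open>K R \<le> 1\<close> makes \<open>psi K\<close> increasing in \<open>\<rho>\<close>.\<close>

lemma weight_exists: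
  obtains R K M m where "R > 0" "K \<ge> 0" "K * R \<le> 1" "\<And>y. rho y < R \<Longrightarrow> y \<in> U"
    "\<And>y. rho y < R \<Longrightarrow> \<bar>a y\<bar> \<le> m \<and> \<bar>b y\<bar> \<le> m \<and> \<bar>D2 b y\<bar> \<le> m
        \<and> \<bar>(a y * D2 b y + D1 b y) / b y\<bar> \<le> m"
    "\<And>y n. \<lbrakk>0 < rho y; rho y < R; n \<ge> 0\<rbrakk> \<Longrightarrow> n - M \<le> - (n * Lam (psi K) y)
        - (4 * m\<^sup>2 + 2 * m) * (1 + \<bar>n * D1 (psi K) y\<bar> + \<bar>n * D2 (psi K) y\<bar>)"
proof -
  let ?c = "\<lambda>y. (a y * D2 b y + D1 b y) / b y"
  let ?e = "\<lambda>u. D1 a u + 2 * a u * D2 a u + 2 * b u * D2 b u"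
  let ?d = "\<lambda>u. a u * a u + b u * b u"
  have bnz: "b u \<noteq> 0" if "u \<in> U" for u using b_pos[OF that] by simp
  note sm = smooth_on_add[OF U] smooth_on_mult[OF U] smooth_on_const[OF U] sa sb smooth_on_partial
      smooth_on_divide[OF U _ _ bnz]
  have sc: "smooth_on U ?c" and se: "smooth_on U ?e" and sd: "smooth_on U ?d"
    by (intro sm | assumption)+
  note lb = smooth_locally_bounded[OF U x0] and ll = smooth_locally_lipschitz[OF U x0]
  obtain \<kappa> where \<kappa>: "\<kappa> > 0" "\<And>y. norm (y - x0) \<le> \<kappa> * rho y" using norm_le_rho by blast
  have "eventually (\<lambda>m. \<forall>\<^sub>F y in nhds x0. y \<in> U \<and> \<bar>a y\<bar> \<le> m \<and> \<bar>b y\<bar> \<le> m \<and> \<bar>D2 b y\<bar> \<le> m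
      \<and> \<bar>?c y\<bar> \<le> m \<and> \<bar>?e y\<bar> \<le> m \<and> \<bar>D2 a y\<bar> \<le> m
      \<and> \<bar>a y - a x0\<bar> \<le> m * norm (y - x0) \<and> \<bar>?d y - ?d x0\<bar> \<le> m * norm (y - x0)) at_top"
    using lb[OF sa] lb[OF sb] lb[OF smooth_on_partial[OF sb, of 2]] lb[OF sc] lb[OF se]
      lb[OF smooth_on_partial[OF sa, of 2]] ll[OF sa] ll[OF sd]
  proof eventually_elim
    case (elim m)
    have "\<forall>\<^sub>F y in nhds x0. y \<in> U" using U x0 by (rule eventually_nhds_in_open)
    then show ?case using elim by eventually_elim blast
  qed
  then obtain m where "\<forall>\<^sub>F y in nhds x0. y \<in> U \<and> \<bar>a y\<bar> \<le> m \<and> \<bar>b y\<bar> \<le> m \<and> \<bar>D2 b y\<bar> \<le> m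
      \<and> \<bar>?c y\<bar> \<le> m \<and> \<bar>?e y\<bar> \<le> m \<and> \<bar>D2 a y\<bar> \<le> m
      \<and> \<bar>a y - a x0\<bar> \<le> m * norm (y - x0) \<and> \<bar>?d y - ?d x0\<bar> \<le> m * norm (y - x0)"
    using eventually_happens'[OF trivial_limit_at_top_linorder] by blast
  then obtain r where r: "r > 0" and "\<forall>y. dist y x0 < r \<longrightarrow> y \<in> U \<and> \<bar>a y\<bar> \<le> m \<and> \<bar>b y\<bar> \<le> m \<and> \<bar>D2 b y\<bar> \<le> m
      \<and> \<bar>?c y\<bar> \<le> m \<and> \<bar>?e y\<bar> \<le> m \<and> \<bar>D2 a y\<bar> \<le> m
      \<and> \<bar>a y - a x0\<bar> \<le> m * norm (y - x0) \<and> \<bar>?d y - ?d x0\<bar> \<le> m * norm (y - x0)"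
    unfolding eventually_nhds_metric by blast
  note all = this(2)[rule_format]
  have m: "m \<ge> 0" using all[of x0] r by auto
  define L where "L = m * \<kappa>"
  define k where "k = 2 + 2 * \<bar>a0\<bar> + 2 * \<bar>b0\<bar>"
  define M where "M = 4 * m\<^sup>2 + 2 * m"
  define C where "C = (3 * L * (k + k\<^sup>2) + 2 * m * k) + 2 * M * k"
  have nn: "L \<ge> 0" "k \<ge> 0" "M \<ge> 0" using m \<kappa> by (simp_all add: L_def k_def M_def)
  have C: "C \<ge> 0" unfolding C_def using m nn by (intro add_nonneg_nonneg mult_nonneg_nonneg) auto
  (* chosen so that - K * b0^2 + C = - 1 *)
  define K where "K = (C + 1) / b0\<^sup>2"
  have K: "K \<ge> 0" using C by (simp add: K_def)
  define R where "R = min (r / \<kappa>) (1 / (1 + C * K + K))"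
  have den: "1 + C * K + K > 0" using C K by (intro add_pos_nonneg mult_nonneg_nonneg) auto
  have R: "R > 0" using r \<kappa> den by (simp add: R_def)
  have Rd: "R * (1 + C * K + K) \<le> 1" using den pos_le_divide_eq[OF den, of R 1] by (simp add: R_def)
  have near: "dist y x0 < r" if "rho y < R" for y
  proof -
    have "norm (y - x0) \<le> \<kappa> * rho y" by (rule \<kappa>)
    also have "\<dots> < \<kappa> * (r / \<kappa>)" using that \<kappa> by (intro mult_strict_left_mono) (auto simp: R_def)
    finally show ?thesis using \<kappa> by (simp add: dist_norm)
  qed
  show thesis
  proof (rule that[of R K m M])
    show "R > 0" "K \<ge> 0" by (fact R K)+
    have "K * R \<le> R * (1 + C * K + K)" using R C K by (simp add: algebra_simps)
    then show "K * R \<le> 1" using Rd by linarith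
    show "y \<in> U" if "rho y < R" for y using all[OF near[OF that]] by blast
    show "\<bar>a y\<bar> \<le> m \<and> \<bar>b y\<bar> \<le> m \<and> \<bar>D2 b y\<bar> \<le> m \<and> \<bar>?c y\<bar> \<le> m" if "rho y < R" for y
      using all[OF near[OF that]] by blast
    fix y and n :: real assume \<rho>: "0 < rho y" "rho y < R" and n: "n \<ge> 0"
    have yx: "y \<noteq> x0" using \<rho>(1) rho_x0 by auto
    note A = all[OF near[OF \<rho>(2)]]
    have lip: "m * norm (y - x0) \<le> L * rho y"
      unfolding L_def mult.assoc using m \<kappa>(2) by (rule mult_left_mono[rotated])
    have rs: "(rho y)\<^sup>2 = (xi y)\<^sup>2 + (eta y)\<^sup>2" using rho_sq[of y] by (simp add: sq_def power2_eq_square)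
    have bd: "\<bar>a y - a0\<bar> \<le> L * rho y" "\<bar>((a y)\<^sup>2 + (b y)\<^sup>2) - (a0\<^sup>2 + b0\<^sup>2)\<bar> \<le> L * rho y"
      "\<bar>D2 a y\<bar> \<le> m" "\<bar>?e y\<bar> \<le> m"
      using A lip by (auto simp: power2_eq_square)
    note WA = weight_algebra[OF \<rho>(1) rs K nn(1) bd, folded gg_def gg'_def k_def]
    define T where "T = 1 / rho y + K"
    have T: "T \<ge> 0" using \<rho> K by (simp add: T_def)
    have p1: "\<bar>D1 (psi K) y\<bar> \<le> k * T" and p2: "\<bar>D2 (psi K) y\<bar> \<le> k * T"
      using WA(1,2) unfolding psi_partial[OF yx] sq_partial T_def by (simp_all only:)
    have lam: "Lam (psi K) y \<le> - K * b0\<^sup>2 / rho y + (3 * L * (k + k\<^sup>2) + 2 * m * k) * T"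
      using WA(3) unfolding Lam_def psi_partial2[OF yx] psi_partial[OF yx] sq_partial2 unfolding sq_partial T_def
      by (simp only: mult.commute mult.left_commute mult.assoc)
    have "Lam (psi K) y + M * (\<bar>D1 (psi K) y\<bar> + \<bar>D2 (psi K) y\<bar>)
        \<le> (- K * b0\<^sup>2 / rho y + (3 * L * (k + k\<^sup>2) + 2 * m * k) * T) + M * (k * T + k * T)"
      using lam p1 p2 nn by (intro add_mono mult_left_mono) auto
    also have "\<dots> = - K * b0\<^sup>2 / rho y + C * T" by (simp add: C_def algebra_simps)
    also have "\<dots> = C * K - 1 / rho y"
    proof -
      have kb: "- K * b0\<^sup>2 = - C - 1" using b0 by (simp add: K_def)
      show ?thesis unfolding kb T_def by (simp add: diff_divide_distrib distrib_left)
    qed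
    also have "\<dots> \<le> - 1"
    proof -
      have "(1 + C * K) * rho y \<le> (1 + C * K) * R" using \<rho> C K by (intro mult_left_mono) auto
      also have "\<dots> \<le> R * (1 + C * K + K)" using R K by (simp add: algebra_simps)
      finally have "(1 + C * K) * rho y \<le> 1" using Rd by linarith
      then have "1 + C * K \<le> 1 / rho y" using \<rho> by (simp add: field_simps)
      then show ?thesis by linarith
    qed
    finally have "n * (Lam (psi K) y + M * (\<bar>D1 (psi K) y\<bar> + \<bar>D2 (psi K) y\<bar>)) \<le> n * (- 1)"
      using n by (rule mult_left_mono)
    then show "n - M \<le> - (n * Lam (psi K) y)
        - (4 * m\<^sup>2 + 2 * m) * (1 + \<bar>n * D1 (psi K) y\<bar> + \<bar>n * D2 (psi K) y\<bar>)"
      unfolding M_def[symmetric] abs_mult using n by (simp add: algebra_simps)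
  qed
qed

definition carleman_estimate :: "real \<Rightarrow> real \<Rightarrow> real \<Rightarrow> bool" where
  "carleman_estimate R K M \<longleftrightarrow> (\<forall>n P Q C. n \<ge> 0 \<and> compact C \<and> C \<subseteq> {y. 0 < rho y \<and> rho y < R}
      \<and> smooth_on (U - {x0}) P \<and> smooth_on (U - {x0}) Q \<and> (\<forall>x. x \<notin> C \<longrightarrow> P x = 0 \<and> Q x = 0) \<longrightarrow>
      (n - M) * (\<integral>x. exp (- 2 * n * psi K x) * ((P x)\<^sup>2 + (Q x)\<^sup>2) \<partial>lborel)
       \<le> (\<integral>x. exp (- 2 * n * psi K x) * ((cr_re a b P Q x)\<^sup>2 + (cr_im a b P Q x)\<^sup>2) \<partial>lborel))"

text \<open>Integrate the pointwise inequality for \<open>e\<^sup>-\<^sup>n\<^sup>\<psi> P\<close> and \<open>e\<^sup>-\<^sup>n\<^sup>\<psi> Q\<close>; the divergence disappears.\<close>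

lemma carleman_inequality:
  "\<exists>R>0. \<exists>K\<ge>0. \<exists>M. K * R \<le> 1 \<and> (\<forall>y. rho y < R \<longrightarrow> y \<in> U) \<and> carleman_estimate R K M"
proof -
  obtain R K M m where RK: "R > 0" "K \<ge> 0" "K * R \<le> 1" "\<And>y. rho y < R \<Longrightarrow> y \<in> U"
    and bd: "\<And>y. rho y < R \<Longrightarrow> \<bar>a y\<bar> \<le> m \<and> \<bar>b y\<bar> \<le> m \<and> \<bar>D2 b y\<bar> \<le> m
        \<and> \<bar>(a y * D2 b y + D1 b y) / b y\<bar> \<le> m"
    and wt: "\<And>y n. \<lbrakk>0 < rho y; rho y < R; n \<ge> 0\<rbrakk> \<Longrightarrow> n - M \<le> - (n * Lam (psi K) y)
        - (4 * m\<^sup>2 + 2 * m) * (1 + \<bar>n * D1 (psi K) y\<bar> + \<bar>n * D2 (psi K) y\<bar>)"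
    by (rule weight_exists) (rule that; assumption)
  have "carleman_estimate R K M"
    unfolding carleman_estimate_def
  proof (intro allI impI, elim conjE)
    fix n :: real and P Q :: "real^2 \<Rightarrow> real" and C :: "(real^2) set"
    assume n: "n \<ge> 0" and C: "compact C" "C \<subseteq> {y. 0 < rho y \<and> rho y < R}"
      and PQ: "smooth_on (U - {x0}) P" "smooth_on (U - {x0}) Q"
      and "\<forall>x. x \<notin> C \<longrightarrow> P x = 0 \<and> Q x = 0"
    then have P0: "\<And>x. x \<notin> C \<Longrightarrow> P x = 0" and Q0: "\<And>x. x \<notin> C \<Longrightarrow> Q x = 0" by auto
    define W where "W = U - {x0}"
    have W: "open W" unfolding W_def using U by (intro open_Diff closed_singleton)
    have CW: "C \<subseteq> W" using C(2) RK(4) rho_x0 by (auto simp: W_def)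
    define \<phi> where "\<phi> y = n * psi K y" for y
    define E where "E y = exp (- \<phi> y)" for y
    have E2: "E y * E y = exp (- 2 * n * psi K y)" for y
      unfolding E_def \<phi>_def exp_add[symmetric] by simp
    have sps: "smooth_on W (psi K)" by (rule smooth_on_subset[OF smooth_psi]) (auto simp: W_def)
    have s\<phi>: "smooth_on W \<phi>" unfolding \<phi>_def[abs_def] by (intro smooth_on_mult smooth_on_const W sps)
    have sE: "smooth_on W E"
    proof -
      have "smooth_on W (\<lambda>y. exp (- \<phi> y))"
        by (rule smooth_on_compose[where W=UNIV and F=exp and T="\<lambda>y. - \<phi> y"])
           (simp_all add: smooth_on_def[of UNIV] Ck_on_exp W
             smooth_on_bounded_linear[OF bounded_linear_minus[OF bounded_linear_ident] W s\<phi>])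
      then show ?thesis by (simp add: E_def[abs_def])
    qed
    have sab: "smooth_on W a" "smooth_on W b" using sa sb by (auto simp: W_def intro: smooth_on_subset)
    note PQ = PQ[folded W_def]
    define P' Q' where "P' y = E y * P y" and "Q' y = E y * Q y" for y
    have sP': "smooth_on W P'" and sQ': "smooth_on W Q'"
      unfolding P'_def[abs_def] Q'_def[abs_def] by (intro smooth_on_mult W sE PQ)+
    define X where "X u = D1 \<phi> u + a u * D2 \<phi> u" for u
    define V1 where "V1 u = X u / 2 * (P' u * P' u + Q' u * Q' u) - b u * P' u * D2 Q' u" for u
    define V2 where "V2 u = (a u * X u + b u * b u * D2 \<phi> u) / 2 * (P' u * P' u + Q' u * Q' u)
        + b u * P' u * D1 Q' u" for u
    note DI = div_identity[OF W sab s\<phi> sP' sQ', folded X_def Lam_def, folded V1_def V2_def]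
    have V0: "V1 x = 0" "V2 x = 0" if "x \<notin> C" for x
      using that P0 Q0 by (simp_all add: V1_def V2_def P'_def Q'_def)
    have sV: "smooth_on W V1" "smooth_on W V2"
      using DI(1,2) by (simp_all add: V1_def[abs_def] V2_def[abs_def])
    let ?N = "\<lambda>x. (P x)\<^sup>2 + (Q x)\<^sup>2"
    let ?D = "\<lambda>x. (cr_re a b P Q x)\<^sup>2
            + (cr_im a b P Q x)\<^sup>2"
    have key: "2 * (D1 V1 x + D2 V2 x) + (n - M) * (exp (- 2 * n * psi K x) * ?N x)
        \<le> exp (- 2 * n * psi K x) * ?D x" for x
    proof (cases "x \<in> C")
      case False
      then have "partial_deriv i V1 x = 0" "partial_deriv i V2 x = 0" for i
        using partial_zero_outside[OF C(1) V0(1)] partial_zero_outside[OF C(1) V0(2)] by auto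
      then show ?thesis using P0 Q0 False by simp
    next
      case True
      then have xW: "x \<in> W" and \<rho>: "0 < rho x" "rho x < R" using CW C(2) by auto
      have xU: "x \<in> U" using xW by (simp add: W_def)
      note d = smooth_on_differentiable[OF _ xW]
      have dexp: "((\<lambda>t. exp (- t)) has_real_derivative - exp (- \<phi> x)) (at (\<phi> x))"
        by (auto intro!: derivative_eq_intros)
      have pE: "partial_deriv i E x = - partial_deriv i \<phi> x * E x" for i
        using partial_chain[OF dexp d[OF s\<phi>], of i] by (simp add: E_def[abs_def] mult.commute)
      have pP: "partial_deriv i P' x = E x * (partial_deriv i P x - partial_deriv i \<phi> x * P x)"
        and pQ: "partial_deriv i Q' x = E x * (partial_deriv i Q x - partial_deriv i \<phi> x * Q x)" for i
        unfolding P'_def[abs_def] Q'_def[abs_def]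
        by (simp_all add: partial_deriv_mult d[OF sE] d[OF PQ(1)] d[OF PQ(2)] pE algebra_simps)
      have p\<phi>: "partial_deriv i \<phi> x = n * partial_deriv i (psi K) x" for i
        unfolding \<phi>_def[abs_def] by (rule partial_deriv_cmult[OF d[OF sps]])
      have pp\<phi>: "partial_deriv i (partial_deriv j \<phi>) x = n * partial_deriv i (partial_deriv j (psi K)) x" for i j
      proof -
        have "partial_deriv i (partial_deriv j \<phi>) x = partial_deriv i (\<lambda>y. n * partial_deriv j (psi K) y) x"
          by (rule partial_deriv_cong[OF W xW])
             (simp add: \<phi>_def[abs_def] partial_deriv_cmult smooth_on_differentiable[OF sps])
        then show ?thesis using partial_deriv_cmult[OF d[OF smooth_on_partial[OF sps]]] by simp
      qed
      have lam: "Lam \<phi> x = n * Lam (psi K) x"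
        unfolding Lam_def p\<phi> pp\<phi> by (simp add: algebra_simps)
      define Y where "Y = exp (- 2 * n * psi K x)"
      have bdx: "\<bar>a x\<bar> \<le> m" "\<bar>b x\<bar> \<le> m" "\<bar>D2 b x\<bar> \<le> m"
        "\<bar>(a x * D2 b x + D1 b x) / b x\<bar> \<le> m"
        using bd[OF \<rho>(2)] by auto
      note CA = carleman_algebra[OF b_pos[OF xU] bdx, of "D1 \<phi> x" "D2 \<phi> x" "P' x"
          "D1 P' x" "D2 P' x" "Q' x" "D1 Q' x" "D2 Q' x" "Lam \<phi> x",
          folded X_def]
      have N: "(P' x)\<^sup>2 + (Q' x)\<^sup>2 = Y * ?N x"
        unfolding Y_def E2[symmetric] P'_def Q'_def by (simp add: power2_eq_square algebra_simps)
      have D: "(cr_re a b P' Q' x + X x * P' x - b x * D2 \<phi> x * Q' x)\<^sup>2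
         + (cr_im a b P' Q' x + X x * Q' x + b x * D2 \<phi> x * P' x)\<^sup>2
         = Y * ?D x"
      proof -
        have 1: "cr_re a b P' Q' x + X x * P' x - b x * D2 \<phi> x * Q' x
           = E x * (cr_re a b P Q x)"
          unfolding pP pQ X_def P'_def Q'_def by (simp add: algebra_simps)
        have 2: "cr_im a b P' Q' x + X x * Q' x + b x * D2 \<phi> x * P' x
           = E x * (cr_im a b P Q x)"
          unfolding pP pQ X_def P'_def Q'_def by (simp add: algebra_simps)
        have "(e * r)\<^sup>2 + (e * s)\<^sup>2 = e * e * (r\<^sup>2 + s\<^sup>2)" for e r s :: real
          by (simp add: power2_eq_square algebra_simps)
        then show ?thesis unfolding 1 2 Y_def E2[symmetric] .
      qed
      have "n - M \<le> - Lam \<phi> x - (4 * m\<^sup>2 + 2 * m) * (1 + \<bar>D1 \<phi> x\<bar> + \<bar>D2 \<phi> x\<bar>)"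
        using wt[OF \<rho> n] unfolding lam p\<phi> .
      then have "(n - M) * ((P' x)\<^sup>2 + (Q' x)\<^sup>2) \<le> (- Lam \<phi> x - (4 * m\<^sup>2 + 2 * m) * (1 + \<bar>D1 \<phi> x\<bar> + \<bar>D2 \<phi> x\<bar>))
          * ((P' x)\<^sup>2 + (Q' x)\<^sup>2)"
        by (rule mult_right_mono) simp
      then have "2 * (D1 V1 x + D2 V2 x) + (n - M) * ((P' x)\<^sup>2 + (Q' x)\<^sup>2)
         \<le> (cr_re a b P' Q' x + X x * P' x - b x * D2 \<phi> x * Q' x)\<^sup>2
         + (cr_im a b P' Q' x + X x * Q' x + b x * D2 \<phi> x * P' x)\<^sup>2"
        using CA DI(3)[OF xW] by (simp add: V1_def[abs_def] V2_def[abs_def])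
      then show ?thesis unfolding N D Y_def .
    qed
    have dV: "integrable lborel (D1 V1)" "integrable lborel (D2 V2)"
      "(\<integral>x. D1 V1 x \<partial>lborel) = 0" "(\<integral>x. D2 V2 x \<partial>lborel) = 0"
      using integral_partial_deriv_zero[OF W sV(1) C(1) CW V0(1)] integral_partial_deriv_zero[OF W sV(2) C(1) CW V0(2)]
      by auto
    have cont: "continuous_on C F" if "smooth_on W F" for F :: "real^2 \<Rightarrow> real"
      using smooth_on_continuous[OF that] CW by (rule continuous_on_subset)
    have iN: "integrable lborel (\<lambda>x. exp (- 2 * n * psi K x) * ?N x)"
    proof (rule integrable_compact_support[OF C(1)])
      show "continuous_on C (\<lambda>x. exp (- 2 * n * psi K x) * ?N x)"
        by (intro continuous_intros cont sps PQ)
    qed (simp add: P0 Q0)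
    have iD: "integrable lborel (\<lambda>x. exp (- 2 * n * psi K x) * ?D x)"
    proof (rule integrable_compact_support[OF C(1)])
      show "continuous_on C (\<lambda>x. exp (- 2 * n * psi K x) * ?D x)"
        by (intro continuous_intros cont sps smooth_on_partial PQ sab)
    qed (simp add: partial_zero_outside[OF C(1) P0] partial_zero_outside[OF C(1) Q0])
    have "(\<integral>x. 2 * (D1 V1 x + D2 V2 x) + (n - M) * (exp (- 2 * n * psi K x) * ?N x) \<partial>lborel)
       \<le> (\<integral>x. exp (- 2 * n * psi K x) * ?D x \<partial>lborel)"
      using key dV iN iD by (intro integral_mono) auto
    also have "(\<integral>x. 2 * (D1 V1 x + D2 V2 x) + (n - M) * (exp (- 2 * n * psi K x) * ?N x) \<partial>lborel)
       = (n - M) * (\<integral>x. exp (- 2 * n * psi K x) * ?N x \<partial>lborel)"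
      using dV iN by (simp add: Bochner_Integration.integral_add)
    finally show "(n - M) * (\<integral>x. exp (- 2 * n * psi K x) * ?N x \<partial>lborel)
       \<le> (\<integral>x. exp (- 2 * n * psi K x) * ?D x \<partial>lborel)" .
  qed
  then show ?thesis using RK by blast
qed

end

section \<open>Carleman inequality for solutions\<close>

lemma (in elliptic_symbol) nhds_imp_rho:
  assumes "\<forall>\<^sub>F y in nhds x0. P y"
  obtains r where "r > 0" "\<And>y. rho y < r \<Longrightarrow> P y"
proof -
  obtain d where d: "d > 0" "\<And>y. dist y x0 < d \<Longrightarrow> P y" using assms unfolding eventually_nhds_metric by blast
  obtain \<kappa> where \<kappa>: "\<kappa> > 0" "\<And>y. norm (y - x0) \<le> \<kappa> * rho y" using norm_le_rho by blast
  show thesis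
  proof (rule that[of "d / \<kappa>"])
    show "P y" if "rho y < d / \<kappa>" for y
    proof (rule d(2))
      have "norm (y - x0) \<le> \<kappa> * rho y" by (rule \<kappa>)
      also have "\<dots> < d" using that \<kappa>(1) by (simp add: field_simps)
      finally show "dist y x0 < d" by (simp add: dist_norm)
    qed
  qed (use d \<kappa> in auto)
qed

context elliptic_equation
begin

text \<open>Both \<open>f\<close> and \<open>w\<close> enter, since the equation for \<open>w\<close> contains \<open>f\<close>.\<close>

definition energy where "energy y = (f y)\<^sup>2 + (p y)\<^sup>2 + (q y)\<^sup>2"

lemma energy_nonneg: "energy y \<ge> 0" by (simp add: energy_def)

lemma smooth_energy: "smooth_on U energy"
  unfolding energy_def[abs_def] power2_eq_square
  by (intro smooth_on_add smooth_on_mult U smooth smooth_pq)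

lemma dbar_le_energy:
  assumes x: "x \<in> U"
  shows "\<exists>C\<ge>0. \<forall>\<^sub>F y in nhds x. y \<in> U \<and>
    (cr_re a b p q y)\<^sup>2
      + (cr_im a b p q y)\<^sup>2 \<le> C * energy y"
proof -
  let ?c2 = "\<lambda>u. (k1 u * a u - m2 u) / b u" and ?c4 = "\<lambda>u. m3 u / b u"
  have bnz: "b u \<noteq> 0" if "u \<in> U" for u using b_pos[OF that] by simp
  have s: "smooth_on U ?c2" "smooth_on U ?c4"
    by (intro smooth_on_diff smooth_on_mult smooth_on_divide U smooth smooth_m bnz | assumption)+
  note lb = smooth_locally_bounded[OF U x]
  have "eventually (\<lambda>m. \<forall>\<^sub>F y in nhds x. y \<in> U \<and> \<bar>k1 y\<bar> \<le> m \<and> \<bar>?c2 y\<bar> \<le> m \<and> \<bar>k3 y\<bar> \<le> m \<and> \<bar>?c4 y\<bar> \<le> m) at_top"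
    using lb[OF smooth(3)] lb[OF s(1)] lb[OF smooth(5)] lb[OF s(2)]
  proof eventually_elim
    case (elim m)
    have "\<forall>\<^sub>F y in nhds x. y \<in> U" using U x by (rule eventually_nhds_in_open)
    then show ?case using elim by eventually_elim blast
  qed
  then obtain m where m: "\<forall>\<^sub>F y in nhds x. y \<in> U \<and> \<bar>k1 y\<bar> \<le> m \<and> \<bar>?c2 y\<bar> \<le> m \<and> \<bar>k3 y\<bar> \<le> m \<and> \<bar>?c4 y\<bar> \<le> m"
    using eventually_happens'[OF trivial_limit_at_top_linorder] by blast
  show ?thesis
  proof (intro exI[of _ "4 * m\<^sup>2"] conjI)
    show "\<forall>\<^sub>F y in nhds x. y \<in> U \<and> (cr_re a b p q y)\<^sup>2
      + (cr_im a b p q y)\<^sup>2 \<le> 4 * m\<^sup>2 * energy y"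
      using m
    proof eventually_elim
      case (elim y)
      then have y: "y \<in> U" by blast
      have f2: "f2 y = - q y / b y" and f1: "f1 y = p y + a y * (q y / b y)"
        using bnz[OF y] by (simp_all add: q_def p_def)
      have e1: "k1 y * f1 y + m2 y * f2 y + k3 y * f y = k1 y * p y + ?c2 y * q y + k3 y * f y"
        unfolding f1 f2 using bnz[OF y] by (simp add: field_simps)
      have e2: "m3 y * f2 y = - (?c4 y) * q y" unfolding f2 by simp
      have sq: "c\<^sup>2 \<le> m\<^sup>2" if "\<bar>c\<bar> \<le> m" for c using that by (simp add: abs_le_square_iff[symmetric])
      have t: "(r * t)\<^sup>2 \<le> m\<^sup>2 * t\<^sup>2" if "\<bar>r\<bar> \<le> m" for r t
        unfolding power_mult_distrib using sq[OF that] by (rule mult_right_mono) simp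
      have "(k1 y * p y + ?c2 y * q y + k3 y * f y)\<^sup>2 \<le> 3 * ((k1 y * p y)\<^sup>2 + (?c2 y * q y)\<^sup>2 + (k3 y * f y)\<^sup>2)"
      proof -
        have "(r + s + t)\<^sup>2 \<le> 3 * (r\<^sup>2 + s\<^sup>2 + t\<^sup>2)" for r s t :: real
        proof -
          have "0 \<le> (r - s)\<^sup>2 + (s - t)\<^sup>2 + (r - t)\<^sup>2" by simp
          then show ?thesis by (simp add: power2_eq_square algebra_simps)
        qed
        then show ?thesis .
      qed
      also have "\<dots> \<le> 3 * (m\<^sup>2 * (p y)\<^sup>2 + m\<^sup>2 * (q y)\<^sup>2 + m\<^sup>2 * (f y)\<^sup>2)"
        using elim by (intro mult_left_mono add_mono t) auto
      finally have 1: "(k1 y * p y + ?c2 y * q y + k3 y * f y)\<^sup>2 \<le> 3 * m\<^sup>2 * energy y"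
        by (simp add: energy_def algebra_simps)
      have "(- (?c4 y) * q y)\<^sup>2 \<le> m\<^sup>2 * (q y)\<^sup>2" using elim by (intro t) simp
      also have "\<dots> \<le> m\<^sup>2 * energy y" by (intro mult_left_mono) (auto simp: energy_def)
      finally show ?case unfolding dbar_pq[OF y] e1 e2 using 1 y by linarith
    qed
  qed simp
qed

text \<open>The function on the right-hand side is \<open>\<bar>(\<partial>\<^sub>1 + \<beta> \<partial>\<^sub>2) \<theta>\<bar>\<^sup>2\<close> times the energy: only the region where
  the cutoff \<open>\<theta>\<close> varies contributes.\<close>

definition cutoff_estimate :: "real^2 \<Rightarrow> real \<Rightarrow> real \<Rightarrow> real \<Rightarrow> bool" where
  "cutoff_estimate x R K M \<longleftrightarrow> (\<forall>n \<theta> C. n \<ge> 0 \<and> compact C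
      \<and> C \<subseteq> {y. 0 < elliptic_symbol.rho a b x y \<and> elliptic_symbol.rho a b x y < R}
      \<and> smooth_on U \<theta> \<and> (\<forall>y. y \<notin> C \<longrightarrow> \<theta> y = 0) \<longrightarrow>
      (n - M) * (\<integral>y. exp (- 2 * n * elliptic_symbol.psi a b x K y) * ((\<theta> y)\<^sup>2 * energy y) \<partial>lborel)
       \<le> 2 * (\<integral>y. exp (- 2 * n * elliptic_symbol.psi a b x K y) *
          (((D1 \<theta> y + a y * D2 \<theta> y)\<^sup>2 + (b y * D2 \<theta> y)\<^sup>2) * energy y) \<partial>lborel))"

text \<open>Add the Carleman inequalities for \<open>\<theta> w\<close> and for the real function \<open>\<theta> f\<close>. The operator applied to
  \<open>w\<close> is bounded by \<open>w\<close> and \<open>f\<close>, and applied to \<open>f\<close> it gives the conjugate of \<open>w\<close>. Both contributions are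
  multiples of the left-hand side that do not grow with \<open>n\<close>, so they only increase the constant \<open>M\<close>.\<close>

lemma cutoff_estimate_exists:
  assumes x: "x \<in> U"
  shows "\<exists>R>0. \<exists>K\<ge>0. \<exists>M. K * R \<le> 1 \<and> (\<forall>y. elliptic_symbol.rho a b x y < R \<longrightarrow> y \<in> U) \<and> cutoff_estimate x R K M"
proof -
  interpret E: elliptic_symbol U a b x
    by unfold_locales (use U x smooth b_pos in auto)
  let ?G = "\<lambda>y. (cr_re a b p q y)\<^sup>2
      + (cr_im a b p q y)\<^sup>2"
  obtain C0 where C0: "C0 \<ge> 0" "\<forall>\<^sub>F y in nhds x. y \<in> U \<and> ?G y \<le> C0 * energy y"
    using dbar_le_energy[OF x] by blast
  obtain R1 where R1: "R1 > 0" "\<And>y. E.rho y < R1 \<Longrightarrow> y \<in> U \<and> ?G y \<le> C0 * energy y"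
    using E.nhds_imp_rho[OF C0(2)] by blast
  obtain R K M where RK: "R > 0" "K \<ge> 0" "K * R \<le> 1" "\<And>y. E.rho y < R \<Longrightarrow> y \<in> U"
    and carl: "E.carleman_estimate R K M"
    using E.carleman_inequality by blast
  have "K * min R R1 \<le> K * R" using RK by (intro mult_left_mono) auto
  then have RK': "min R R1 > 0" "K * min R R1 \<le> 1" "\<And>y. E.rho y < min R R1 \<Longrightarrow> y \<in> U"
    using RK R1 by auto
  have "cutoff_estimate x (min R R1) K (M + (2 * C0 + 2))"
    unfolding cutoff_estimate_def
  proof (intro allI impI, elim conjE)
    fix n :: real and \<theta> :: "real^2 \<Rightarrow> real" and C :: "(real^2) set"
    assume n: "n \<ge> 0" and C: "compact C" "C \<subseteq> {y. 0 < E.rho y \<and> E.rho y < min R R1}"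
      and s\<theta>: "smooth_on U \<theta>" and \<theta>0': "\<forall>y. y \<notin> C \<longrightarrow> \<theta> y = 0"
    have \<theta>0: "\<And>y. y \<notin> C \<Longrightarrow> \<theta> y = 0" using \<theta>0' by blast
    have CU: "C \<subseteq> U" using C(2) RK(4) by auto
    have C': "C \<subseteq> {y. 0 < E.rho y \<and> E.rho y < R}" using C(2) by auto
    let ?e = "\<lambda>y. exp (- 2 * n * E.psi K y)"
    let ?P = "\<lambda>y. \<theta> y * p y" and ?Q = "\<lambda>y. \<theta> y * q y" and ?F = "\<lambda>y. \<theta> y * f y"
    let ?X = "\<lambda>y. (D1 \<theta> y + a y * D2 \<theta> y)\<^sup>2 + (b y * D2 \<theta> y)\<^sup>2"
    have sm: "smooth_on U ?P" "smooth_on U ?Q" "smooth_on U ?F"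
      by (intro smooth_on_mult U s\<theta> smooth smooth_pq)+
    have sm': "smooth_on (U - {x}) G" if "smooth_on U G" for G :: "real^2 \<Rightarrow> real"
      using that by (rule smooth_on_subset) auto
    let ?D1 = "\<lambda>y. (cr_re a b ?P ?Q y)\<^sup>2
            + (cr_im a b ?P ?Q y)\<^sup>2"
    let ?D2 = "\<lambda>y. (D1 ?F y + a y * D2 ?F y)\<^sup>2 + (b y * D2 ?F y)\<^sup>2"
    have c1: "(n - M) * (\<integral>y. ?e y * ((?P y)\<^sup>2 + (?Q y)\<^sup>2) \<partial>lborel) \<le> (\<integral>y. ?e y * ?D1 y \<partial>lborel)"
      using carl[unfolded E.carleman_estimate_def, rule_format, of n C ?P ?Q] n C(1) C' sm'[OF sm(1)] sm'[OF sm(2)] \<theta>0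
      by simp
    have z: "partial_deriv i (\<lambda>y. 0) y = 0" for i and y :: "real^2" by (simp add: partial_deriv_def)
    have c2: "(n - M) * (\<integral>y. ?e y * (?F y)\<^sup>2 \<partial>lborel) \<le> (\<integral>y. ?e y * ?D2 y \<partial>lborel)"
      using carl[unfolded E.carleman_estimate_def, rule_format, of n C ?F "\<lambda>y. 0"] n C(1) C' sm'[OF sm(3)]
        smooth_on_const[of "U - {x}" 0] \<theta>0 U by (simp add: z open_Diff)
    have cont: "continuous_on C G" if "smooth_on U G" for G :: "real^2 \<Rightarrow> real"
      using smooth_on_continuous[OF that] CU by (rule continuous_on_subset)
    have cpsi: "continuous_on C (E.psi K)"
      using smooth_on_continuous[OF E.smooth_psi] by (rule continuous_on_subset) (use C E.rho_x0 in auto)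
    have z0: "partial_deriv i \<theta> y = 0" "partial_deriv i ?P y = 0" "partial_deriv i ?Q y = 0" "partial_deriv i ?F y = 0"
      if "y \<notin> C" for i y
      using \<theta>0 that by (auto intro!: partial_zero_outside[OF C(1)])
    have int: "integrable lborel (\<lambda>y. ?e y * ((?P y)\<^sup>2 + (?Q y)\<^sup>2))" "integrable lborel (\<lambda>y. ?e y * (?F y)\<^sup>2)"
      "integrable lborel (\<lambda>y. ?e y * ?D1 y)" "integrable lborel (\<lambda>y. ?e y * ?D2 y)"
      "integrable lborel (\<lambda>y. ?e y * ((\<theta> y)\<^sup>2 * energy y))" "integrable lborel (\<lambda>y. ?e y * (?X y * energy y))"
      by (rule integrable_compact_support[OF C(1)],
          intro continuous_intros cpsi cont sm smooth_on_partial smooth smooth_pq smooth_energy s\<theta>,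
          simp add: \<theta>0 z0)+
    have pt: "?D1 y + ?D2 y \<le> (2 * C0 + 2) * ((\<theta> y)\<^sup>2 * energy y) + 2 * (?X y * energy y)" for y
    proof (cases "y \<in> C")
      case False
      then show ?thesis by (simp add: \<theta>0 z0)
    next
      case True
      then have y: "y \<in> U" and G: "?G y \<le> C0 * energy y" using CU R1(2) C(2) by auto
      note d = smooth_on_differentiable[OF _ y]
      have pr: "partial_deriv i ?P y = partial_deriv i \<theta> y * p y + \<theta> y * partial_deriv i p y"
        "partial_deriv i ?Q y = partial_deriv i \<theta> y * q y + \<theta> y * partial_deriv i q y"
        "partial_deriv i ?F y = partial_deriv i \<theta> y * f y + \<theta> y * partial_deriv i f y" for i
        by (intro partial_deriv_mult d s\<theta> smooth smooth_pq)+
      define c1 c2 where "c1 = D1 \<theta> y + a y * D2 \<theta> y" and "c2 = b y * D2 \<theta> y"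
      define g1 g2 where "g1 = cr_re a b p q y"
        and "g2 = cr_im a b p q y"
      have ge: "g1\<^sup>2 + g2\<^sup>2 \<le> C0 * energy y" using G by (simp add: g1_def g2_def)
      have two: "(r + s)\<^sup>2 \<le> 2 * r\<^sup>2 + 2 * s\<^sup>2" for r s :: real
        using zero_le_power2[of "r - s"] by (simp add: power2_eq_square algebra_simps)
      have D1: "?D1 y = (\<theta> y * g1 + (c1 * p y - c2 * q y))\<^sup>2 + (\<theta> y * g2 + (c1 * q y + c2 * p y))\<^sup>2"
        unfolding pr c1_def c2_def g1_def g2_def by (simp add: algebra_simps)
      also have "\<dots> \<le> 2 * (\<theta> y * g1)\<^sup>2 + 2 * (c1 * p y - c2 * q y)\<^sup>2 + (2 * (\<theta> y * g2)\<^sup>2 + 2 * (c1 * q y + c2 * p y)\<^sup>2)"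
        by (intro add_mono two)
      also have "\<dots> = 2 * (\<theta> y)\<^sup>2 * (g1\<^sup>2 + g2\<^sup>2) + 2 * ((c1\<^sup>2 + c2\<^sup>2) * ((p y)\<^sup>2 + (q y)\<^sup>2))"
        by (simp add: power2_eq_square algebra_simps)
      also have "\<dots> \<le> 2 * (\<theta> y)\<^sup>2 * (C0 * energy y) + 2 * ((c1\<^sup>2 + c2\<^sup>2) * ((p y)\<^sup>2 + (q y)\<^sup>2))"
        by (intro add_right_mono mult_left_mono ge) simp
      finally have 1: "?D1 y \<le> 2 * (\<theta> y)\<^sup>2 * (C0 * energy y) + 2 * ((c1\<^sup>2 + c2\<^sup>2) * ((p y)\<^sup>2 + (q y)\<^sup>2))" .
      have "?D2 y = (\<theta> y * p y + c1 * f y)\<^sup>2 + (\<theta> y * (- q y) + c2 * f y)\<^sup>2"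
        unfolding pr c1_def c2_def p_def q_def by (simp add: algebra_simps)
      also have "\<dots> \<le> 2 * (\<theta> y * p y)\<^sup>2 + 2 * (c1 * f y)\<^sup>2 + (2 * (\<theta> y * (- q y))\<^sup>2 + 2 * (c2 * f y)\<^sup>2)"
        by (intro add_mono two)
      also have "\<dots> = 2 * (\<theta> y)\<^sup>2 * ((p y)\<^sup>2 + (q y)\<^sup>2) + 2 * ((c1\<^sup>2 + c2\<^sup>2) * (f y)\<^sup>2)"
        by (simp add: power2_eq_square algebra_simps)
      also have "\<dots> \<le> 2 * (\<theta> y)\<^sup>2 * energy y + 2 * ((c1\<^sup>2 + c2\<^sup>2) * (f y)\<^sup>2)"
        by (intro add_right_mono mult_left_mono) (auto simp: energy_def)
      finally have 2: "?D2 y \<le> 2 * (\<theta> y)\<^sup>2 * energy y + 2 * ((c1\<^sup>2 + c2\<^sup>2) * (f y)\<^sup>2)" .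
      have X: "?X y = c1\<^sup>2 + c2\<^sup>2" by (simp add: c1_def c2_def)
      have "2 * (c1\<^sup>2 + c2\<^sup>2) * energy y = 2 * ((c1\<^sup>2 + c2\<^sup>2) * ((p y)\<^sup>2 + (q y)\<^sup>2)) + 2 * ((c1\<^sup>2 + c2\<^sup>2) * (f y)\<^sup>2)"
        by (simp add: energy_def algebra_simps)
      then show ?thesis unfolding X using 1 2 by (simp add: algebra_simps)
    qed
    let ?I = "\<integral>y. ?e y * ((\<theta> y)\<^sup>2 * energy y) \<partial>lborel"
    let ?J = "\<integral>y. ?e y * (?X y * energy y) \<partial>lborel"
    have "?I = (\<integral>y. ?e y * ((?P y)\<^sup>2 + (?Q y)\<^sup>2) + ?e y * (?F y)\<^sup>2 \<partial>lborel)"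
      by (rule Bochner_Integration.integral_cong) (simp_all add: energy_def power2_eq_square algebra_simps)
    also have "\<dots> = (\<integral>y. ?e y * ((?P y)\<^sup>2 + (?Q y)\<^sup>2) \<partial>lborel) + (\<integral>y. ?e y * (?F y)\<^sup>2 \<partial>lborel)"
      using int by (intro Bochner_Integration.integral_add)
    finally have "(n - M) * ?I \<le> (\<integral>y. ?e y * ?D1 y \<partial>lborel) + (\<integral>y. ?e y * ?D2 y \<partial>lborel)"
      using c1 c2 by (simp only: distrib_left)
    also have "\<dots> = (\<integral>y. ?e y * ?D1 y + ?e y * ?D2 y \<partial>lborel)"
      using int by (intro Bochner_Integration.integral_add[symmetric])
    also have "\<dots> \<le> (\<integral>y. (2 * C0 + 2) * (?e y * ((\<theta> y)\<^sup>2 * energy y)) + 2 * (?e y * (?X y * energy y)) \<partial>lborel)"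
    proof (rule integral_mono)
      show "?e y * ?D1 y + ?e y * ?D2 y \<le> (2 * C0 + 2) * (?e y * ((\<theta> y)\<^sup>2 * energy y)) + 2 * (?e y * (?X y * energy y))" for y
      proof -
        have "?e y * (?D1 y + ?D2 y) \<le> ?e y * ((2 * C0 + 2) * ((\<theta> y)\<^sup>2 * energy y) + 2 * (?X y * energy y))"
          by (intro mult_left_mono pt) simp
        then show ?thesis by (simp only: distrib_left mult.left_commute)
      qed
    qed (use int in auto)
    also have "\<dots> = (2 * C0 + 2) * ?I + 2 * ?J"
      using int by simp
    finally show "(n - (M + (2 * C0 + 2))) * ?I \<le> 2 * ?J" by (simp add: algebra_simps)
  qed
  then show ?thesis using RK(2) RK' by blast
qed

end

section \<open>Strong unique continuation\<close>

lemma ln_minus_sqrt_mono: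
  fixes K s s' :: real
  assumes K: "K \<ge> 0" "K * sqrt s' \<le> 1" and s: "0 < s" "s \<le> s'"
  shows "ln s / 2 - K * sqrt s \<le> ln s' / 2 - K * sqrt s'"
proof (rule DERIV_nonneg_imp_nondecreasing[OF s(2)])
  fix t assume t: "s \<le> t" "t \<le> s'"
  then have t0: "t > 0" using s by linarith
  have "((\<lambda>t. ln t / 2 - K * sqrt t) has_real_derivative 1 / (2 * t) - K * (inverse (sqrt t) / 2)) (at t)"
    using t0 by (auto intro!: derivative_eq_intros)
  moreover have "0 \<le> 1 / (2 * t) - K * (inverse (sqrt t) / 2)"
  proof -
    have "K * sqrt t \<le> K * sqrt s'" using K t by (intro mult_left_mono) auto
    then have "K * sqrt t \<le> 1" using K by linarith
    then have "K * sqrt t / (2 * t) \<le> 1 / (2 * t)" using t0 by (intro divide_right_mono) auto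
    moreover have "K * sqrt t / (2 * t) = K * (inverse (sqrt t) / 2)"
      using t0 by (simp add: field_simps)
    ultimately show ?thesis by linarith
  qed
  ultimately show "\<exists>d. ((\<lambda>t. ln t / 2 - K * sqrt t) has_real_derivative d) (at t) \<and> 0 \<le> d" by blast
qed

context elliptic_symbol
begin

lemma compact_annulus:
  assumes "0 < s1"
  shows "compact {y. s1 \<le> sq y \<and> sq y \<le> s2}"
proof -
  obtain \<kappa> where \<kappa>: "\<kappa> > 0" "\<And>y. norm (y - x0) \<le> \<kappa> * rho y" using norm_le_rho by blast
  have "{y. s1 \<le> sq y \<and> sq y \<le> s2} \<subseteq> cball x0 (\<kappa> * sqrt s2)"
  proof
    fix y assume "y \<in> {y. s1 \<le> sq y \<and> sq y \<le> s2}"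
    then have "rho y \<le> sqrt s2" by (simp add: rho_def)
    then have "\<kappa> * rho y \<le> \<kappa> * sqrt s2" using \<kappa> by (intro mult_left_mono) auto
    then show "y \<in> cball x0 (\<kappa> * sqrt s2)" using \<kappa>(2)[of y] by (simp add: dist_norm norm_minus_commute)
  qed
  moreover have "closed {y. s1 \<le> sq y \<and> sq y \<le> s2}"
    by (intro closed_Collect_conj closed_Collect_le continuous_intros
        smooth_on_continuous[OF smooth_sq[OF open_UNIV]])
  ultimately show ?thesis by (meson bounded_cball bounded_subset compact_eq_bounded_closed)
qed

text \<open>A cutoff that is 1 for \<open>2 \<tau> \<le> \<rho>\<^sup>2 \<le> \<sigma>\<close> and vanishes outside \<open>\<tau> \<le> \<rho>\<^sup>2 \<le> 2 \<sigma>\<close>. The factor \<open>A\<close> in its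
  derivative is large, of size \<open>1 / \<tau>\<close>, only in the inner transition zone; in the outer one its size does
  not depend on \<open>\<tau>\<close>.\<close>

definition annular_cutoff :: "real \<Rightarrow> real \<Rightarrow> real \<Rightarrow> (real^2 \<Rightarrow> real) \<Rightarrow> bool" where
  "annular_cutoff B \<tau> \<sigma> \<theta> \<longleftrightarrow> smooth_on UNIV \<theta>
      \<and> (\<forall>y. sq y < \<tau> \<or> sq y > 2 * \<sigma> \<longrightarrow> \<theta> y = 0)
      \<and> (\<forall>y. 2 * \<tau> \<le> sq y \<and> sq y \<le> \<sigma> \<longrightarrow> \<theta> y = 1)
      \<and> (\<forall>y. \<exists>A. (\<forall>i. partial_deriv i \<theta> y = A * partial_deriv i sq y)
             \<and> A\<^sup>2 \<le> (if \<tau> \<le> sq y \<and> sq y \<le> 2 * \<tau> then B / \<tau>\<^sup>2 else if \<sigma> \<le> sq y \<and> sq y \<le> 2 * \<sigma> then B / \<sigma>\<^sup>2 else 0))"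

lemma annular_cutoff_exists:
  "\<exists>B\<ge>0. \<forall>\<tau> \<sigma>. 0 < \<tau> \<and> 2 * \<tau> < \<sigma> \<longrightarrow> (\<exists>\<theta>. annular_cutoff B \<tau> \<sigma> \<theta>)"
proof -
  obtain H :: "real \<Rightarrow> real" and H' B
  where H: "smooth_on UNIV H" "\<And>t. t \<le> 1 \<Longrightarrow> H t = 1" "\<And>t. t \<ge> 2 \<Longrightarrow> H t = 0"
    "\<And>t. 0 \<le> H t" "\<And>t. H t \<le> 1" and D: "\<And>t. (H has_real_derivative H' t) (at t)"
    and B: "\<And>t. \<bar>H' t\<bar> \<le> B" and Z: "\<And>t. t < 1 \<or> t > 2 \<Longrightarrow> H' t = 0"
    using smooth_step by blast
  have B0: "B \<ge> 0" using B[of 0] by linarith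
  have ds: "sq differentiable (at y)" for y
    using smooth_sq[OF open_UNIV] by (rule smooth_on_differentiable) simp
  have sH: "smooth_on UNIV (\<lambda>y. H (sq y / c))" for c
  proof -
    have s: "smooth_on UNIV (\<lambda>y. inverse c * sq y)" by (intro smooth_on_mult smooth_on_const open_UNIV smooth_sq)
    have "smooth_on UNIV (\<lambda>y. H (inverse c * sq y))"
      by (rule smooth_on_compose[OF open_UNIV open_UNIV _ H(1) s]) simp
    then show ?thesis by (simp add: divide_inverse mult.commute)
  qed
  have pH: "partial_deriv i (\<lambda>y. H (sq y / c)) y = H' (sq y / c) / c * partial_deriv i sq y" for c i y
  proof -
    have "((\<lambda>t. H (t / c)) has_real_derivative H' (sq y / c) * (1 / c)) (at (sq y))"
      by (rule DERIV_chain2[OF D DERIV_cdivide[OF DERIV_ident]])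
    from partial_chain[OF this ds] show ?thesis by simp
  qed
  show ?thesis
  proof (rule exI[of _ "4 * B\<^sup>2"], intro conjI allI impI)
    fix \<tau> \<sigma> :: real assume "0 < \<tau> \<and> 2 * \<tau> < \<sigma>"
    then have \<tau>: "0 < \<tau>" "2 * \<tau> < \<sigma>" by auto
    then have \<sigma>: "0 < \<sigma>" by linarith
    let ?t = "\<lambda>y. H (sq y / \<sigma>) * (1 - H (sq y / \<tau>))"
    have st: "smooth_on UNIV ?t" by (intro smooth_on_mult smooth_on_diff smooth_on_const open_UNIV sH)
    have 1: "?t y = 0" if "sq y < \<tau> \<or> sq y > 2 * \<sigma>" for y
      using that \<tau> \<sigma> H(2)[of "sq y / \<tau>"] H(3)[of "sq y / \<sigma>"] by (auto simp: field_simps)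
    have 2: "?t y = 1" if "2 * \<tau> \<le> sq y \<and> sq y \<le> \<sigma>" for y
      using that \<tau> \<sigma> H(2)[of "sq y / \<sigma>"] H(3)[of "sq y / \<tau>"] by (auto simp: field_simps)
    have 3: "\<exists>A. (\<forall>i. partial_deriv i ?t y = A * partial_deriv i sq y)
         \<and> A\<^sup>2 \<le> (if \<tau> \<le> sq y \<and> sq y \<le> 2 * \<tau> then 4 * B\<^sup>2 / \<tau>\<^sup>2 else if \<sigma> \<le> sq y \<and> sq y \<le> 2 * \<sigma> then 4 * B\<^sup>2 / \<sigma>\<^sup>2 else 0)" for y
    proof -
      define A1 A2 where "A1 = H' (sq y / \<sigma>) / \<sigma> * (1 - H (sq y / \<tau>))" and "A2 = H (sq y / \<sigma>) * (H' (sq y / \<tau>) / \<tau>)"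
      have dH: "(\<lambda>y. H (sq y / c)) differentiable (at y)" for c
        using sH by (rule smooth_on_differentiable) simp
      have p: "partial_deriv i ?t y = (A1 - A2) * partial_deriv i sq y" for i
      proof -
        have "partial_deriv i (\<lambda>y. 1 - H (sq y / \<tau>)) y = - (H' (sq y / \<tau>) / \<tau> * partial_deriv i sq y)"
          by (subst partial_deriv_diff) (auto intro: dH simp: pH, simp add: partial_deriv_def)
        then show ?thesis
          by (subst partial_deriv_mult) (auto intro!: dH differentiable_diff simp: pH A1_def A2_def algebra_simps)
      qed
      have b1: "\<bar>A1\<bar> \<le> B / \<sigma>"
      proof -
        have "\<bar>A1\<bar> = \<bar>H' (sq y / \<sigma>)\<bar> / \<sigma> * \<bar>1 - H (sq y / \<tau>)\<bar>" using \<sigma> by (simp add: A1_def abs_mult)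
        also have "\<dots> \<le> B / \<sigma> * 1"
          using B H(4,5)[of "sq y / \<tau>"] \<sigma> B0 by (intro mult_mono divide_right_mono) auto
        finally show ?thesis by simp
      qed
      have b2: "\<bar>A2\<bar> \<le> B / \<tau>"
      proof -
        have "\<bar>A2\<bar> = \<bar>H (sq y / \<sigma>)\<bar> * (\<bar>H' (sq y / \<tau>)\<bar> / \<tau>)" using \<tau> by (simp add: A2_def abs_mult)
        also have "\<dots> \<le> 1 * (B / \<tau>)"
          using B H(4,5)[of "sq y / \<sigma>"] \<tau> B0 by (intro mult_mono divide_right_mono) auto
        finally show ?thesis by simp
      qed
      have z1: "A1 = 0" if "\<not> (\<sigma> \<le> sq y \<and> sq y \<le> 2 * \<sigma>)"
        using Z[of "sq y / \<sigma>"] that \<sigma> by (auto simp: A1_def field_simps)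
      have z2: "A2 = 0" if "\<not> (\<tau> \<le> sq y \<and> sq y \<le> 2 * \<tau>)"
        using Z[of "sq y / \<tau>"] that \<tau> by (auto simp: A2_def field_simps)
      have sqb: "v\<^sup>2 \<le> 4 * B\<^sup>2 / c\<^sup>2" if "\<bar>v\<bar> \<le> B / c" "c > 0" for v c
      proof -
        have "v\<^sup>2 \<le> (B / c)\<^sup>2" using that B0 by (simp add: abs_le_square_iff[symmetric])
        also have "\<dots> \<le> 4 * B\<^sup>2 / c\<^sup>2" unfolding power_divide by (intro divide_right_mono) auto
        finally show ?thesis .
      qed
      have "(A1 - A2)\<^sup>2 \<le> (if \<tau> \<le> sq y \<and> sq y \<le> 2 * \<tau> then 4 * B\<^sup>2 / \<tau>\<^sup>2 else if \<sigma> \<le> sq y \<and> sq y \<le> 2 * \<sigma> then 4 * B\<^sup>2 / \<sigma>\<^sup>2 else 0)"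
        using z1 z2 sqb[OF b1 \<sigma>] sqb[OF b2 \<tau>(1)] \<tau> by auto
      then show ?thesis using p by blast
    qed
    show "\<exists>\<theta>. annular_cutoff (4 * B\<^sup>2) \<tau> \<sigma> \<theta>"
      unfolding annular_cutoff_def
      by (rule exI[of _ ?t]) (use st 1 2 3 in blast)
  qed (simp)
qed

end

lemma le_of_small_perturbation:
  fixes l :: real
  assumes "\<tau>0 > 0" "\<And>\<tau>. \<lbrakk>0 < \<tau>; \<tau> < \<tau>0\<rbrakk> \<Longrightarrow> l \<le> c * \<tau> + r"
  shows "l \<le> r"
proof (rule tendsto_lowerbound)
  have "((\<lambda>\<tau>. c * \<tau> + r) \<longlongrightarrow> c * 0 + r) (at_right 0)" by (intro tendsto_intros)
  then show "((\<lambda>\<tau>. c * \<tau> + r) \<longlongrightarrow> r) (at_right 0)" by simp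
  show "\<forall>\<^sub>F \<tau> in at_right 0. l \<le> c * \<tau> + r"
    unfolding eventually_at_right_field using assms by (intro exI[of _ \<tau>0]) auto
qed simp

context elliptic_equation
begin

lemma energy_flat:
  assumes x: "x \<in> U" and fl: "\<And>m. flat m x w" "\<And>m. flat m x f"
  shows "\<exists>C\<ge>0. \<forall>\<^sub>F y in nhds x. energy y \<le> C * norm (y - x) ^ (2 * N)"
proof -
  obtain C1 r1 where 1: "C1 \<ge> 0" "r1 > 0" "\<And>y. y \<in> ball x r1 \<Longrightarrow> norm (w y) \<le> C1 * norm (y - x) ^ N"
    using flat_bound[OF U x smooth_w fl(1)] by meson
  obtain C2 r2 where 2: "C2 \<ge> 0" "r2 > 0" "\<And>y. y \<in> ball x r2 \<Longrightarrow> norm (f y) \<le> C2 * norm (y - x) ^ N"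
    using flat_bound[OF U x smooth(6) fl(2)] by meson
  show ?thesis
  proof (intro exI[of _ "C1\<^sup>2 + C2\<^sup>2"] conjI)
    have "energy y \<le> (C1\<^sup>2 + C2\<^sup>2) * norm (y - x) ^ (2 * N)" if y: "y \<in> ball x (min r1 r2)" for y
    proof -
      have "(p y)\<^sup>2 + (q y)\<^sup>2 = (norm (w y))\<^sup>2" by (simp add: w_def cmod_power2)
      also have "\<dots> \<le> (C1 * norm (y - x) ^ N)\<^sup>2" using 1 y by (intro power_mono) auto
      finally have "(p y)\<^sup>2 + (q y)\<^sup>2 \<le> (C1 * norm (y - x) ^ N)\<^sup>2" .
      moreover have "(f y)\<^sup>2 \<le> (C2 * norm (y - x) ^ N)\<^sup>2"
        using power_mono[OF 2(3)[of y], of 2] y by simp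
      ultimately show ?thesis unfolding energy_def
        by (simp add: power_mult_distrib power_mult algebra_simps flip: power_mult)
    qed
    then show "\<forall>\<^sub>F y in nhds x. energy y \<le> (C1\<^sup>2 + C2\<^sup>2) * norm (y - x) ^ (2 * N)"
      unfolding eventually_nhds_metric using 1 2
      by (intro exI[of _ "min r1 r2"]) (auto simp: dist_commute)
  qed simp
qed

text \<open>Suppose that the energy is positive at a point \<open>z\<close> with \<open>\<rho>\<^sup>2 < \<sigma>\<close>, and use the cutoff estimate for
  \<open>\<tau> \<rightarrow> 0\<close>. For fixed \<open>n\<close> the inner transition zone contributes \<open>O(\<tau>)\<close>, because the energy
  decays faster than any power of \<open>\<rho>\<close> while the weight grows like \<open>\<rho>\<^sup>-\<^sup>2\<^sup>n\<close>. The weight is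
  decreasing in \<open>\<rho>\<close>: in the outer zone it is at most its value \<open>e\<sigma>\<close> at \<open>\<rho>\<^sup>2 = \<sigma>\<close>, near \<open>z\<close> it is at least \<open>e\<sigma>\<close>.
  Dividing by \<open>e\<sigma>\<close> leaves \<open>(n - M) v \<le> const\<close> with \<open>v > 0\<close> and a constant independent of \<open>n\<close>, which is
  absurd for large \<open>n\<close>.\<close>

theorem strong_unique_continuation:
  assumes x: "x \<in> U" and fl: "\<And>m. flat m x w" "\<And>m. flat m x f"
  shows "\<forall>\<^sub>F y in nhds x. f y = 0"
proof -
  interpret E: elliptic_symbol U a b x
    by unfold_locales (use U x smooth b_pos in auto)
  obtain \<kappa> where \<kappa>: "\<kappa> > 0" "\<And>y. norm (y - x) \<le> \<kappa> * E.rho y" using E.norm_le_rho by blast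
  obtain B where B: "B \<ge> 0" and cutoff: "\<And>\<tau> \<sigma>. \<lbrakk>0 < \<tau>; 2 * \<tau> < \<sigma>\<rbrakk> \<Longrightarrow> \<exists>\<theta>. E.annular_cutoff B \<tau> \<sigma> \<theta>"
    using E.annular_cutoff_exists by blast
  let ?g = "\<lambda>y. (D1 E.sq y + a y * D2 E.sq y) * (D1 E.sq y + a y * D2 E.sq y)
     + (b y * D2 E.sq y) * (b y * D2 E.sq y)"
  have sg: "smooth_on U ?g"
    by (intro smooth_on_add smooth_on_mult U smooth smooth_on_partial E.smooth_sq)
  have "eventually (\<lambda>m. \<forall>\<^sub>F y in nhds x. \<bar>?g y\<bar> \<le> m \<and> \<bar>energy y\<bar> \<le> m) at_top"
    using smooth_locally_bounded[OF U x sg] smooth_locally_bounded[OF U x smooth_energy]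
    by eventually_elim (rule eventually_conj)
  then obtain m where "\<forall>\<^sub>F y in nhds x. \<bar>?g y\<bar> \<le> m \<and> \<bar>energy y\<bar> \<le> m"
    using eventually_happens'[OF trivial_limit_at_top_linorder] by blast
  then obtain R1 where R1: "R1 > 0" "\<And>y. E.rho y < R1 \<Longrightarrow> \<bar>?g y\<bar> \<le> m \<and> \<bar>energy y\<bar> \<le> m"
    using E.nhds_imp_rho by blast
  have m: "m \<ge> 0" using R1(2)[of x] R1(1) by (auto simp: E.rho_x0)
  obtain R K M where R: "R > 0" and K: "K \<ge> 0" "K * R \<le> 1" and RU: "\<And>y. E.rho y < R \<Longrightarrow> y \<in> U"
    and est: "cutoff_estimate x R K M"
    using cutoff_estimate_exists[OF x] by blast
  define R' where "R' = min R R1"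
  have R': "R' > 0" "R' \<le> R" "R' \<le> R1" using R R1 by (auto simp: R'_def)
  define \<sigma> where "\<sigma> = R'\<^sup>2 / 4"
  have \<sigma>: "\<sigma> > 0" using R' by (simp add: \<sigma>_def)
  have small: "E.rho y < R'" if "E.sq y \<le> 2 * \<sigma>" for y
  proof (rule power2_less_imp_less)
    have "(E.rho y)\<^sup>2 = E.sq y" using E.rho_sq[of y] by (simp add: power2_eq_square)
    also have "\<dots> < R'\<^sup>2"
    proof -
      have "R'\<^sup>2 > 0" using R' by simp
      then show ?thesis using that unfolding \<sigma>_def by linarith
    qed
    finally show "(E.rho y)\<^sup>2 < R'\<^sup>2" .
  qed (use R' in simp)
  have K\<sigma>: "K * sqrt \<sigma> \<le> 1"
  proof -
    have "sqrt \<sigma> \<le> R'" using R' by (intro real_le_lsqrt) (auto simp: \<sigma>_def)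
    then have "K * sqrt \<sigma> \<le> K * R" using K R' by (intro mult_left_mono) auto
    then show ?thesis using K by linarith
  qed
  define \<beta>\<^sub>0 where "\<beta>\<^sub>0 = ln \<sigma> / 2 - K * sqrt \<sigma>"
  define D where "D = cball x (\<kappa> * R')"
  define vol where "vol = measure lborel D"
  have zero: "energy z = 0" if z: "z \<noteq> x" "E.sq z < \<sigma>" for z
  proof (rule ccontr)
    assume "energy z \<noteq> 0"
    then have ez: "energy z > 0" using energy_nonneg[of z] by linarith
    have sz: "E.sq z > 0" using E.sq_pos z by blast
    have zU: "z \<in> U" using small[of z] z \<sigma> R' RU[of z] by auto
    define \<tau>0 where "\<tau>0 = E.sq z / 4"
    have \<tau>0: "\<tau>0 > 0" "2 * \<tau>0 < \<sigma>" using sz z by (auto simp: \<tau>0_def)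
    have "isCont energy z" "isCont E.sq z"
      using smooth_on_continuous[OF smooth_energy] smooth_on_continuous[OF E.smooth_sq[OF open_UNIV]] U zU
      by (auto simp: continuous_on_eq_continuous_at)
    then have "(energy \<longlongrightarrow> energy z) (nhds z)" "(E.sq \<longlongrightarrow> E.sq z) (nhds z)"
      by (simp_all add: tendsto_nhds_iff isCont_def)
    then have "\<forall>\<^sub>F y in nhds z. energy z / 2 < energy y \<and> 2 * \<tau>0 < E.sq y \<and> E.sq y < \<sigma>"
      using ez sz z unfolding \<tau>0_def
      by (intro eventually_conj order_tendstoD) auto
    then obtain d where d: "d > 0" "\<And>y. y \<in> ball z d \<Longrightarrow> energy z / 2 < energy y \<and> 2 * \<tau>0 < E.sq y \<and> E.sq y < \<sigma>"
      unfolding eventually_nhds_metric by (auto simp: dist_commute)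
    define v where "v = energy z / 2 * measure lborel (ball z d)"
    have v: "v > 0" using ez d(1) by (simp add: v_def content_ball_pos)
    have bound: "(real n - M) * v \<le> 2 * (m * (B / \<sigma>\<^sup>2) * m) * vol" if n: "real n \<ge> M" for n :: nat
    proof -
      define e where "e y = exp (- 2 * real n * E.psi K y)" for y
      define e\<sigma> where "e\<sigma> = exp (- 2 * real n * \<beta>\<^sub>0)"
      have e\<sigma>: "e\<sigma> > 0" by (simp add: e\<sigma>_def)
      (* of the exponent n + 3, n compensates the weight and 2 the squared derivative of the cutoff;
         one power of \<tau> remains *)
      obtain C where C: "C \<ge> 0" "\<forall>\<^sub>F y in nhds x. energy y \<le> C * norm (y - x) ^ (2 * (n + 3))"
        using energy_flat[OF x fl] by blast
      obtain r where r: "r > 0" "\<And>y. E.rho y < r \<Longrightarrow> energy y \<le> C * norm (y - x) ^ (2 * (n + 3))"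
        using E.nhds_imp_rho[OF C(2)] by blast
      define C' where "C' = exp (2 * real n) * C * \<kappa> ^ (2 * (n + 3))"
      have C': "C' \<ge> 0" using C \<kappa> by (simp add: C'_def)
      have inner: "e y * energy y \<le> C' * (E.sq y) ^ 3" if y: "y \<noteq> x" "E.rho y < r" "E.rho y < R'" for y
      proof -
        have s: "E.sq y > 0" using y E.sq_pos by blast
        have "K * E.rho y \<le> K * R" using K y R' by (intro mult_left_mono) auto
        then have "K * E.rho y \<le> 1" using K by linarith
        then have "2 * real n * (K * E.rho y) \<le> 2 * real n * 1" by (intro mult_left_mono) auto
        then have "exp (2 * real n * (K * E.rho y)) \<le> exp (2 * real n)" by simp
        moreover have "e y = exp (2 * real n * (K * E.rho y)) / (E.sq y) ^ n"
        proof -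
          have "- 2 * real n * E.psi K y = 2 * real n * (K * E.rho y) - real n * ln (E.sq y)"
            by (simp add: E.psi_def E.rho_def algebra_simps)
          moreover have "exp (real n * ln (E.sq y)) = (E.sq y) ^ n" using s by (simp add: exp_of_nat_mult)
          ultimately show ?thesis unfolding e_def by (simp add: exp_diff)
        qed
        ultimately have ey: "e y \<le> exp (2 * real n) / (E.sq y) ^ n" using s by (simp add: divide_right_mono)
        have "norm (y - x) ^ (2 * (n + 3)) \<le> (\<kappa> * E.rho y) ^ (2 * (n + 3))"
          by (rule power_mono[OF \<kappa>(2)]) simp
        also have "\<dots> = \<kappa> ^ (2 * (n + 3)) * (E.sq y) ^ (n + 3)"
          unfolding power_mult_distrib power_mult[of "E.rho y"] using E.rho_sq[of y] by (simp add: power2_eq_square)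
        finally have "energy y \<le> C * (\<kappa> ^ (2 * (n + 3)) * (E.sq y) ^ (n + 3))"
          using r(2)[OF y(2)] C(1) mult_left_mono order_trans by blast
        then have "e y * energy y \<le> (exp (2 * real n) / (E.sq y) ^ n) * (C * (\<kappa> ^ (2 * (n + 3)) * (E.sq y) ^ (n + 3)))"
          using ey s energy_nonneg by (intro mult_mono) auto
        also have "\<dots> = C' * (E.sq y) ^ 3" using s by (simp add: C'_def power_add)
        finally show ?thesis .
      qed
      have "(real n - M) * (e\<sigma> * v) \<le> 2 * (m * B * C' * 8) * vol * \<tau> + 2 * (m * (B / \<sigma>\<^sup>2) * (e\<sigma> * m)) * vol"
        if \<tau>: "0 < \<tau>" "\<tau> < min \<tau>0 (r\<^sup>2 / 4)" for \<tau>
      proof -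
        have \<tau>\<sigma>: "2 * \<tau> < \<sigma>" using \<tau> \<tau>0 by simp
        obtain \<theta> where s\<theta>: "smooth_on UNIV \<theta>"
          and \<theta>0: "\<And>y. E.sq y < \<tau> \<or> E.sq y > 2 * \<sigma> \<Longrightarrow> \<theta> y = 0"
          and \<theta>1: "\<And>y. 2 * \<tau> \<le> E.sq y \<and> E.sq y \<le> \<sigma> \<Longrightarrow> \<theta> y = 1"
          and \<theta>A: "\<And>y. \<exists>A. (\<forall>i. partial_deriv i \<theta> y = A * partial_deriv i E.sq y)
           \<and> A\<^sup>2 \<le> (if \<tau> \<le> E.sq y \<and> E.sq y \<le> 2 * \<tau> then B / \<tau>\<^sup>2 else if \<sigma> \<le> E.sq y \<and> E.sq y \<le> 2 * \<sigma> then B / \<sigma>\<^sup>2 else 0)"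
          using cutoff[OF \<tau>(1) \<tau>\<sigma>] unfolding E.annular_cutoff_def by blast
        define S where "S = {y. \<tau> \<le> E.sq y \<and> E.sq y \<le> 2 * \<sigma>}"
        have S: "compact S" unfolding S_def by (rule E.compact_annulus[OF \<tau>(1)])
        have Snx: "y \<noteq> x" if "y \<in> S" for y
        proof -
          have "E.sq y > 0" using that \<tau> by (auto simp: S_def)
          then show ?thesis using E.rho_sq[of x] by (auto simp: E.rho_x0)
        qed
        have SR: "S \<subseteq> {y. 0 < E.rho y \<and> E.rho y < R}"
          using Snx E.rho_pos small R' by (force simp: S_def)
        have SD: "S \<subseteq> D"
        proof
          fix y assume "y \<in> S"
          then have "E.rho y < R'" using small by (auto simp: S_def)
          then have "\<kappa> * E.rho y \<le> \<kappa> * R'" using \<kappa> by (intro mult_left_mono) auto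
          then show "y \<in> D" using \<kappa>(2)[of y] by (simp add: D_def dist_norm norm_minus_commute)
        qed
        have \<theta>S: "\<theta> y = 0" if "y \<notin> S" for y using that \<theta>0[of y] by (auto simp: S_def)
        let ?X = "\<lambda>y. (D1 \<theta> y + a y * D2 \<theta> y)\<^sup>2 + (b y * D2 \<theta> y)\<^sup>2"
        let ?c = "m * B * C' * 8 * \<tau> + m * (B / \<sigma>\<^sup>2) * (e\<sigma> * m)"
        have c0: "?c \<ge> 0" using m B C' \<tau> e\<sigma> by (intro add_nonneg_nonneg mult_nonneg_nonneg divide_nonneg_nonneg) auto
        have e0: "e y \<ge> 0" for y by (simp add: e_def)
        have pt: "e y * (?X y * energy y) \<le> ?c * indicator D y" for y
        proof (cases "y \<in> S")
          case False
          have "partial_deriv i \<theta> y = 0" for i by (rule partial_zero_outside[OF S \<theta>S False])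
          then show ?thesis using c0 by (simp add: indicator_def)
        next
          case True
          have yx: "y \<noteq> x" and yR: "E.rho y < R'" and yD: "y \<in> D" using Snx[OF True] small SD True by (auto simp: S_def)
          have g: "\<bar>?g y\<bar> \<le> m" and en: "energy y \<le> m" using R1(2)[of y] yR R' by auto
          obtain A where A: "\<And>i. partial_deriv i \<theta> y = A * partial_deriv i E.sq y"
            "A\<^sup>2 \<le> (if \<tau> \<le> E.sq y \<and> E.sq y \<le> 2 * \<tau> then B / \<tau>\<^sup>2 else if \<sigma> \<le> E.sq y \<and> E.sq y \<le> 2 * \<sigma> then B / \<sigma>\<^sup>2 else 0)"
            using \<theta>A[of y] by blast
          have "?X y = A\<^sup>2 * ?g y" unfolding A(1) by (simp add: power2_eq_square algebra_simps)
          also have "\<dots> \<le> A\<^sup>2 * m" using g by (intro mult_left_mono) auto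
          finally have "e y * (?X y * energy y) \<le> e y * ((A\<^sup>2 * m) * energy y)"
            using e0 energy_nonneg by (intro mult_left_mono mult_right_mono) auto
          also have "\<dots> = m * A\<^sup>2 * (e y * energy y)" by simp
          also have "\<dots> \<le> ?c"
          proof -
            have n1: "m * B * C' * 8 * \<tau> \<ge> 0" "m * (B / \<sigma>\<^sup>2) * (e\<sigma> * m) \<ge> 0"
              using m B C' \<tau> e\<sigma> by (intro mult_nonneg_nonneg divide_nonneg_nonneg; simp)+
            consider (inside) "\<tau> \<le> E.sq y" "E.sq y \<le> 2 * \<tau>" | (outside) "\<sigma> \<le> E.sq y" "E.sq y > 2 * \<tau>" "E.sq y \<le> 2 * \<sigma>"
              | (mid) "\<not> (\<tau> \<le> E.sq y \<and> E.sq y \<le> 2 * \<tau>)" "\<not> (\<sigma> \<le> E.sq y \<and> E.sq y \<le> 2 * \<sigma>)"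
              using \<tau>\<sigma> by argo
            then show ?thesis
            proof cases
              case inside
              have "E.rho y < r"
              proof (rule power2_less_imp_less)
                have "(E.rho y)\<^sup>2 = E.sq y" using E.rho_sq[of y] by (simp add: power2_eq_square)
                also have "\<dots> < r\<^sup>2" using inside \<tau> by simp
                finally show "(E.rho y)\<^sup>2 < r\<^sup>2" .
              qed (use r in simp)
              then have "e y * energy y \<le> C' * (E.sq y) ^ 3" by (rule inner[OF yx _ yR])
              also have "\<dots> \<le> C' * (2 * \<tau>) ^ 3" using inside C' E.sq_nonneg by (intro mult_left_mono power_mono) auto
              finally have en3: "e y * energy y \<le> C' * (2 * \<tau>) ^ 3" .
              have "m * A\<^sup>2 * (e y * energy y) \<le> m * (B / \<tau>\<^sup>2) * (C' * (2 * \<tau>) ^ 3)"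
                by (rule mult_mono[OF mult_left_mono[OF _ m] en3])
                   (use A(2) inside m e0 energy_nonneg B in auto)
              also have "\<dots> = m * B * C' * 8 * \<tau>" using \<tau> by (simp add: field_simps power2_eq_square power3_eq_cube)
              finally show ?thesis using n1 by linarith
            next
              case outside
              have "\<beta>\<^sub>0 \<le> E.psi K y"
              proof -
                have "K * sqrt (E.sq y) \<le> K * R" using yR R' K by (intro mult_left_mono) (auto simp: E.rho_def)
                then have "K * sqrt (E.sq y) \<le> 1" using K by linarith
                then show ?thesis unfolding \<beta>\<^sub>0_def E.psi_def
                  using outside \<sigma> by (intro ln_minus_sqrt_mono K)
              qed
              then have "e y \<le> e\<sigma>" unfolding e_def e\<sigma>_def by (simp add: mult_left_mono)
              then have en\<sigma>: "e y * energy y \<le> e\<sigma> * m" using en energy_nonneg e\<sigma> by (intro mult_mono) auto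
              have "m * A\<^sup>2 * (e y * energy y) \<le> m * (B / \<sigma>\<^sup>2) * (e\<sigma> * m)"
                by (rule mult_mono[OF mult_left_mono[OF _ m] en\<sigma>])
                   (use A(2) outside m e0 energy_nonneg B in auto)
              then show ?thesis using n1 by linarith
            next
              case mid
              then have "A\<^sup>2 \<le> 0" using A(2) by (auto split: if_splits)
              then show ?thesis using c0 by simp
            qed
          qed
          finally show ?thesis using yD by simp
        qed
        have SU: "S \<subseteq> U" using SR RU by blast
        have cont: "continuous_on S G" if "smooth_on U G" for G :: "real^2 \<Rightarrow> real"
          using smooth_on_continuous[OF that] SU by (rule continuous_on_subset)
        have c\<theta>: "continuous_on S G" if "smooth_on UNIV G" for G :: "real^2 \<Rightarrow> real"
          using smooth_on_continuous[OF that] by (rule continuous_on_subset) simp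
        have ce: "continuous_on S e"
          unfolding e_def[abs_def]
          by (intro continuous_intros continuous_on_subset[OF smooth_on_continuous[OF E.smooth_psi]]) (use Snx in auto)
        have iX: "integrable lborel (\<lambda>y. e y * (?X y * energy y))"
          by (rule integrable_compact_support[OF S])
             (intro continuous_intros ce c\<theta> cont s\<theta> smooth_on_partial smooth smooth_energy,
              simp add: partial_zero_outside[OF S \<theta>S])
        have iT: "integrable lborel (\<lambda>y. e y * ((\<theta> y)\<^sup>2 * energy y))"
          by (rule integrable_compact_support[OF S])
             (intro continuous_intros ce c\<theta> cont s\<theta> smooth_energy, simp add: \<theta>S)
        have "(\<integral>y. e y * (?X y * energy y) \<partial>lborel) \<le> (\<integral>y. ?c * indicator D y \<partial>lborel)"
          by (intro integral_mono iX pt integrable_mult_right integrable_real_indicator emeasure_compact_finite)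
             (auto simp: D_def)
        also have "\<dots> = ?c * vol" by (simp add: vol_def D_def)
        finally have up: "(\<integral>y. e y * (?X y * energy y) \<partial>lborel) \<le> ?c * vol" .
        have "e\<sigma> * v = (\<integral>y. (e\<sigma> * (energy z / 2)) * indicator (ball z d) y \<partial>lborel)"
          by (simp add: v_def)
        also have "\<dots> \<le> (\<integral>y. e y * ((\<theta> y)\<^sup>2 * energy y) \<partial>lborel)"
        proof (rule integral_mono[OF _ iT])
          show "integrable lborel (\<lambda>y. (e\<sigma> * (energy z / 2)) * indicator (ball z d) y)"
            by (intro integrable_mult_right integrable_real_indicator emeasure_bounded_finite) auto
          fix y
          show "(e\<sigma> * (energy z / 2)) * indicator (ball z d) y \<le> e y * ((\<theta> y)\<^sup>2 * energy y)"
          proof (cases "y \<in> ball z d")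
            case True
            note dy = d(2)[OF True]
            have "\<theta> y = 1" using \<theta>1[of y] dy \<tau> by auto
            moreover have "e\<sigma> \<le> e y"
            proof -
              have "E.psi K y \<le> \<beta>\<^sub>0" unfolding \<beta>\<^sub>0_def E.psi_def
                using dy \<tau>0 by (intro ln_minus_sqrt_mono K K\<sigma>) auto
              then show ?thesis unfolding e_def e\<sigma>_def by (simp add: mult_left_mono)
            qed
            moreover have "e\<sigma> * (energy z / 2) \<le> e y * energy y"
              using \<open>e\<sigma> \<le> e y\<close> dy ez e0 by (intro mult_mono) auto
            ultimately show ?thesis using True by simp
          qed (simp add: e0 energy_nonneg)
        qed
        finally have low: "e\<sigma> * v \<le> (\<integral>y. e y * ((\<theta> y)\<^sup>2 * energy y) \<partial>lborel)" .
        have "(real n - M) * (e\<sigma> * v) \<le> (real n - M) * (\<integral>y. e y * ((\<theta> y)\<^sup>2 * energy y) \<partial>lborel)"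
          using low n by (intro mult_left_mono) auto
        also have "\<dots> \<le> 2 * (\<integral>y. e y * (?X y * energy y) \<partial>lborel)"
          unfolding e_def using est[unfolded cutoff_estimate_def, rule_format, of "real n" S \<theta>] S SR smooth_on_subset[OF s\<theta>] \<theta>S by simp
        also have "\<dots> \<le> 2 * (?c * vol)" using up by simp
        finally show ?thesis by (simp add: algebra_simps)
      qed
      then have "(real n - M) * (e\<sigma> * v) \<le> 2 * (m * (B / \<sigma>\<^sup>2) * (e\<sigma> * m)) * vol"
        by (rule le_of_small_perturbation[of "min \<tau>0 (r\<^sup>2 / 4)", rotated]) (use \<tau>0 r in auto)
      then have "e\<sigma> * ((real n - M) * v) \<le> e\<sigma> * (2 * (m * (B / \<sigma>\<^sup>2) * m) * vol)"
        by (simp add: algebra_simps)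
      then show ?thesis using e\<sigma> by (simp only: mult_le_cancel_left_pos)
    qed
    obtain n :: nat where n: "real n > M + 2 * (m * (B / \<sigma>\<^sup>2) * m) * vol / v" "real n \<ge> M"
      using reals_Archimedean2[of "max M (M + 2 * (m * (B / \<sigma>\<^sup>2) * m) * vol / v)"] by auto
    have "2 * (m * (B / \<sigma>\<^sup>2) * m) * vol < (real n - M) * v"
      using n(1) unfolding pos_divide_less_eq[OF v, symmetric] by linarith
    with bound[OF n(2)] show False by linarith
  qed
  have "flat 1 x f" by (rule fl)
  then have fx: "f x = 0" by simp
  have "\<forall>\<^sub>F y in nhds x. E.sq y < \<sigma>"
  proof -
    have "isCont E.sq x" using smooth_on_continuous[OF E.smooth_sq[OF open_UNIV]]
      by (auto simp: continuous_on_eq_continuous_at)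
    then have "(E.sq \<longlongrightarrow> E.sq x) (nhds x)" by (simp add: tendsto_nhds_iff isCont_def)
    moreover have "E.sq x < \<sigma>" using E.rho_sq[of x] \<sigma> by (simp add: E.rho_x0)
    ultimately show ?thesis by (rule order_tendstoD)
  qed
  then show ?thesis
  proof eventually_elim
    case (elim y)
    show ?case
    proof (cases "y = x")
      case False
      have "energy y = 0" by (rule zero[OF False elim])
      then have "(f y)\<^sup>2 \<le> 0" unfolding energy_def
        by (metis add.assoc add_nonneg_nonneg le_add_same_cancel1 zero_le_power2)
      then show ?thesis by simp
    qed (simp add: fx)
  qed
qed

theorem critical_zeros_accumulate:
  assumes x: "x \<in> U" and lim: "x islimpt {u \<in> U. f u = 0 \<and> f1 u = 0 \<and> f2 u = 0}"
  shows "\<forall>\<^sub>F y in nhds x. f y = 0"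
  by (rule strong_unique_continuation[OF x]) (rule flat_all[OF x lim])+

end

section \<open>Straightening a regular level set\<close>

lemma partial_compose_sum:
  fixes T :: "real^2 \<Rightarrow> real^2" and H :: "real^2 \<Rightarrow> real"
  assumes T: "T differentiable (at u)" and H: "H differentiable (at (T u))"
  shows "partial_deriv m (\<lambda>x. H (T x)) u = (\<Sum>k\<in>UNIV. partial_deriv k H (T u) * partial_deriv m (\<lambda>x. T x $ k) u)"
proof -
  let ?D = "frechet_derivative T (at u)" and ?D' = "frechet_derivative H (at (T u))"
  have D: "(T has_derivative ?D) (at u)" and D': "(H has_derivative ?D') (at (T u))"
    using T H by (simp_all add: differentiable_has_derivative)
  have l: "linear ?D'" by (rule has_derivative_linear[OF D'])
  have nth: "partial_deriv m (\<lambda>x. T x $ k) u = ?D (axis m 1) $ k" for k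
    by (rule partial_deriv_eqI[OF bounded_linear.has_derivative[OF bounded_linear_vec_nth D]])
  have "partial_deriv m (\<lambda>x. H (T x)) u = ?D' (?D (axis m 1))"
    by (rule partial_deriv_eqI[OF has_derivative_compose[OF D D']])
  also have "?D (axis m 1) = ?D (axis m 1) $ 1 *\<^sub>R axis 1 1 + ?D (axis m 1) $ 2 *\<^sub>R axis 2 1"
    by (simp add: vec2_eq_iff axis_def)
  also have "?D' \<dots> = ?D (axis m 1) $ 1 * D1 H (T u) + ?D (axis m 1) $ 2 * D2 H (T u)"
    by (simp add: linear_add[OF l] linear_scale[OF l] partial_deriv_def)
  finally show ?thesis by (simp add: sum_2 nth mult.commute)
qed

lemma partial_deriv_nth: "partial_deriv m (\<lambda>x. x $ k) u = (if m = k then 1 else 0)"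
proof -
  have "((\<lambda>x::real^2. x $ k) has_derivative (\<lambda>h. h $ k)) (at u)"
    by (rule bounded_linear_imp_has_derivative[OF bounded_linear_vec_nth])
  from partial_deriv_eqI[OF this, of m] show ?thesis by (simp add: axis_def)
qed

text \<open>The coordinates \<open>(u\<^sub>j, F u)\<close>, in which the zero set of \<open>F\<close> is the first axis.\<close>

definition straighten :: "2 \<Rightarrow> (real^2 \<Rightarrow> real) \<Rightarrow> real^2 \<Rightarrow> real^2" where
  "straighten j F u = (\<chi> k. if k = 1 then u $ j else F u)"

lemma smooth_straighten:
  assumes "open U" "smooth_on U F"
  shows "smooth_on U (straighten j F)"
proof (rule smooth_on_vec2[OF assms(1)])
  fix k :: 2
  show "smooth_on U (\<lambda>u. straighten j F u $ k)"
    using exhaust_2[of k] assms smooth_on_linear[OF assms(1) bounded_linear_vec_nth[of j]]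
    by (auto simp: straighten_def)
qed

text \<open>The inverse function theorem gives a differentiable inverse \<open>S\<close>. One component of \<open>S\<close> is
  a coordinate, and the partial derivatives of the other one are rational expressions in the partial derivatives of
  \<open>F\<close> at \<open>S y\<close>. So if \<open>S\<close> is of class \<open>C\<^sup>k\<close>, its derivatives are too, and \<open>S\<close> is smooth by
  induction.\<close>

lemma straightening_coordinates:
  assumes U: "open U" and F: "smooth_on U F" and u0: "u0 \<in> U" and i: "partial_deriv i F u0 \<noteq> 0" and ij: "i \<noteq> j"
  obtains U' V S where "open U'" "U' \<subseteq> U" "u0 \<in> U'" "open V" "homeomorphism U' V (straighten j F) S"
    "smooth_on U' (straighten j F)" "smooth_on V S" "\<And>u. u \<in> U' \<Longrightarrow> partial_deriv i F u \<noteq> 0"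
proof -
  let ?T = "straighten j F" and ?D = "\<lambda>u. frechet_derivative (straighten j F) (at u)"
  define U0 where "U0 = {u \<in> U. partial_deriv i F u \<noteq> 0}"
  have U0: "open U0" "U0 \<subseteq> U" "u0 \<in> U0"
  proof -
    have "U0 = U \<inter> partial_deriv i F -` (- {0})" by (auto simp: U0_def)
    then show "open U0"
      using smooth_on_continuous[OF smooth_on_partial[OF F]] U
      by (simp add: continuous_open_preimage open_Compl)
  qed (use u0 i in \<open>auto simp: U0_def\<close>)
  have F0: "smooth_on U0 F" using F U0(2) by (rule smooth_on_subset)
  have T: "smooth_on U0 ?T" by (rule smooth_straighten[OF U0(1) F0])
  have D: "(?T has_derivative ?D u) (at u)" if "u \<in> U0" for u
    using T that by (intro differentiable_has_derivative) (rule smooth_on_differentiable)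
  have bl: "bounded_linear (?D u)" if "u \<in> U0" for u using D[OF that] by (rule has_derivative_bounded_linear)
  have D1: "?D u h $ 1 = h $ j" if "u \<in> U0" for u h
  proof -
    have "((\<lambda>u. u $ j) has_derivative (\<lambda>h. ?D u h $ 1)) (at u)"
      using bounded_linear.has_derivative[OF bounded_linear_vec_nth[of 1] D[OF that]] by (simp add: straighten_def)
    moreover have "((\<lambda>u. u $ j) has_derivative (\<lambda>h. h $ j)) (at u)"
      by (rule bounded_linear_imp_has_derivative[OF bounded_linear_vec_nth])
    ultimately show ?thesis by (metis has_derivative_unique)
  qed
  have D2: "?D u h $ 2 = frechet_derivative F (at u) h" if "u \<in> U0" for u h
  proof -
    have "(F has_derivative (\<lambda>h. ?D u h $ 2)) (at u)"
      using bounded_linear.has_derivative[OF bounded_linear_vec_nth[of 2] D[OF that]] by (simp add: straighten_def)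
    then show ?thesis by (metis frechet_derivative_at)
  qed
  define f' where "f' u = Blinfun (?D u)" for u
  have f': "blinfun_apply (f' u) = ?D u" if "u \<in> U0" for u
    unfolding f'_def by (rule bounded_linear_Blinfun_apply[OF bl[OF that]])
  have contf: "continuous_on U0 f'"
  proof (rule continuous_on_blinfun_componentwise)
    fix v :: "real^2" assume v: "v \<in> Basis"
    have "continuous_on U0 (\<lambda>u. ?D u v)" by (rule smooth_on_continuous[OF smooth_on_frechet[OF T v]])
    then show "continuous_on U0 (\<lambda>u. blinfun_apply (f' u) v)"
      by (rule continuous_on_eq) (simp add: f')
  qed
  have lin: "linear (?D u0)" using bl[OF U0(3)] by (rule bounded_linear.linear)
  have "inj (?D u0)"
  proof (rule linear_injective_0[OF lin, THEN iffD2], intro allI impI)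
    fix h assume h: "?D u0 h = 0"
    have hj: "h $ j = 0" using D1[OF U0(3), of h] h by simp
    have "h = h $ i *\<^sub>R axis i 1"
      using hj ij exhaust_2[of i] exhaust_2[of j] by (auto simp: vec2_eq_iff axis_def)
    then have "?D u0 h = h $ i *\<^sub>R ?D u0 (axis i 1)" by (metis linear_scale[OF lin])
    then have "h $ i * partial_deriv i F u0 = 0"
      using h D2[OF U0(3), of "axis i 1"] by (metis partial_deriv_def real_scaleR_def scaleR_zero_right vector_scaleR_component zero_index)
    then show "h = 0" using i hj ij exhaust_2[of i] exhaust_2[of j] by (auto simp: vec2_eq_iff)
  qed
  then obtain g where g: "linear g" "g \<circ> ?D u0 = id" using linear_injective_left_inverse[OF lin] by blast
  have "Blinfun g o\<^sub>L f' u0 = id_blinfun"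
  proof (rule blinfun_eqI)
    fix h
    have "blinfun_apply (Blinfun g) = g"
      using g(1) by (intro bounded_linear_Blinfun_apply) (simp add: linear_conv_bounded_linear)
    then show "blinfun_apply (Blinfun g o\<^sub>L f' u0) h = blinfun_apply id_blinfun h"
      using g(2) by (simp add: f'[OF U0(3)] fun_eq_iff)
  qed
  from inverse_function_theorem[OF U0(1) _ contf U0(3) this] D f'
  obtain U' V S S' where S: "open U'" "U' \<subseteq> U0" "u0 \<in> U'" "open V" "homeomorphism U' V ?T S"
    "\<And>y. y \<in> V \<Longrightarrow> (S has_derivative S' y) (at y)"
    by metis
  have SV: "S ` V \<subseteq> U0" using S(2,5) by (auto simp: homeomorphism_def)
  have TS: "?T (S y) = y" if "y \<in> V" for y using S(5) that by (auto simp: homeomorphism_def)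
  have Sj: "S y $ j = y $ 1" and FS: "F (S y) = y $ 2" if "y \<in> V" for y
    using TS[OF that] by (auto simp: straighten_def vec2_eq_iff)
  have dS: "S differentiable (at y)" if "y \<in> V" for y using S(6)[OF that] by (rule differentiableI)
  have dSk: "(\<lambda>y. S y $ k) differentiable (at y)" if "y \<in> V" for y k
    using bounded_linear.has_derivative[OF bounded_linear_vec_nth S(6)[OF that]] by (rule differentiableI)
  have pSj: "partial_deriv m (\<lambda>y. S y $ j) y = (if m = 1 then 1 else 0)" if "y \<in> V" for y m
    using partial_deriv_cong[OF S(4) that Sj, where i=m] by (simp add: partial_deriv_nth)
  have pSi: "partial_deriv m (\<lambda>y. S y $ i) y =
      ((if m = 2 then 1 else 0) - (if m = 1 then 1 else 0) * partial_deriv j F (S y)) / partial_deriv i F (S y)"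
    if y: "y \<in> V" for y m
  proof -
    have Sy: "S y \<in> U0" using SV y by blast
    have "partial_deriv m (\<lambda>y. F (S y)) y = (if m = 2 then 1 else 0)"
      using partial_deriv_cong[OF S(4) y FS, where i=m] by (simp add: partial_deriv_nth)
    moreover have "partial_deriv m (\<lambda>y. F (S y)) y =
       partial_deriv i F (S y) * partial_deriv m (\<lambda>y. S y $ i) y + partial_deriv j F (S y) * partial_deriv m (\<lambda>y. S y $ j) y"
      using partial_compose_sum[OF dS[OF y] smooth_on_differentiable[OF F0 Sy], where m=m] ij exhaust_2[of i] exhaust_2[of j]
      by (auto simp: sum_2)
    moreover have "partial_deriv i F (S y) \<noteq> 0" using Sy by (simp add: U0_def)
    ultimately show ?thesis by (simp add: pSj[OF y] field_simps)
  qed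
  have "Ck_on k V S" for k
  proof (induction k)
    case 0
    show ?case using S(5) by (simp add: homeomorphism_def)
  next
    case (Suc k)
    have comp: "Ck_on k V (\<lambda>y. G (S y))" if "smooth_on U0 G" for G :: "real^2 \<Rightarrow> real"
      by (rule Ck_on_compose[OF S(4) U0(1) SV smooth_on_Ck[OF that] Suc])
    have pF: "Ck_on k V (\<lambda>y. partial_deriv l F (S y))" for l by (rule comp[OF smooth_on_partial[OF F0]])
    have nz: "partial_deriv i F (S y) \<noteq> 0" if "y \<in> V" for y using SV that by (auto simp: U0_def)
    show ?case
    proof (rule Ck_on_vec2[OF S(4)])
      fix l
      have "l = i \<or> l = j" using ij exhaust_2[of i] exhaust_2[of j] exhaust_2[of l] by auto
      then show "Ck_on (Suc k) V (\<lambda>y. S y $ l)"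
      proof
        assume l: "l = i"
        show ?thesis unfolding l
        proof (rule Ck_on_SucI_partial[OF S(4) dSk])
          show "Ck_on k V (partial_deriv m (\<lambda>y. S y $ i))" for m
          proof (rule Ck_on_cong[OF S(4)])
            show "Ck_on k V (\<lambda>y. ((if m = 2 then 1 else 0) - (if m = 1 then 1 else 0) * partial_deriv j F (S y)) / partial_deriv i F (S y))"
              by (intro Ck_on_divide Ck_on_diff Ck_on_mult Ck_on_const S(4) pF nz)
          qed (simp add: pSi)
        qed
      next
        assume l: "l = j"
        show ?thesis unfolding l
          by (rule Ck_on_cong[OF S(4) Ck_on_linear[OF S(4) bounded_linear_vec_nth[of 1]]]) (simp add: Sj)
      qed
    qed
  qed
  then have "smooth_on V S" by (simp add: smooth_on_def)
  moreover have "smooth_on U' ?T" using T S(2) by (rule smooth_on_subset)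
  moreover have "partial_deriv i F u \<noteq> 0" if "u \<in> U'" for u using that S(2) by (auto simp: U0_def)
  ultimately show thesis using that[OF S(1) _ S(3,4,5)] S(2) U0(2) by blast
qed

section \<open>The equation in coordinates\<close>

lemma inner_product_matrix_entries:
  assumes "inner_product_matrix B"
  shows "B $ 2 $ 1 = B $ 1 $ 2" "B $ 2 $ 2 > 0" "det B > 0"
proof -
  have "transpose B $ 1 $ 2 = B $ 1 $ 2" using assms by (simp add: inner_product_matrix_def)
  then show "B $ 2 $ 1 = B $ 1 $ 2" by (simp add: transpose_def)
  have "axis 2 1 \<bullet> (B *v axis 2 1) > 0" using assms by (simp add: inner_product_matrix_def axis_eq_0_iff)
  then show "B $ 2 $ 2 > 0" by (simp add: inner_vec_def sum_2 matrix_vector_2 axis_def)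
qed (rule inner_product_matrix_det[OF assms])

text \<open>Multiplied by \<open>\<surd>det G\<close>, the Laplacian is \<open>\<partial>\<^sub>1 (\<alpha> F\<^sub>1 - \<gamma> F\<^sub>2) + \<partial>\<^sub>2 (\<delta> F\<^sub>2 - \<gamma> F\<^sub>1)\<close> with
  \<open>\<alpha> \<delta> - \<gamma>\<^sup>2 = 1\<close>. In dimension two the conformal factor drops out of the principal part, and
  \<open>a = - \<gamma> / \<alpha>\<close>, \<open>b = 1 / \<alpha>\<close> satisfy \<open>a\<^sup>2 + b\<^sup>2 = \<delta> / \<alpha>\<close>.\<close>

lemma elliptic_equation_of_witten:
  assumes U: "open U" and G: "smooth_on U G" "\<And>u. u \<in> U \<Longrightarrow> inner_product_matrix (G u)"
    and sm: "smooth_on U \<Phi>" "smooth_on U H" "smooth_on U F"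
    and eq: "\<And>u. u \<in> U \<Longrightarrow> coord_laplacian G F u - coord_grad_inner G \<Phi> F u + H u * F u = 0"
  shows "\<exists>a b k1 k2 k3. elliptic_equation U a b k1 k2 k3 F"
proof -
  define g11 g12 g22 where "g11 u = G u $ 1 $ 1" and "g12 u = G u $ 1 $ 2" and "g22 u = G u $ 2 $ 2" for u
  have sg: "smooth_on U g11" "smooth_on U g12" "smooth_on U g22"
    unfolding g11_def[abs_def] g12_def[abs_def] g22_def[abs_def] by (intro smooth_on_nth U G(1))+
  define dt where "dt u = g11 u * g22 u - g12 u * g12 u" for u
  have dt: "det (G u) = dt u" "dt u > 0" "g22 u > 0" "G u $ 2 $ 1 = g12 u" if "u \<in> U" for u
    using inner_product_matrix_entries[OF G(2)[OF that]]
    by (simp_all add: det_2 dt_def g11_def g12_def g22_def)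
  note nz = dt(2)[THEN less_imp_neq, symmetric] dt(3)[THEN less_imp_neq, symmetric]
  define S where "S u = sqrt (dt u)" for u
  have S: "S u > 0" "S u * S u = dt u" if "u \<in> U" for u using dt(2)[OF that] by (simp_all add: S_def)
  note Snz = S(1)[THEN less_imp_neq, symmetric]
  have sdt: "smooth_on U dt" unfolding dt_def[abs_def] by (intro smooth_on_diff smooth_on_mult sg U)
  have sS: "smooth_on U S" unfolding S_def[abs_def] by (rule smooth_on_sqrt[OF U sdt dt(2)])
  define \<alpha> \<gamma> \<delta> where "\<alpha> u = g22 u / S u" and "\<gamma> u = g12 u / S u" and "\<delta> u = g11 u / S u" for u
  have sabc: "smooth_on U \<alpha>" "smooth_on U \<gamma>" "smooth_on U \<delta>"
    unfolding \<alpha>_def[abs_def] \<gamma>_def[abs_def] \<delta>_def[abs_def] by (intro smooth_on_divide sg sS U Snz | assumption)+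
  have \<alpha>: "\<alpha> u > 0" if "u \<in> U" for u using dt(3)[OF that] S(1)[OF that] by (simp add: \<alpha>_def)
  note \<alpha>nz = \<alpha>[THEN less_imp_neq, symmetric]
  have det1: "\<alpha> u * \<delta> u - \<gamma> u * \<gamma> u = 1" if "u \<in> U" for u
  proof -
    have "\<alpha> u * \<delta> u - \<gamma> u * \<gamma> u = dt u / (S u * S u)" by (simp add: \<alpha>_def \<gamma>_def \<delta>_def dt_def diff_divide_distrib mult.commute)
    then show ?thesis using S(2)[OF that] nz(1)[OF that] by simp
  qed
  note grad = coord_grad_2[of G]
  define e1 e2 where "e1 u = (g22 u * D1 \<Phi> u - g12 u * D2 \<Phi> u) / dt u"
    and "e2 u = (g11 u * D2 \<Phi> u - g12 u * D1 \<Phi> u) / dt u" for u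
  have se: "smooth_on U e1" "smooth_on U e2"
    unfolding e1_def[abs_def] e2_def[abs_def]
    by (intro smooth_on_divide smooth_on_diff smooth_on_mult smooth_on_partial sg sm sdt U nz | assumption)+
  define k1 where "k1 u = (S u * e1 u - (D1 \<alpha> u - D2 \<gamma> u)) / \<alpha> u" for u
  define k2 where "k2 u = (S u * e2 u - (D2 \<delta> u - D1 \<gamma> u)) / \<alpha> u" for u
  define k3 where "k3 u = (0 - S u * H u) / \<alpha> u" for u
  define a where "a u = (0 - \<gamma> u) / \<alpha> u" for u
  define b where "b u = 1 / \<alpha> u" for u
  note smr = smooth_on_divide[OF U _ _ \<alpha>nz] smooth_on_diff[OF U] smooth_on_mult[OF U] smooth_on_const[OF U]
    smooth_on_partial sabc se sS sm
  have "elliptic_equation U a b k1 k2 k3 F"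
  proof
    show "open U" by (rule U)
    show "smooth_on U a" "smooth_on U b" "smooth_on U k1" "smooth_on U k2" "smooth_on U k3" "smooth_on U F"
      unfolding a_def[abs_def] b_def[abs_def] k1_def[abs_def] k2_def[abs_def] k3_def[abs_def]
      by (intro smr | assumption)+
    fix u assume u: "u \<in> U"
    show "b u > 0" using \<alpha>[OF u] by (simp add: b_def)
    let ?F1 = "D1 F" and ?F2 = "D2 F"
    have X1: "sqrt (det (G v)) * coord_grad G F v $ 1 = \<alpha> v * ?F1 v - \<gamma> v * ?F2 v" if v: "v \<in> U" for v
    proof -
      have "coord_grad G F v $ 1 = (g22 v * ?F1 v - g12 v * ?F2 v) / (S v * S v)"
        using grad(1)[of v F] nz(1)[OF v] S(2)[OF v] unfolding dt(1)[OF v] by (simp add: g22_def g12_def)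
      moreover have ring: "s * ((x - y) / (s * s)) = x / s - y / s" if "s \<noteq> 0" for s x y :: real
        using that by (simp add: diff_divide_distrib right_diff_distrib)
      ultimately show ?thesis
        unfolding dt(1)[OF v] S_def[symmetric] \<alpha>_def \<gamma>_def by (simp only: times_divide_eq_left ring[OF Snz[OF v]])
    qed
    have X2: "sqrt (det (G v)) * coord_grad G F v $ 2 = \<delta> v * ?F2 v - \<gamma> v * ?F1 v" if v: "v \<in> U" for v
    proof -
      have "coord_grad G F v $ 2 = (g11 v * ?F2 v - g12 v * ?F1 v) / (S v * S v)"
        using grad(2)[of v F] nz(1)[OF v] S(2)[OF v] unfolding dt(1)[OF v] by (simp add: g11_def dt(4)[OF v])
      moreover have ring: "s * ((x - y) / (s * s)) = x / s - y / s" if "s \<noteq> 0" for s x y :: real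
        using that by (simp add: diff_divide_distrib right_diff_distrib)
      ultimately show ?thesis
        unfolding dt(1)[OF v] S_def[symmetric] \<delta>_def \<gamma>_def by (simp only: times_divide_eq_left ring[OF Snz[OF v]])
    qed
    note d = smooth_on_differentiable[OF _ u]
    have dF: "?F1 differentiable (at u)" "?F2 differentiable (at u)" by (intro d smooth_on_partial sm)+
    note dabc = d[OF sabc(1)] d[OF sabc(2)] d[OF sabc(3)]
    have c: "D2 ?F1 u = D1 ?F2 u" by (rule partial_deriv_commute[OF sm(3) U u])
    have P1: "D1 (\<lambda>v. sqrt (det (G v)) * coord_grad G F v $ 1) u
       = D1 \<alpha> u * ?F1 u + \<alpha> u * D1 ?F1 u - (D1 \<gamma> u * ?F2 u + \<gamma> u * D1 ?F2 u)"
      by (rule trans[OF partial_deriv_cong[OF U u X1]]) (assumption, simp add: partial_deriv_diff partial_deriv_mult differentiable_mult dF dabc)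
    have P2: "D2 (\<lambda>v. sqrt (det (G v)) * coord_grad G F v $ 2) u
       = D2 \<delta> u * ?F2 u + \<delta> u * D2 ?F2 u - (D2 \<gamma> u * ?F1 u + \<gamma> u * D1 ?F2 u)"
      by (rule trans[OF partial_deriv_cong[OF U u X2]]) (assumption, simp add: partial_deriv_diff partial_deriv_mult differentiable_mult dF dabc c)
    define Q where "Q = \<alpha> u * D1 ?F1 u - 2 * \<gamma> u * D1 ?F2 u + \<delta> u * D2 ?F2 u"
    have cancel: "S u * (z / S u) = z" for z using Snz[OF u] by simp
    have lap: "S u * coord_laplacian G F u = Q + (D1 \<alpha> u - D2 \<gamma> u) * ?F1 u
       + (D2 \<delta> u - D1 \<gamma> u) * ?F2 u"
      unfolding coord_laplacian_def coord_div_def sum_2 P1 P2 dt(1)[OF u] S_def[symmetric] Q_def cancel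
      by (simp add: algebra_simps)
    have "G u *v coord_grad G F u = (\<chi> j. partial_deriv j F u)"
      using matrix_inv_eq_iff[of "G u"] nz(1)[OF u] dt(1)[OF u] unfolding coord_grad_def by metis
    then have inn: "coord_grad_inner G \<Phi> F u = e1 u * ?F1 u + e2 u * ?F2 u"
      using grad(1)[of u \<Phi>] grad(2)[of u \<Phi>] nz(1)[OF u]
      unfolding coord_grad_inner_def dt(1)[OF u] dt(4)[OF u]
      by (simp add: inner_vec_def sum_2 e1_def e2_def g11_def g12_def g22_def)
    have k: "\<alpha> u * k1 u = S u * e1 u - (D1 \<alpha> u - D2 \<gamma> u)"
      "\<alpha> u * k2 u = S u * e2 u - (D2 \<delta> u - D1 \<gamma> u)"
      "\<alpha> u * k3 u = - (S u * H u)"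
      using \<alpha>nz[OF u] by (simp_all add: k1_def k2_def k3_def)
    have "S u * coord_laplacian G F u = S u * (coord_grad_inner G \<Phi> F u - H u * F u)"
      using eq[OF u] by simp
    then have Q: "Q = (\<alpha> u * k1 u) * ?F1 u + (\<alpha> u * k2 u) * ?F2 u + (\<alpha> u * k3 u) * F u"
      unfolding lap inn k by (simp add: algebra_simps)
    have ab: "\<alpha> u * ((a u)\<^sup>2 + (b u)\<^sup>2) = \<delta> u"
    proof -
      have "\<alpha> u * ((a u)\<^sup>2 + (b u)\<^sup>2) = (\<gamma> u * \<gamma> u + 1) / \<alpha> u"
        using \<alpha>nz[OF u] by (simp add: a_def b_def field_simps power2_eq_square)
      also have "\<gamma> u * \<gamma> u + 1 = \<alpha> u * \<delta> u" using det1[OF u] by linarith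
      finally show ?thesis using \<alpha>nz[OF u] by simp
    qed
    have "\<alpha> u * (D1 ?F1 u + 2 * a u * D1 ?F2 u + ((a u)\<^sup>2 + (b u)\<^sup>2) * D2 ?F2 u) = Q"
    proof -
      have au: "\<alpha> u * a u = - \<gamma> u" using \<alpha>nz[OF u] by (simp add: a_def)
      have e: "\<alpha> u * (x + 2 * a u * y + s * z) = \<alpha> u * x + 2 * (\<alpha> u * a u) * y + (\<alpha> u * s) * z" for x y z s
        by (simp add: algebra_simps)
      show ?thesis unfolding e au ab Q_def by simp
    qed
    then have "\<alpha> u * (D1 ?F1 u + 2 * a u * D1 ?F2 u + ((a u)\<^sup>2 + (b u)\<^sup>2) * D2 ?F2 u)
       = \<alpha> u * (k1 u * ?F1 u + k2 u * ?F2 u + k3 u * F u)"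
      unfolding Q by (simp add: algebra_simps)
    then show "D1 ?F1 u + 2 * a u * D1 ?F2 u + ((a u)\<^sup>2 + (b u)\<^sup>2) * D2 ?F2 u
       = k1 u * ?F1 u + k2 u * ?F2 u + k3 u * F u"
      using \<alpha>nz[OF u] by simp
  qed
  then show ?thesis by blast
qed

section \<open>The nodal set on the surface\<close>

lemma is_chartD:
  assumes c: "is_chart M c"
  shows chart_dom_open: "openin M (chart_dom c)"
    and chart_img_open: "open (chart_img c)"
    and chart_dom_topspace: "chart_dom c \<subseteq> topspace M"
    and chart_inj: "inj_on (chart_map c) (chart_dom c)"
    and chart_inv_map: "\<And>p. p \<in> chart_dom c \<Longrightarrow> chart_inv c (chart_map c p) = p"
    and chart_preimage_open: "\<And>T. open T \<Longrightarrow> openin M {q \<in> chart_dom c. chart_map c q \<in> T}"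
    and chart_image_open: "\<And>Q. \<lbrakk>openin M Q; Q \<subseteq> chart_dom c\<rbrakk> \<Longrightarrow> open (chart_map c ` Q)"
proof -
  show dom: "openin M (chart_dom c)" and img: "open (chart_img c)" using c by (auto simp: is_chart_def)
  show sub: "chart_dom c \<subseteq> topspace M" using dom by (rule openin_subset)
  have hm: "homeomorphic_map (subtopology M (chart_dom c)) (top_of_set (chart_img c)) (chart_map c)"
    using c by (simp add: is_chart_def)
  have ts: "topspace (subtopology M (chart_dom c)) = chart_dom c" using sub by auto
  show inj: "inj_on (chart_map c) (chart_dom c)" using hm unfolding homeomorphic_map_def ts by simp
  show "chart_inv c (chart_map c p) = p" if "p \<in> chart_dom c" for p using inj that by simp
  show "openin M {q \<in> chart_dom c. chart_map c q \<in> T}" if "open T" for T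
  proof -
    have "openin (top_of_set (chart_img c)) (chart_img c \<inter> T)" using that by (rule openin_open_Int)
    then have "openin (subtopology M (chart_dom c)) {q \<in> topspace (subtopology M (chart_dom c)). chart_map c q \<in> chart_img c \<inter> T}"
      using homeomorphic_imp_continuous_map[OF hm] by (intro openin_continuous_map_preimage)
    moreover have "{q \<in> topspace (subtopology M (chart_dom c)). chart_map c q \<in> chart_img c \<inter> T} = {q \<in> chart_dom c. chart_map c q \<in> T}"
      unfolding ts by auto
    ultimately show ?thesis using dom openin_trans_full by metis
  qed
  show "open (chart_map c ` Q)" if "openin M Q" "Q \<subseteq> chart_dom c" for Q
  proof -
    have "openin (subtopology M (chart_dom c)) Q" using that dom by (simp add: openin_open_subtopology)
    then have "openin (top_of_set (chart_img c)) (chart_map c ` Q)"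
      using homeomorphic_imp_open_map[OF hm] unfolding open_map_def by blast
    then show ?thesis using img by (meson openin_open_trans)
  qed
qed

lemma coord_rep_map: "is_chart M c \<Longrightarrow> p \<in> chart_dom c \<Longrightarrow> coord_rep c f (chart_map c p) = f p"
  by (simp add: coord_rep_def chart_inv_map)

text \<open>Asking for a vanishing gradient in all charts of the atlas makes the set usable in
  whichever chart is at hand, and a point outside it still has one chart with a non-zero partial derivative.\<close>

definition critical_zeros :: "'a topology \<Rightarrow> 'a chart set \<Rightarrow> ('a \<Rightarrow> real) \<Rightarrow> 'a set" where
  "critical_zeros M A f = {p \<in> nodal_set M f. \<forall>c\<in>A. p \<in> chart_dom c \<longrightarrow>
     (\<forall>i. partial_deriv i (coord_rep c f) (chart_map c p) = 0)}"

text \<open>Shrink a chart to a set on which \<open>\<partial>\<^sub>i f \<noteq> 0\<close> and straighten \<open>f\<close> there. The new chart contains no critical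
  zeros, and its second coordinate is \<open>f\<close>. Its transition maps are compositions of the old ones
  with the straightening map or its inverse.\<close>

lemma smooth_curve_regular_zeros:
  assumes M: "smooth_surface M A" and f: "smooth_fun A f"
  shows "smooth_curve M A (nodal_set M f - critical_zeros M A f)"
  unfolding smooth_curve_def
proof (intro conjI ballI)
  show "nodal_set M f - critical_zeros M A f \<subseteq> topspace M" by (auto simp: nodal_set_def)
  fix p assume p: "p \<in> nodal_set M f - critical_zeros M A f"
  then obtain c i where c: "c \<in> A" "p \<in> chart_dom c"
    and i: "partial_deriv i (coord_rep c f) (chart_map c p) \<noteq> 0"
    unfolding critical_zeros_def by blast
  have ch: "is_chart M d" if "d \<in> A" for d using M that by (simp add: smooth_surface_def)
  note C = is_chartD[OF ch[OF c(1)]]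
  obtain j :: 2 where ij: "i \<noteq> j" using exhaust_2[of i] by (metis zero_neq_one)
  let ?F = "coord_rep c f" and ?U = "chart_img c" and ?T = "straighten j (coord_rep c f)"
  have F: "smooth_on ?U ?F" using f c(1) by (simp add: smooth_fun_def)
  obtain U V S where U: "open U" "U \<subseteq> ?U" "chart_map c p \<in> U" and V: "open V" and hom: "homeomorphism U V ?T S"
    and T: "smooth_on U ?T" and S: "smooth_on V S" and ne: "\<And>u. u \<in> U \<Longrightarrow> partial_deriv i ?F u \<noteq> 0"
    using straightening_coordinates[OF C(2) F _ i ij] c(2) by blast
  have ST: "S (?T u) = u" "?T u \<in> V" if "u \<in> U" for u using hom that by (auto simp: homeomorphism_def)
  have TS: "?T (S v) = v" "S v \<in> U" if "v \<in> V" for v using hom that by (auto simp: homeomorphism_def)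
  define W where "W = {q \<in> chart_dom c. chart_map c q \<in> U}"
  define e where "e = (W, ?T \<circ> chart_map c)"
  have e: "chart_dom e = W" "\<And>q. chart_map e q = ?T (chart_map c q)" by (simp_all add: e_def)
  have W: "openin M W" unfolding W_def by (rule C(6)[OF U(1)])
  have Wsub: "W \<subseteq> chart_dom c" and pW: "p \<in> W" using U(3) c(2) by (auto simp: W_def)
  have imgc: "chart_map c ` W = U" using U(2) by (auto simp: W_def)
  have imge: "chart_img e = V"
  proof -
    have "chart_img e = ?T ` (chart_map c ` W)" by (auto simp: e image_image)
    then show ?thesis using hom unfolding imgc by (simp add: homeomorphism_def)
  qed
  have "homeomorphic_map (subtopology M W) (top_of_set U) (chart_map c)"
  proof -
    have "homeomorphic_map (subtopology M (chart_dom c)) (top_of_set ?U) (chart_map c)"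
      using ch[OF c(1)] by (simp add: is_chart_def)
    moreover have "chart_map c ` (topspace (subtopology M (chart_dom c)) \<inter> W) = topspace (top_of_set ?U) \<inter> U"
      using imgc Wsub C(3) U(2) by (simp add: Int_absorb1 Int_absorb2)
    ultimately have "homeomorphic_map (subtopology (subtopology M (chart_dom c)) W) (subtopology (top_of_set ?U) U) (chart_map c)"
      by (rule homeomorphic_map_subtopologies)
    then show ?thesis using Wsub U(2) by (simp add: subtopology_subtopology Int_absorb1 Int_absorb2)
  qed
  moreover have "homeomorphic_map (top_of_set U) (top_of_set V) ?T"
    unfolding homeomorphic_map_maps homeomorphic_maps_def
    by (intro exI[of _ S]) (use hom in \<open>auto simp: homeomorphism_def\<close>)
  ultimately have "homeomorphic_map (subtopology M W) (top_of_set V) (?T \<circ> chart_map c)"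
    by (rule homeomorphic_map_compose)
  then have eM: "is_chart M e" unfolding is_chart_def imge using W V by (simp add: e_def)
  note E = is_chartD[OF eM, unfolded e(1)]
  have inve: "chart_inv e v = chart_inv c (S v)" if v: "v \<in> V" for v
  proof -
    obtain q where q: "q \<in> W" "v = chart_map e q" using v imge by (auto simp: e(1))
    have qc: "q \<in> chart_dom c" "chart_map c q \<in> U" using q by (auto simp: W_def)
    have "S v = chart_map c q" using ST(1)[OF qc(2)] by (simp add: q(2) e(2))
    then show ?thesis using E(5)[OF q(1)] C(5)[OF qc(1)] q(2) by (simp add: e(1))
  qed
  have "smoothly_compatible e d" if d: "d \<in> A" for d
    unfolding smoothly_compatible_def
  proof
    note D = is_chartD[OF ch[OF d]]
    have cd: "smooth_on (chart_map c ` (chart_dom c \<inter> chart_dom d)) (transition c d)"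
      "smooth_on (chart_map d ` (chart_dom c \<inter> chart_dom d)) (transition d c)"
      using M c(1) d by (auto simp: smooth_surface_def smoothly_compatible_def)
    have o1: "open (chart_map e ` (chart_dom e \<inter> chart_dom d))"
      by (rule chart_image_open[OF eM]) (use W D(1) in \<open>auto simp: e(1)\<close>)
    have o2: "open (chart_map c ` (chart_dom c \<inter> chart_dom d))"
      by (rule chart_image_open[OF ch[OF c(1)]]) (use C(1) D(1) in auto)
    have o3: "open (chart_map d ` (chart_dom e \<inter> chart_dom d))"
      by (rule chart_image_open[OF ch[OF d]]) (use W D(1) in \<open>auto simp: e(1)\<close>)
    have sub: "chart_map e ` (chart_dom e \<inter> chart_dom d) \<subseteq> V" using imge by auto
    have Se: "S (chart_map e q) = chart_map c q" if "q \<in> W" for q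
      using that ST(1) by (auto simp: e(2) W_def)
    show "smooth_on (chart_map e ` (chart_dom e \<inter> chart_dom d)) (transition e d)"
    proof (rule smooth_on_cong[OF o1])
      show "smooth_on (chart_map e ` (chart_dom e \<inter> chart_dom d)) (\<lambda>v. transition c d (S v))"
        by (rule smooth_on_compose[OF o1 o2 _ cd(1) smooth_on_subset[OF S sub]])
           (use Se Wsub in \<open>auto simp: e(1)\<close>)
      show "transition c d (S v) = transition e d v" if "v \<in> chart_map e ` (chart_dom e \<inter> chart_dom d)" for v
        using inve[of v] sub that by (auto simp: transition_def)
    qed
    have td: "transition d c (chart_map d q) = chart_map c q" "transition d e (chart_map d q) = ?T (chart_map c q)"
      if "q \<in> chart_dom d" for q
      using D(5)[OF that] by (simp_all add: transition_def e(2))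
    show "smooth_on (chart_map d ` (chart_dom e \<inter> chart_dom d)) (transition d e)"
    proof (rule smooth_on_cong[OF o3])
      show "smooth_on (chart_map d ` (chart_dom e \<inter> chart_dom d)) (\<lambda>x. ?T (transition d c x))"
      proof (rule smooth_on_compose[OF o3 U(1) _ T])
        show "transition d c ` (chart_map d ` (chart_dom e \<inter> chart_dom d)) \<subseteq> U"
          using td(1) by (auto simp: e(1) W_def)
        show "smooth_on (chart_map d ` (chart_dom e \<inter> chart_dom d)) (transition d c)"
          by (rule smooth_on_subset[OF cd(2)]) (use Wsub in \<open>auto simp: e(1)\<close>)
      qed
    qed (use td in auto)
  qed
  then have "smooth_chart M A e" using eM by (simp add: smooth_chart_def)
  moreover have "p \<in> chart_dom e" using pW by (simp add: e(1))
  moreover have "chart_map e ` ((nodal_set M f - critical_zeros M A f) \<inter> chart_dom e) = {u \<in> chart_img e. u $ 2 = 0}"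
  proof -
    have "q \<in> nodal_set M f - critical_zeros M A f \<longleftrightarrow> chart_map e q $ 2 = 0" if q: "q \<in> W" for q
    proof -
      have qc: "q \<in> chart_dom c" "chart_map c q \<in> U" using q by (auto simp: W_def)
      have "q \<notin> critical_zeros M A f" using ne[OF qc(2)] qc(1) c(1) by (auto simp: critical_zeros_def)
      moreover have "chart_map e q $ 2 = f q"
        using coord_rep_map[OF ch[OF c(1)] qc(1), of f] by (simp add: e(2) straighten_def)
      ultimately show ?thesis using qc(1) C(3) by (auto simp: nodal_set_def)
    qed
    then show ?thesis unfolding e(1) by auto
  qed
  ultimately show "\<exists>c. smooth_chart M A c \<and> p \<in> chart_dom c \<and>
      chart_map c ` ((nodal_set M f - critical_zeros M A f) \<inter> chart_dom c) = {u \<in> chart_img c. u $ 2 = 0}"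
    by blast
qed

text \<open>In a chart around \<open>p\<close> this is \<open>critical_zeros_accumulate\<close>.\<close>

lemma accumulated_critical_zeros:
  assumes M: "riemannian_surface M A g"
    and sm: "smooth_fun A \<phi>" "smooth_fun A h" "smooth_fun A f"
    and eq: "\<forall>p\<in>topspace M. witten_laplacian A g \<phi> f p + h p * f p = 0"
    and p: "p \<in> M derived_set_of (critical_zeros M A f)"
  shows "\<exists>Q. openin M Q \<and> p \<in> Q \<and> (\<forall>q\<in>Q. f q = 0)"
proof -
  have S: "smooth_surface M A" and gm: "riemannian_metric A g" using M by (auto simp: riemannian_surface_def)
  have pt: "p \<in> topspace M" using p by (simp add: in_derived_set_of)
  then obtain c where c: "c \<in> A" "p \<in> chart_dom c" using S unfolding smooth_surface_def by blast
  have ch: "is_chart M c" using S c(1) by (simp add: smooth_surface_def)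
  note C = is_chartD[OF ch]
  let ?U = "chart_img c" and ?F = "coord_rep c f"
  have met: "smooth_on ?U (g c)" "\<And>u. u \<in> ?U \<Longrightarrow> inner_product_matrix (g c u)"
    using gm c(1) unfolding riemannian_metric_def by blast+
  have "coord_laplacian (g c) ?F u - coord_grad_inner (g c) (coord_rep c \<phi>) ?F u + coord_rep c h u * ?F u = 0"
    if u: "u \<in> ?U" for u
  proof -
    obtain q where q: "q \<in> chart_dom c" "u = chart_map c q" using u by blast
    have "witten_laplacian A g \<phi> f q + h q * f q = 0" using eq q C(3) by blast
    then show ?thesis
      unfolding witten_laplacian_def laplacian_eq[OF M sm(3) c(1) q(1)] grad_inner_eq[OF M sm(1,3) c(1) q(1)]
      by (simp add: q(2) coord_rep_map[OF ch q(1)])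
  qed
  then obtain a b k1 k2 k3 where "elliptic_equation ?U a b k1 k2 k3 ?F"
    using elliptic_equation_of_witten[OF C(2) met(1) met(2), of "coord_rep c \<phi>" "coord_rep c h" ?F] sm c
    unfolding smooth_fun_def by blast
  then interpret elliptic_equation ?U a b k1 k2 k3 ?F .
  have "\<forall>\<^sub>F y in nhds (chart_map c p). ?F y = 0"
  proof (rule critical_zeros_accumulate)
    show "chart_map c p \<in> ?U" using c(2) by blast
    show "chart_map c p islimpt {u \<in> ?U. ?F u = 0 \<and> f1 u = 0 \<and> f2 u = 0}"
    proof (rule islimptI)
      fix T assume T: "chart_map c p \<in> T" "open T"
      have "\<exists>q. q \<noteq> p \<and> q \<in> critical_zeros M A f \<and> q \<in> {q \<in> chart_dom c. chart_map c q \<in> T}"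
        using p[unfolded in_derived_set_of, THEN conjunct2, rule_format, of "{q \<in> chart_dom c. chart_map c q \<in> T}"]
          c(2) T(1) C(6)[OF T(2)] by simp
      then obtain q where q: "q \<noteq> p" "q \<in> critical_zeros M A f" "q \<in> chart_dom c" "chart_map c q \<in> T"
        by auto
      have "?F (chart_map c q) = 0" "f1 (chart_map c q) = 0" "f2 (chart_map c q) = 0"
        using q c(1) coord_rep_map[OF ch q(3), of f] by (auto simp: critical_zeros_def nodal_set_def)
      moreover have "chart_map c q \<noteq> chart_map c p" using C(4) q c(2) by (auto dest: inj_onD)
      ultimately show "\<exists>y\<in>{u \<in> ?U. ?F u = 0 \<and> f1 u = 0 \<and> f2 u = 0}. y \<in> T \<and> y \<noteq> chart_map c p"
        using q(3,4) by blast
    qed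
  qed
  then obtain T where T: "open T" "chart_map c p \<in> T" "\<And>y. y \<in> T \<Longrightarrow> ?F y = 0"
    unfolding eventually_nhds by blast
  show ?thesis
  proof (intro exI[of _ "{q \<in> chart_dom c. chart_map c q \<in> T}"] conjI ballI)
    show "openin M {q \<in> chart_dom c. chart_map c q \<in> T}" by (rule C(6)[OF T(1)])
    show "f q = 0" if "q \<in> {q \<in> chart_dom c. chart_map c q \<in> T}" for q
      using that T(3)[of "chart_map c q"] coord_rep_map[OF ch, of q f] by simp
  qed (use c T in auto)
qed

lemma locally_zero_imp_critical:
  assumes M: "smooth_surface M A" and Q: "openin M Q" "p \<in> Q" "\<And>q. q \<in> Q \<Longrightarrow> f q = 0"
  shows "p \<in> critical_zeros M A f"
  unfolding critical_zeros_def
proof (intro CollectI conjI ballI impI allI)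
  show "p \<in> nodal_set M f" using Q openin_subset[OF Q(1)] by (auto simp: nodal_set_def)
  fix c i assume c: "c \<in> A" "p \<in> chart_dom c"
  have ch: "is_chart M c" using M c(1) by (simp add: smooth_surface_def)
  let ?V = "chart_map c ` (chart_dom c \<inter> Q)"
  have V: "open ?V" by (rule chart_image_open[OF ch]) (use chart_dom_open[OF ch] Q in auto)
  have "partial_deriv i (coord_rep c f) (chart_map c p) = partial_deriv i (\<lambda>u. 0) (chart_map c p)"
    by (rule partial_deriv_cong[OF V]) (use c Q coord_rep_map[OF ch] in auto)
  then show "partial_deriv i (coord_rep c f) (chart_map c p) = 0" by (simp add: partial_deriv_def)
qed

theorem theorem1p4:
  fixes M :: "'a topology" and A :: "'a chart set" and g :: "'a metric_components"
    and \<phi> h f :: "'a \<Rightarrow> real"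
  assumes "riemannian_surface M A g"
    and "smooth_fun A \<phi>" and "smooth_fun A h" and "smooth_fun A f"
    and "\<forall>p\<in>topspace M. witten_laplacian A g \<phi> f p + h p * f p = 0"
    and "\<forall>C\<in>connected_components_of M. \<exists>p\<in>C. f p \<noteq> 0"
  shows "\<exists>S. S \<subseteq> nodal_set M f \<and> M derived_set_of S = {} \<and>
           smooth_curve M A (nodal_set M f - S)"
proof (intro exI[of _ "critical_zeros M A f"] conjI)
  have S: "smooth_surface M A" using assms(1) by (simp add: riemannian_surface_def)
  show "critical_zeros M A f \<subseteq> nodal_set M f" by (auto simp: critical_zeros_def)
  show "smooth_curve M A (nodal_set M f - critical_zeros M A f)"
    by (rule smooth_curve_regular_zeros[OF S assms(4)])
  (* E is open by definition and closed because it is contained in the set of critical zeros,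
     all of whose accumulation points lie in E *)
  define E where "E = {p. \<exists>Q. openin M Q \<and> p \<in> Q \<and> (\<forall>q\<in>Q. f q = 0)}"
  have DE: "M derived_set_of critical_zeros M A f \<subseteq> E"
    using accumulated_critical_zeros[OF assms(1-5)] by (auto simp: E_def)
  have oE: "openin M E" by (subst openin_subopen) (unfold E_def, blast)
  have "E \<subseteq> critical_zeros M A f"
    using locally_zero_imp_critical[OF S] by (auto simp: E_def)
  then have "M derived_set_of E \<subseteq> E" using DE derived_set_of_mono by blast
  then have cE: "closedin M E" using oE by (simp add: closedin_contains_derived_set openin_subset)
  have False if p: "p \<in> M derived_set_of critical_zeros M A f" for p
  proof -
    have pt: "p \<in> topspace M" using p by (simp add: in_derived_set_of)
    let ?C = "connected_component_of_set M p"
    have C: "?C \<in> connected_components_of M" using pt by (simp add: connected_components_of_def)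
    have pC: "p \<in> ?C" using pt by (simp add: connected_component_of_refl)
    have "connectedin M ?C" by (rule connectedin_connected_component_of)
    then have "?C \<subseteq> E"
      using connectedin_clopen_cases[OF _ cE oE] pC p DE by (force simp: disjnt_def)
    moreover obtain q where "q \<in> ?C" "f q \<noteq> 0" using assms(6) C by blast
    ultimately show False unfolding E_def by blast
  qed
  then show "M derived_set_of critical_zeros M A f = {}" by blast
qed

end
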